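(* Let $n\ge1$, let $m>0$, and let $\gamma\in L^\infty(\mathbb{R}^n)$ with $\gamma\ge0$. Assume that there exist $\epsilon>0$ and a nonempty open set $\Omega\subset\mathbb{R}^n$, invariant under translations by $2\pi\mathbb{Z}^n$, such that $\gamma(x)\ge\epsilon$ for a.e. $x\in\Omega$. Then there exists a constant $C>0$, independent of $s$, such that for all $s\in\mathbb{R}$ and all $u\in H^2(\mathbb{R}^n)$, $f\in L^2(\mathbb{R}^n)$ with $$(\Delta+m\,\mathrm{Id}+is\,\gamma(x)-s^2\,\mathrm{Id})u=f\quad\text{on }\mathbb{R}^n,$$ one has $$\|u\|_{L^2(\mathbb{R}^n)}\le C(1+|s|)\,\|f\|_{L^2(\mathbb{R}^n)}.$$
   Context: $\Delta=-\sum_{j=1}^n\partial_{x_j}^2$ denotes the nonnegative Laplace operator on $\mathbb{R}^n$. Functions are complex-valued. *)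

theory Defs
  imports "HOL-Analysis.Analysis"
begin

(* Elements of the function spaces below are representatives: functions defined everywhere,
   with almost-everywhere equality made explicit where it matters. *)

definition L2 :: "(real ^ 'n \<Rightarrow> complex) set" where
  "L2 = {u \<in> borel_measurable lebesgue. integrable lebesgue (\<lambda>x. (norm (u x))\<^sup>2)}"

definition L2_norm :: "(real ^ 'n \<Rightarrow> complex) \<Rightarrow> real" where
  "L2_norm u = sqrt (LINT x|lebesgue. (norm (u x))\<^sup>2)"

definition Linfty :: "(real ^ 'n \<Rightarrow> real) set" where
  "Linfty = {g \<in> borel_measurable lebesgue. \<exists>B. AE x in lebesgue. \<bar>g x\<bar> \<le> B}"

definition L1_loc :: "(real ^ 'n \<Rightarrow> complex) set" where
  "L1_loc = {u. \<forall>K. compact K \<longrightarrow> set_integrable lebesgue K u}"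

definition partial :: "'n \<Rightarrow> (real ^ 'n \<Rightarrow> complex) \<Rightarrow> real ^ 'n \<Rightarrow> complex" where
  "partial j f x = frechet_derivative f (at x) (axis j 1)"

primrec C_k :: "nat \<Rightarrow> (real ^ 'n \<Rightarrow> complex) set" where
  "C_k 0 = {f. continuous_on UNIV f}"
| "C_k (Suc k) = {f. (\<forall>x. f differentiable (at x)) \<and> (\<forall>j. partial j f \<in> C_k k)}"

definition test_functions :: "(real ^ 'n \<Rightarrow> complex) set" where
  "test_functions = {\<phi>. (\<forall>k. \<phi> \<in> C_k k) \<and> compact (closure {x. \<phi> x \<noteq> 0})}"

(* Local integrability is demanded because the Bochner integral of a non-integrable function
   is 0, so the integral identity alone would not be meaningful. *)
definition weak_partial ::
    "'n \<Rightarrow> (real ^ 'n \<Rightarrow> complex) \<Rightarrow> (real ^ 'n \<Rightarrow> complex) \<Rightarrow> bool" where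
  "weak_partial j u v \<longleftrightarrow> u \<in> L1_loc \<and> v \<in> L1_loc \<and>
     (\<forall>\<phi>\<in>test_functions.
        (LINT x|lebesgue. u x * partial j \<phi> x) = - (LINT x|lebesgue. v x * \<phi> x))"

(* sobolev k is the space H^k. *)
primrec sobolev :: "nat \<Rightarrow> (real ^ 'n \<Rightarrow> complex) set" where
  "sobolev 0 = L2"
| "sobolev (Suc k) = {u \<in> L2. \<forall>j. \<exists>v\<in>sobolev k. weak_partial j u v}"

(* v represents the nonnegative Laplacian of u, minus the sum of the pure second weak
   derivatives; v is determined by u up to a null set. *)
definition is_laplacian :: "(real ^ 'n \<Rightarrow> complex) \<Rightarrow> (real ^ 'n \<Rightarrow> complex) \<Rightarrow> bool" where
  "is_laplacian u v \<longleftrightarrow> (\<exists>g h.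
     (\<forall>j. weak_partial j u (g j) \<and> weak_partial j (g j) (h j)) \<and>
     (AE x in lebesgue. v x = - (\<Sum>j\<in>UNIV. h j x)))"

end

theory Submission
  imports Defs
begin

text \<open>Pairing the equation with \<open>u\<close> disposes of everything but one inequality. The imaginary part gives
  \<open>s * \<integral> \<gamma> * |u|\<^sup>2 = Im \<integral> f * cnj u\<close>, and for \<open>s\<^sup>2 \<le> m / 2\<close> the real part alone bounds \<open>u\<close>.
  For larger \<open>|s|\<close> put \<open>\<mu> = s\<^sup>2 - m\<close>, so that \<open>(\<Delta> - \<mu>) u = f - i s \<gamma> u\<close>, and fix a continuous
  \<open>2\<pi>\<close>-periodic weight \<open>0 \<le> \<psi> \<le> 1\<close> that is not identically zero and vanishes off \<open>\<Omega>\<close>. If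
  \<open>\<parallel>u\<parallel>\<^sup>2 \<le> C * (\<parallel>(\<Delta> - \<mu>) u\<parallel>\<^sup>2 + \<integral> \<psi> * |u|\<^sup>2)\<close> with \<open>C\<close> independent of \<open>\<mu>\<close>, then both terms
  on the right are controlled by \<open>f\<close> and \<open>\<integral> \<gamma> * |u|\<^sup>2\<close>, and the theorem follows by absorption
  (\<open>damped_resolvent_bound\<close>).

  To prove that inequality, multiply \<open>u\<close> by a wide cutoff and expand it in a Fourier series on the
  cell \<open>[-\<pi>N, \<pi>N]\<^sup>n\<close>, whose frequencies form the lattice of vectors with coordinates in
  \<open>(1/N) \<int>\<close>. Frequencies outside the shell \<open>| |k|\<^sup>2 - \<mu> | \<le> 1\<close> are controlled by
  \<open>(\<Delta> - \<mu>) u\<close>. What remains is an uncertainty principle (\<open>shell_bound\<close>): for trigonometric sums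
  with frequencies in the shell, the mean of \<open>\<psi> * |p|\<^sup>2\<close> is at least \<open>c\<close> times the mean of
  \<open>|p|\<^sup>2\<close>, with \<open>c\<close> independent of \<open>\<mu>\<close> and \<open>N\<close>. Letting \<open>N\<close> tend to infinity gives the
  inequality on the whole space (\<open>whole_space_estimate\<close>).

  The uncertainty principle rests on three facts. First, \<open>\<psi>\<close> is uniformly close to a trigonometric
  polynomial with finitely many integer frequencies, of length at most \<open>R\<close> say; multiplication by it
  couples only frequencies whose difference is integral and no longer than \<open>R\<close>, so up to a small
  error the quadratic form splits over the \<open>R\<close>-chained clusters of frequencies
  (\<open>weighted_partition\<close>). Second, a short difference \<open>h\<close> of two frequencies of the shell satisfies
  \<open>|2 h \<bullet> k + |h|\<^sup>2| \<le> 2\<close>, so \<open>h\<close> is nearly orthogonal to \<open>k\<close>; if a cluster spans all directions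
  of the frequency set under consideration (one coset of the integer lattice at a time), then the
  component of \<open>k\<close> in these directions is bounded, and so is the diameter of that set
  (\<open>cluster_diameter\<close>). Third, for frequencies in a bounded part of one coset of the integer
  lattice there is only a finite-dimensional statement to prove, and applying difference operators
  isolates one coefficient at a time (\<open>single_coefficient_bound\<close>).

  These facts combine by induction on the dimension of the span of the frequency differences
  (\<open>ex_coset_bound\<close>). The order of the choices keeps the argument from being circular: the constant
  for dimension \<open>d\<close> determines the accuracy of the approximation and thereby \<open>R\<close>. Then either all
  clusters have dimension at most \<open>d\<close> and the old constant applies to each of them, or the full
  frequency set has diameter bounded in terms of \<open>R\<close> and the finite-dimensional statement supplies
  the constant for dimension \<open>d + 1\<close>.\<close>

section \<open>Frequencies in a thin shell\<close>

definition lattice :: "nat \<Rightarrow> (real ^ 'n) set" where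
  "lattice N = {k. \<forall>j. real N * k $ j \<in> \<int>}"

definition shell :: "real \<Rightarrow> (real ^ 'n) set" where
  "shell \<mu> = {k. \<bar>(norm k)\<^sup>2 - \<mu>\<bar> \<le> 1}"

definition differences :: "(real ^ 'n) set \<Rightarrow> (real ^ 'n) set" where
  "differences A = {k - l | k l. k \<in> A \<and> l \<in> A}"

text \<open>Connectedness of the graph that joins points at distance at most \<open>R\<close>, expressed by cuts: every
  proper nonempty part has an edge leaving it. This form makes it easy to grow a connected set by
  one vertex.\<close>

definition chained :: "real \<Rightarrow> (real ^ 'n) set \<Rightarrow> bool" where
  "chained R B \<longleftrightarrow> (\<forall>C. C \<subseteq> B \<longrightarrow> C \<noteq> {} \<longrightarrow> C \<noteq> B \<longrightarrow>
     (\<exists>c\<in>C. \<exists>b\<in>B - C. norm (b - c) \<le> R))"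

lemma lattice_zero [simp]: "0 \<in> lattice N"
  by (simp add: lattice_def)

lemma lattice_add: "k \<in> lattice N \<Longrightarrow> l \<in> lattice N \<Longrightarrow> k + l \<in> lattice N"
  by (auto simp: lattice_def distrib_left)

lemma lattice_uminus: "k \<in> lattice N \<Longrightarrow> - k \<in> lattice N"
  by (auto simp: lattice_def)

lemma lattice_diff: "k \<in> lattice N \<Longrightarrow> l \<in> lattice N \<Longrightarrow> k - l \<in> lattice N"
  by (auto simp: lattice_def right_diff_distrib)

lemma lattice_one_subset: "lattice 1 \<subseteq> lattice N"
  by (auto simp: lattice_def)

lemma finite_lattice_ball:
  assumes "N > 0"
  shows "finite {k \<in> (lattice N :: (real ^ 'n) set). norm k \<le> R}"
proof -
  let ?I = "(\<lambda>i::int. real_of_int i / real N) ` {- \<lceil>real N * R\<rceil> .. \<lceil>real N * R\<rceil>}"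
  let ?P = "PiE (UNIV :: 'n set) (\<lambda>_. ?I)"
  have "finite ?P" by (intro finite_PiE) auto
  moreover have "{k \<in> (lattice N :: (real ^ 'n) set). norm k \<le> R} \<subseteq> (\<lambda>f. \<chi> j. f j) ` ?P"
  proof
    fix k :: "real ^ 'n" assume k: "k \<in> {k \<in> lattice N. norm k \<le> R}"
    have "k $ j \<in> ?I" for j
    proof -
      obtain i where i: "real N * k $ j = real_of_int i"
        using k by (auto simp: lattice_def elim: Ints_cases)
      have "\<bar>k $ j\<bar> \<le> R" using k component_le_norm_cart[of k j] by auto
      hence "real N * \<bar>k $ j\<bar> \<le> real N * R" by (intro mult_left_mono) auto
      hence "\<bar>real_of_int i\<bar> \<le> real N * R" using i by (metis abs_mult abs_of_nat)
      hence "i \<in> {- \<lceil>real N * R\<rceil> .. \<lceil>real N * R\<rceil>}"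
        by auto (simp_all add: abs_le_iff, linarith+)
      moreover have "k $ j = real_of_int i / real N" using i assms by (simp add: field_simps)
      ultimately show ?thesis by blast
    qed
    hence "(\<lambda>j. k $ j) \<in> ?P" by auto
    thus "k \<in> (\<lambda>f. \<chi> j. f j) ` ?P" by (rule rev_image_eqI) (simp add: vec_eq_iff)
  qed
  ultimately show ?thesis by (meson finite_imageI finite_subset)
qed

text \<open>\<open>K\<close> is a norm bound for expressing vectors of the span through \<open>H\<close>: a vector almost orthogonal to
  every element of \<open>H\<close> is almost orthogonal to the whole span.\<close>

definition span_inner_bound :: "real \<Rightarrow> (real ^ 'n) set \<Rightarrow> bool" where
  "span_inner_bound K H \<longleftrightarrow> K \<ge> 0 \<and> (\<forall>w E z. (\<forall>h\<in>H. \<bar>h \<bullet> w\<bar> \<le> E) \<longrightarrow> E \<ge> 0 \<longrightarrow> z \<in> span H \<longrightarrow>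
     \<bar>z \<bullet> w\<bar> \<le> K * E * norm z)"

lemma span_inner_boundD:
  "span_inner_bound K H \<Longrightarrow> (\<And>h. h \<in> H \<Longrightarrow> \<bar>h \<bullet> w\<bar> \<le> E) \<Longrightarrow> E \<ge> 0 \<Longrightarrow> z \<in> span H \<Longrightarrow> \<bar>z \<bullet> w\<bar> \<le> K * E * norm z"
  by (simp add: span_inner_bound_def)

text \<open>An orthonormal basis of the span consists of fixed linear combinations of \<open>H\<close>, and \<open>K\<close> is the sum
  of the absolute values of their coefficients.\<close>

lemma inner_bound_on_span:
  fixes H :: "(real ^ 'n) set"
  assumes "finite H"
  shows "\<exists>K. span_inner_bound K H"
proof -
  obtain B where B: "B \<subseteq> span H" "pairwise orthogonal B" "\<And>x. x \<in> B \<Longrightarrow> norm x = 1"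
     "independent B" "span B = span H"
    using orthonormal_basis_subspace[OF subspace_span[of H]] by metis
  have finB: "finite B" using B(4) by (simp add: independent_imp_finite)
  have "\<forall>b\<in>B. \<exists>u. b = (\<Sum>h\<in>H. u h *\<^sub>R h)"
    using B(1) span_finite[OF assms] by auto
  then obtain u where u: "\<And>b. b \<in> B \<Longrightarrow> b = (\<Sum>h\<in>H. u b h *\<^sub>R h)" by metis
  let ?K = "\<Sum>b\<in>B. \<Sum>h\<in>H. \<bar>u b h\<bar>"
  have "\<bar>z \<bullet> w\<bar> \<le> ?K * E * norm z" if h: "\<forall>h\<in>H. \<bar>h \<bullet> w\<bar> \<le> E" and E: "E \<ge> 0" and z: "z \<in> span H" for w E z
  proof -
    have bw: "\<bar>b \<bullet> w\<bar> \<le> (\<Sum>h\<in>H. \<bar>u b h\<bar>) * E" if "b \<in> B" for b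
    proof -
      have "b \<bullet> w = (\<Sum>h\<in>H. u b h *\<^sub>R h) \<bullet> w" using u[OF that] by (rule arg_cong)
      also have "\<dots> = (\<Sum>h\<in>H. u b h * (h \<bullet> w))" by (simp add: inner_sum_left)
      finally have "\<bar>b \<bullet> w\<bar> = \<bar>\<Sum>h\<in>H. u b h * (h \<bullet> w)\<bar>" by simp
      also have "\<dots> \<le> (\<Sum>h\<in>H. \<bar>u b h\<bar> * E)"
        by (rule order_trans[OF sum_abs]) (auto simp: abs_mult intro!: sum_mono mult_left_mono
            h[rule_format])
      finally show ?thesis by (simp add: sum_distrib_right)
    qed
    have "z = (\<Sum>b\<in>B. (z \<bullet> b) *\<^sub>R b)"
    proof (rule sym, rule orthonormal_basis_expand)
    qed (use B z finB in auto)
    hence "z \<bullet> w = (\<Sum>b\<in>B. (z \<bullet> b) *\<^sub>R b) \<bullet> w" by simp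
    also have "\<dots> = (\<Sum>b\<in>B. (z \<bullet> b) * (b \<bullet> w))" by (simp add: inner_sum_left)
    finally have "\<bar>z \<bullet> w\<bar> = \<bar>\<Sum>b\<in>B. (z \<bullet> b) * (b \<bullet> w)\<bar>" by simp
    also have "\<dots> \<le> (\<Sum>b\<in>B. norm z * ((\<Sum>h\<in>H. \<bar>u b h\<bar>) * E))"
    proof (rule order_trans[OF sum_abs], rule sum_mono)
      fix b assume b: "b \<in> B"
      have "\<bar>z \<bullet> b\<bar> \<le> norm z" using Cauchy_Schwarz_ineq2[of z b] B(3)[OF b] by simp
      thus "\<bar>(z \<bullet> b) * (b \<bullet> w)\<bar> \<le> norm z * ((\<Sum>h\<in>H. \<bar>u b h\<bar>) * E)"
        unfolding abs_mult by (intro mult_mono bw b) auto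
    qed
    also have "\<dots> = ?K * E * norm z" by (simp add: sum_distrib_left sum_distrib_right mult_ac)
    finally show ?thesis .
  qed
  moreover have "?K \<ge> 0" by (intro sum_nonneg) auto
  ultimately show ?thesis unfolding span_inner_bound_def by blast
qed

text \<open>Only finitely many sets of integer vectors have all their elements in a given ball, so one
  constant serves for all of them.\<close>

lemma inner_bound_on_lattice_spans:
  "\<exists>K\<ge>0. \<forall>H \<subseteq> {k \<in> (lattice 1 :: (real ^ 'n) set). norm k \<le> R}. span_inner_bound K H"
proof -
  let ?S = "{k \<in> (lattice 1 :: (real ^ 'n) set). norm k \<le> R}"
  have fin: "finite ?S" by (rule finite_lattice_ball) simp
  hence "\<forall>H\<in>Pow ?S. \<exists>K. span_inner_bound K H"
    by (intro ballI inner_bound_on_span) (auto intro: finite_subset)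
  from bchoice[OF this] obtain K where K: "\<forall>H\<in>Pow ?S. span_inner_bound (K H) H" by blast
  have K0: "\<And>H. H \<in> Pow ?S \<Longrightarrow> K H \<ge> 0" using K by (auto simp: span_inner_bound_def)
  let ?K = "\<Sum>H\<in>Pow ?S. K H"
  have nonneg: "?K \<ge> 0" by (intro sum_nonneg K0) auto
  have "span_inner_bound ?K H" if H: "H \<in> Pow ?S" for H
    unfolding span_inner_bound_def
  proof (intro conjI allI impI)
    fix w z :: "real ^ 'n" and E :: real
    assume *: "\<forall>h\<in>H. \<bar>h \<bullet> w\<bar> \<le> E" "0 \<le> E" "z \<in> span H"
    have "\<bar>z \<bullet> w\<bar> \<le> K H * E * norm z"
      using span_inner_boundD[OF bspec[OF K H]] * by blast
    also have "K H \<le> ?K" using H fin K0 by (intro member_le_sum) auto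
    hence "K H * E * norm z \<le> ?K * E * norm z" using * by (intro mult_right_mono) auto
    finally show "\<bar>z \<bullet> w\<bar> \<le> ?K * E * norm z" .
  qed (rule nonneg)
  thus ?thesis using nonneg by (intro exI[of _ ?K]) auto
qed

lemma differences_mono: "A \<subseteq> B \<Longrightarrow> differences A \<subseteq> differences B"
  by (auto simp: differences_def)

lemma chained_insert:
  assumes C: "chained R C" and "c \<in> C" "norm (b - c) \<le> R"
  shows "chained R (insert b C)"
  unfolding chained_def
proof (intro allI impI)
  fix X assume X: "X \<subseteq> insert b C" "X \<noteq> {}" "X \<noteq> insert b C"
  consider "X \<inter> C = {}" | "C \<subseteq> X" | "X \<inter> C \<noteq> {}" "X \<inter> C \<noteq> C" by blast
  thus "\<exists>c\<in>X. \<exists>d\<in>insert b C - X. norm (d - c) \<le> R"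
  proof cases
    case 1
    hence "X = {b}" using X by auto
    thus ?thesis using assms 1 by (metis Diff_iff disjoint_iff insertI1 insertI2 norm_minus_commute)
  next
    case 2
    hence "b \<notin> X" using X by auto
    thus ?thesis using assms 2 by blast
  next
    case 3
    then obtain c' d where "c' \<in> X \<inter> C" "d \<in> C - X \<inter> C" "norm (d - c') \<le> R"
      using C unfolding chained_def by (metis Int_lower2)
    thus ?thesis by blast
  qed
qed

text \<open>In any set \<open>A\<close> of frequencies from one shell and one coset of the integer lattice, a single chained
  subset \<open>B\<close> of dimension at most \<open>d\<close> that spans the same directions as \<open>A\<close> forces \<open>A\<close> to have
  diameter at most \<open>D\<close>. The type argument records the ambient dimension.\<close>

definition diameter_bound :: "real \<Rightarrow> nat \<Rightarrow> real \<Rightarrow> ('n::finite) itself \<Rightarrow> bool" where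
  "diameter_bound R d D _ \<longleftrightarrow> D \<ge> 0 \<and>
     (\<forall>\<mu> A. \<forall>B :: (real ^ 'n) set. finite B \<longrightarrow> B \<noteq> {} \<longrightarrow> B \<subseteq> A \<longrightarrow> A \<subseteq> shell \<mu> \<longrightarrow>
        differences A \<subseteq> lattice 1 \<longrightarrow> chained R B \<longrightarrow>
        span (differences B) = span (differences A) \<longrightarrow> dim (differences B) \<le> d \<longrightarrow>
        (\<forall>k\<in>A. \<forall>l\<in>A. norm (k - l) \<le> D))"

text \<open>Let \<open>B\<close> be a cluster of dimension \<open>d + 1\<close>. Inside it there is a maximal chained part \<open>C\<close> of
  dimension at most \<open>d\<close> through a given \<open>k\<close>, and by induction \<open>C\<close> has bounded diameter. One more
  vertex \<open>b\<close> adjacent to \<open>C\<close> gives bounded integer vectors from \<open>k\<close> that span all directions of \<open>B\<close>.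
  Each of them is nearly orthogonal to \<open>k\<close>, since \<open>k\<close> and its translate lie in the same shell, so
  \<open>k\<close> is nearly orthogonal to every \<open>z\<close> in the span, with an error linear in \<open>|z|\<close>. If \<open>k + z\<close> also
  lies in the shell then \<open>|z|\<^sup>2 \<le> 2 + 2 |z \<bullet> k|\<close>, which bounds \<open>|z|\<close>.\<close>

lemma cluster_diameter:
  assumes "R \<ge> 0"
  shows "\<exists>D. diameter_bound R d D TYPE('n::finite)"
proof (induction d)
  case 0
  have "norm (k - l) \<le> 0" if "span (differences B) = span (differences A)" "dim (differences B) \<le> 0"
      "k \<in> A" "l \<in> A"
    for A B :: "(real ^ 'n) set" and k l
  proof -
    have "differences B \<subseteq> {0}" using that(2) dim_eq_0[of "differences B"] by simp
    hence "span (differences B) \<subseteq> span {0}" by (rule span_mono)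
    hence "span (differences A) \<subseteq> {0}" using that(1) by simp
    moreover have "k - l \<in> span (differences A)" using that
        by (auto simp: differences_def intro!: span_base)
    ultimately show ?thesis by auto
  qed
  thus ?case unfolding diameter_bound_def by (intro exI[of _ 0]) blast
next
  case (Suc d)
  then obtain D0 where "diameter_bound R d D0 TYPE('n)" by blast
  hence D0: "D0 \<ge> 0"
    "\<And>\<mu> A B k l. finite (B :: (real ^ 'n) set) \<Longrightarrow> B \<noteq> {} \<Longrightarrow> B \<subseteq> A \<Longrightarrow> A \<subseteq> shell \<mu> \<Longrightarrow>
        differences A \<subseteq> lattice 1 \<Longrightarrow>
     chained R B \<Longrightarrow> span (differences B) = span (differences A) \<Longrightarrow> dim (differences B) \<le> d \<Longrightarrow>
     k \<in> A \<Longrightarrow> l \<in> A \<Longrightarrow> norm (k - l) \<le> D0" unfolding diameter_bound_def by blast+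
  define R' where "R' = D0 + R"
  obtain K where K: "K \<ge> 0" "\<And>H. H \<subseteq> {k \<in> (lattice 1 :: (real ^ 'n) set). norm k \<le> R'} \<Longrightarrow>
      span_inner_bound K H"
    using inner_bound_on_lattice_spans[where ?'n='n and R=R'] by blast
  define E where "E = (2 + R'\<^sup>2) / 2"
  have E: "E \<ge> 0" by (simp add: E_def)
  define D where "D = max D0 (2 * (2 + 2 * K * E))"
  have main: "norm (x - y) \<le> D" if fin: "finite B" and ne: "B \<noteq> {}" and BA: "B \<subseteq> A" and A: "A \<subseteq> shell \<mu>"
      and lat: "differences A \<subseteq> lattice 1" and
     ch: "chained R B" and sp: "span (differences B) = span (differences A)"
         and dim: "dim (differences B) \<le> Suc d" and xy: "x \<in> A" "y \<in> A"
    for \<mu> x y and A B :: "(real ^ 'n) set"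
  proof (cases "dim (differences B) \<le> d")
    case True
    thus ?thesis using D0(2)[OF fin ne BA A lat ch sp _ xy] by (simp add: D_def)
  next
    case False
    with dim have dimB: "dim (differences B) = Suc d" by simp
    obtain k where k: "k \<in> B" using ne by auto
    \<comment> \<open>the chained parts of \<open>B\<close> through \<open>k\<close> to which the induction hypothesis applies\<close>
    define F where "F = {C. C \<subseteq> B \<and> k \<in> C \<and> chained R C \<and> dim (differences C) \<le> d}"
    have "finite F" unfolding F_def using fin by simp
    moreover have "{k} \<in> F"
    proof -
      have "differences {k} = {0}" by (auto simp: differences_def)
      hence "dim (differences {k}) \<le> d" by (metis dim_eq_0 le0 order_refl)
      moreover have "chained R {k}" by (auto simp: chained_def)
      ultimately show ?thesis using k by (simp add: F_def)
    qed
    ultimately obtain C where C: "C \<in> F" and max: "\<And>C'. C' \<in> F \<Longrightarrow> C \<subseteq> C' \<Longrightarrow> C = C'"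
      using finite_has_maximal[of F] by (metis empty_iff)
    have C': "C \<subseteq> B" "k \<in> C" "chained R C" "dim (differences C) \<le> d" using C by (auto simp: F_def)
    have "C \<noteq> B" using C'(4) dimB by auto
    then obtain c b where cb: "c \<in> C" "b \<in> B - C" "norm (b - c) \<le> R"
      using ch C' unfolding chained_def by (metis empty_iff)
    define H where "H = (\<lambda>x. x - k) ` insert b C"
    have sub: "insert b C \<subseteq> B" using C' cb by auto
    have "insert b C \<notin> F" using max[of "insert b C"] cb by auto
    hence dimC: "dim (differences (insert b C)) \<ge> Suc d"
      using sub C' chained_insert[OF C'(3) cb(1,3)] by (auto simp: F_def)
    have "span (differences (insert b C)) \<subseteq> span H"
    proof (rule span_minimal)
      show "differences (insert b C) \<subseteq> span H"
      proof
        fix z assume "z \<in> differences (insert b C)"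
        then obtain p q where "z = p - q" "p \<in> insert b C" "q \<in> insert b C"
            by (auto simp: differences_def)
        moreover have "p - q = (p - k) - (q - k)" by simp
        ultimately show "z \<in> span H" unfolding H_def
          by (metis image_eqI span_base span_diff)
      qed
    qed simp
    moreover have "span (differences (insert b C)) = span (differences B)"
      by (rule dim_eq_span[OF differences_mono[OF sub]]) (use dimB dimC in simp)
    ultimately have spH: "span (differences A) \<subseteq> span H" using sp by simp
    have finC: "finite C" using C' fin finite_subset by blast
    have CA: "C \<subseteq> A" using C' BA by auto
    have dC: "norm (z - k) \<le> D0" if "z \<in> C" for z
    proof (rule D0(2)[OF finC _ order_refl _ _ C'(3) refl C'(4)])
      show "C \<noteq> {}" using C' by auto
      show "C \<subseteq> shell \<mu>" using CA A by auto
      show "differences C \<subseteq> lattice 1" using differences_mono[OF CA] lat by auto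
    qed (use that C' in auto)
    have H: "H \<subseteq> {k \<in> lattice 1. norm k \<le> R'}"
    proof
      fix h assume "h \<in> H"
      then obtain z where z: "z \<in> insert b C" "h = z - k" by (auto simp: H_def)
      have "h \<in> differences A" using z sub BA k by (auto simp: differences_def)
      moreover have "norm h \<le> R'"
      proof (cases "z = b")
        case True
        have "norm (b - k) \<le> norm (b - c) + norm (c - k)" by norm
        thus ?thesis using True z cb dC[OF cb(1)] by (simp add: R'_def)
      next
        case False
        thus ?thesis using z dC[of z] assms by (simp add: R'_def)
      qed
      ultimately show "h \<in> {k \<in> lattice 1. norm k \<le> R'}" using lat by auto
    qed
    have kA: "k \<in> A" using k BA by auto
    have sq: "\<bar>(norm z)\<^sup>2 + 2 * (z \<bullet> k)\<bar> \<le> 2" if "z + k \<in> A" for z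
    proof -
      have "(norm (z + k))\<^sup>2 = (norm z)\<^sup>2 + 2 * (z \<bullet> k) + (norm k)\<^sup>2"
        by (simp add: power2_norm_eq_inner inner_add_left inner_add_right inner_commute)
      moreover have "\<bar>(norm (z + k))\<^sup>2 - \<mu>\<bar> \<le> 1" "\<bar>(norm k)\<^sup>2 - \<mu>\<bar> \<le> 1"
        using that kA A by (auto simp: shell_def)
      ultimately show ?thesis by linarith
    qed
    have hk: "\<bar>h \<bullet> k\<bar> \<le> E" if "h \<in> H" for h
    proof -
      have "h + k \<in> A" using that sub BA by (auto simp: H_def)
      moreover have "(norm h)\<^sup>2 \<le> R'\<^sup>2" using that H by (intro power_mono) auto
      moreover have "(norm h)\<^sup>2 \<ge> 0" by simp
      moreover have "2 * E = 2 + R'\<^sup>2" by (simp add: E_def)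
      ultimately show ?thesis using sq[of h] by linarith
    qed
    have near: "norm (z - k) \<le> 2 + 2 * K * E" if "z \<in> A" for z
    proof (rule ccontr)
      let ?t = "norm (z - k)"
      assume n: "\<not> ?thesis"
      have "z - k \<in> span H" using that kA
          by (intro subsetD[OF spH] span_base) (auto simp: differences_def)
      hence 1: "\<bar>(z - k) \<bullet> k\<bar> \<le> K * E * ?t" using span_inner_boundD[OF K(2)[OF H] hk E] by blast
      have "?t\<^sup>2 \<le> 2 + 2 * K * E * ?t" using sq[of "z - k"] that 1 by (simp add: abs_le_iff)
      moreover have "K * E \<ge> 0" using K E by simp
      moreover have "2 * ?t + 2 * K * E * ?t < ?t * ?t"
      proof -
        have "(2 + 2 * K * E) * ?t < ?t * ?t"
          using n \<open>K * E \<ge> 0\<close> by (intro mult_strict_right_mono) auto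
        thus ?thesis by (simp add: distrib_right)
      qed
      moreover have "?t > 2" using n \<open>K * E \<ge> 0\<close> by simp
      ultimately show False by (simp add: power2_eq_square)
    qed
    have "norm (x - y) \<le> norm (x - k) + norm (y - k)" by norm
    thus ?thesis using near[OF xy(1)] near[OF xy(2)] by (simp add: D_def)
  qed
  have "D \<ge> 0" using D0 by (simp add: D_def)
  hence "diameter_bound R (Suc d) D TYPE('n)"
    unfolding diameter_bound_def by (intro conjI allI impI ballI) (assumption, rule main)
  thus ?case by blast
qed

definition near_rel :: "real \<Rightarrow> (real ^ 'n) set \<Rightarrow> ((real ^ 'n) \<times> (real ^ 'n)) set" where
  "near_rel R A = {(k, l). k \<in> A \<and> l \<in> A \<and> norm (k - l) \<le> R}\<^sup>* \<inter> A \<times> A"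

lemma equiv_near_rel: "equiv A (near_rel R A)"
proof (rule equivI)
  let ?s = "{(k, l). k \<in> A \<and> l \<in> A \<and> norm (k - l) \<le> R}"
  have "sym ?s" by (auto simp: sym_def norm_minus_commute)
  hence "sym (?s\<^sup>*)" by (rule sym_rtrancl)
  thus "sym (near_rel R A)" unfolding near_rel_def sym_def by blast
  show "trans (near_rel R A)" unfolding near_rel_def by (intro transI) (auto intro: rtrancl_trans)
  show "refl_on A (near_rel R A)" by (auto simp: near_rel_def refl_on_def)
  show "near_rel R A \<subseteq> A \<times> A" by (auto simp: near_rel_def)
qed

lemma chained_near_rel_class:
  assumes "B \<in> A // near_rel R A"
  shows "chained R B"
  unfolding chained_def
proof (intro allI impI)
  let ?s = "{(k, l). k \<in> A \<and> l \<in> A \<and> norm (k - l) \<le> R}"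
  fix C assume C: "C \<subseteq> B" "C \<noteq> {}" "C \<noteq> B"
  then obtain x y where x: "x \<in> C" and y: "y \<in> B" "y \<notin> C" by blast
  have "(x, y) \<in> near_rel R A"
    using quotient_eq_iff[OF equiv_near_rel assms assms] x y C by blast
  hence xy: "(x, y) \<in> ?s\<^sup>*" by (simp add: near_rel_def)
  have BA: "B \<subseteq> A" using assms equiv_near_rel in_quotient_imp_subset by blast
  have "y \<notin> C \<longrightarrow> (\<exists>c\<in>C. \<exists>b\<in>A - C. (x, c) \<in> ?s\<^sup>* \<and> (c, b) \<in> ?s)"
    using xy
  proof (induction rule: rtrancl_induct)
    case base show ?case using x by simp
  next
    case (step y z)
    show ?case
    proof (cases "y \<in> C")
      case True
      thus ?thesis using step by auto
    qed (use step in auto)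
  qed
  then obtain c b where cb: "c \<in> C" "b \<in> A - C" "(c, b) \<in> ?s" using y by blast
  have "(c, b) \<in> near_rel R A" using cb C BA by (auto simp: near_rel_def)
  hence "b \<in> B" using assms cb(1) C(1) equiv_near_rel[of A R] by (meson in_quotient_imp_closed subsetD)
  thus "\<exists>c\<in>C. \<exists>b\<in>B - C. norm (b - c) \<le> R" using cb
      by (intro bexI[of _ c] bexI[of _ b]) (auto simp: norm_minus_commute[of b c])
qed

section \<open>Waves and their means over cells\<close>

definition wave :: "real ^ 'n \<Rightarrow> real ^ 'n \<Rightarrow> complex" where
  "wave k x = cis (k \<bullet> x)"

definition cell :: "nat \<Rightarrow> (real ^ 'n) set" where
  "cell N = cbox (\<chi> j. - (pi * real N)) (\<chi> j. pi * real N)"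

abbreviation cell_measure :: "nat \<Rightarrow> (real ^ 'n) measure" where
  "cell_measure N \<equiv> lebesgue_on (cell N)"

definition cell_volume :: "nat \<Rightarrow> 'n::finite itself \<Rightarrow> real" where
  "cell_volume N _ = (2 * pi * real N) ^ CARD('n)"

definition mean :: "nat \<Rightarrow> (real ^ 'n \<Rightarrow> 'b::{banach, second_countable_topology}) \<Rightarrow> 'b" where
  "mean N f = (LINT x|cell_measure N. f x) /\<^sub>R cell_volume N TYPE('n)"

abbreviation sum_norm_sq :: "(real ^ 'n) set \<Rightarrow> (real ^ 'n \<Rightarrow> complex) \<Rightarrow> real" where
  "sum_norm_sq A a \<equiv> \<Sum>k\<in>A. (norm (a k))\<^sup>2"

definition trig :: "(real ^ 'n) set \<Rightarrow> (real ^ 'n \<Rightarrow> complex) \<Rightarrow> real ^ 'n \<Rightarrow> complex" where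
  "trig A a x = (\<Sum>k\<in>A. a k * wave k x)"

lemma norm_wave [simp]: "norm (wave k x) = 1"
  by (simp add: wave_def)

lemma wave_0 [simp]: "wave 0 x = 1"
  by (simp add: wave_def)

lemma wave_add: "wave (k + l) x = wave k x * wave l x"
  by (simp add: wave_def inner_add_left cis_mult)

lemma wave_translate: "wave k (x + y) = wave k y * wave k x"
  by (simp add: wave_def inner_add_right cis_mult add.commute)

lemma cnj_wave: "cnj (wave k x) = wave (- k) x"
  by (simp add: wave_def cis_cnj)

lemma wave_diff: "wave (k - l) x = wave k x * cnj (wave l x)"
  by (simp add: wave_def inner_diff_left cis_cnj cis_mult)

lemma continuous_on_wave [continuous_intros]: "continuous_on S (wave k)"
  unfolding wave_def by (intro continuous_intros)

lemma continuous_on_trig [continuous_intros]: "continuous_on S (trig A a)"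
  unfolding trig_def by (intro continuous_intros)

lemma compact_cell: "compact (cell N)"
  by (simp add: cell_def)

lemma cell_sets [simp, measurable]: "cell N \<in> sets lebesgue" "cell N \<in> sets borel"
  by (auto simp: cell_def)

lemma cell_volume_pos: "N > 0 \<Longrightarrow> cell_volume N TYPE('n::finite) > 0"
  by (simp add: cell_volume_def)

lemma integrable_on_cell:
  fixes f :: "real ^ 'n \<Rightarrow> 'b::euclidean_space"
  assumes "continuous_on UNIV f"
  shows "integrable (cell_measure N) f"
  unfolding cell_def by (rule continuous_imp_integrable) (use assms continuous_on_subset in blast)

lemma integral_on_cell:
  fixes f :: "real ^ 'n \<Rightarrow> 'b::{banach, second_countable_topology}"
  assumes [measurable]: "f \<in> borel_measurable borel"
  shows "(LINT x|cell_measure N. f x) = (LINT x|lborel. indicator (cell N) x *\<^sub>R f x)"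
  by (subst integral_restrict_space, simp, rule integral_completion) measurable

text \<open>Lebesgue measure is the product of its one-dimensional copies, one for each basis vector.\<close>

lemma lborel_integral_prod:
  fixes f :: "'a::euclidean_space \<Rightarrow> real \<Rightarrow> complex"
  assumes int: "\<And>b. b \<in> Basis \<Longrightarrow> integrable lborel (f b)"
  shows "(LINT x|lborel. (\<Prod>b\<in>Basis. f b (x \<bullet> b))) = (\<Prod>b\<in>Basis. LINT t|lborel. f b t)"
proof -
  interpret product_sigma_finite "\<lambda>_::'a. lborel :: real measure" by standard
  have [measurable]: "f b \<in> borel_measurable borel" if "b \<in> Basis" for b
    using int[OF that] by simp
  have "(LINT x|lborel. (\<Prod>b\<in>Basis. f b (x \<bullet> b)))
      = (LINT y|(\<Pi>\<^sub>M b\<in>(Basis::'a set). lborel). (\<Prod>b\<in>Basis. f b ((\<Sum>c\<in>Basis. y c *\<^sub>R c) \<bullet> b)))"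
    by (subst lborel_eq, rule integral_distr) measurable
  also have "\<dots> = (LINT y|(\<Pi>\<^sub>M b\<in>(Basis::'a set). lborel). (\<Prod>b\<in>Basis. f b (y b)))"
    by (intro Bochner_Integration.integral_cong refl prod.cong) (simp add: inner_sum_left_Basis)
  also have "\<dots> = (\<Prod>b\<in>Basis. LINT t|lborel. f b t)"
    by (intro product_integral_prod int) auto
  finally show ?thesis .
qed

lemma integral_cis_period:
  assumes "N > 0" "real N * \<kappa> \<in> \<int>"
  shows "(LINT t|lborel. indicator {-(pi * real N)..pi * real N} t *\<^sub>R cis (\<kappa> * t))
         = (if \<kappa> = 0 then of_real (2 * pi * real N) else 0)"
proof (cases "\<kappa> = 0")
  case True
  have "(LINT t|lborel. indicator {-(pi * real N)..pi * real N} t *\<^sub>R (1::complex))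
      = of_real (pi * real N) - of_real (-(pi * real N))"
    by (rule integral_FTC_Icc) (auto intro!: derivative_eq_intros continuous_intros simp:
        has_vector_derivative_def scaleR_conv_of_real)
  thus ?thesis using True by simp
next
  case False
  define F where "F t = cis (\<kappa> * t) / (\<i> * of_real \<kappa>)" for t
  have "(LINT t|lborel. indicator {-(pi * real N)..pi * real N} t *\<^sub>R cis (\<kappa> * t)) = F (pi * real N)
      - F (-(pi * real N))"
  proof (rule integral_FTC_Icc)
    fix t
    let ?A = "\<i> * complex_of_real \<kappa>"
    have "((\<lambda>t. exp (t *\<^sub>R ?A) * inverse ?A) has_vector_derivative exp (t *\<^sub>R ?A) * ?A * inverse ?A)
        (at t within {-(pi * real N)..pi * real N})"
      by (intro has_vector_derivative_mult_left exp_scaleR_has_vector_derivative_right)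
    moreover have "(\<lambda>t. exp (t *\<^sub>R ?A) * inverse ?A) = F"
      by (auto simp: F_def cis_conv_exp scaleR_conv_of_real field_simps)
    moreover have "exp (t *\<^sub>R ?A) * ?A * inverse ?A = cis (\<kappa> * t)"
      using False by (simp add: cis_conv_exp scaleR_conv_of_real field_simps)
    ultimately show "(F has_vector_derivative cis (\<kappa> * t)) (at t within {-(pi * real N)..pi * real N})"
      by simp
  qed (auto intro!: continuous_intros)
  also have "\<dots> = 0"
  proof -
    have "sin (real N * \<kappa> * pi) = 0" using assms(2) by (simp add: sin_times_pi_eq_0)
    hence "cis (\<kappa> * (pi * real N)) = cis (- (\<kappa> * (pi * real N)))"
      by (simp add: complex_eq_iff mult_ac)
    thus ?thesis by (simp add: F_def)
  qed
  finally show ?thesis using False by simp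
qed

lemma integral_wave_cell:
  assumes N: "N > 0" and k: "k \<in> lattice N"
  shows "(LINT x|cell_measure N. wave (k :: real ^ 'n) x)
      = (if k = 0 then of_real (cell_volume N TYPE('n)) else 0)"
proof -
  let ?f = "\<lambda>b t. indicator {-(pi * real N)..pi * real N} t *\<^sub>R cis ((k \<bullet> b) * t)"
  have eq: "indicator (cell N) x *\<^sub>R wave k x = (\<Prod>b\<in>Basis. ?f b (x \<bullet> b))" for x
  proof -
    have "indicator (cell N) x = (\<Prod>b\<in>Basis. indicator {-(pi * real N)..pi * real N} (x \<bullet> b) :: real)"
    proof -
      have "(x \<in> cell N) = (\<forall>b\<in>Basis. x \<bullet> b \<in> {-(pi * real N)..pi * real N})"
        by (auto simp: cell_def cbox_def inner_axis Basis_vec_def)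
      moreover have "(\<Prod>b\<in>Basis. indicator {-(pi * real N)..pi * real N} (x \<bullet> b) :: real) =
          (if \<forall>b\<in>Basis. x \<bullet> b \<in> {-(pi * real N)..pi * real N} then 1 else 0)"
        by (auto simp: indicator_def prod_zero_iff)
      ultimately show ?thesis by (simp add: indicator_def)
    qed
    moreover have "wave k x = (\<Prod>b\<in>Basis. cis ((k \<bullet> b) * (x \<bullet> b)))"
      by (simp add: wave_def cis_conv_exp euclidean_inner[of k x] sum_distrib_left exp_sum)
    ultimately show ?thesis by (simp add: scaleR_conv_of_real prod.distrib)
  qed
  have "(LINT x|cell_measure N. wave k x) = (LINT x|lborel. (\<Prod>b\<in>Basis. ?f b (x \<bullet> b)))"
    by (subst integral_on_cell) (auto simp: eq intro!: borel_measurable_continuous_onI continuous_on_wave)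
  also have "\<dots> = (\<Prod>b\<in>Basis. LINT t|lborel. ?f b t)"
    by (intro lborel_integral_prod borel_integrable_compact continuous_intros) auto
  also have "\<dots> = (\<Prod>b\<in>(Basis :: (real ^ 'n) set). if k \<bullet> b = 0 then of_real (2 * pi * real N) else 0)"
    by (intro prod.cong refl integral_cis_period N)
        (use k in \<open>auto simp: Basis_vec_def inner_axis lattice_def\<close>)
  also have "\<dots> = (if k = 0 then of_real (cell_volume N TYPE('n)) else 0)"
  proof (cases "k = 0")
    case False
    then obtain b where "b \<in> Basis" "k \<bullet> b \<noteq> 0" using euclidean_eqI[of k 0] by auto
    thus ?thesis using False by (auto simp: prod_zero_iff intro!: bexI[of _ b])
  qed (simp add: cell_volume_def)
  finally show ?thesis .
qed

lemma mean_wave: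
  assumes "N > 0" and "k \<in> lattice N"
  shows "mean N (wave (k :: real ^ 'n)) = (if k = 0 then 1 else 0)"
  using integral_wave_cell[OF assms] cell_volume_pos[OF assms(1), where ?'n='n]
      by (simp add: mean_def scaleR_conv_of_real)

lemma emeasure_cell:
  "emeasure lebesgue (cell N :: (real ^ 'n) set) = ennreal (cell_volume N TYPE('n))"
proof -
  have "emeasure lborel (cell N :: (real ^ 'n) set)
      = (\<Prod>b\<in>(Basis::(real^'n) set). ((\<chi> j. pi * real N) - (\<chi> j. - (pi * real N))) \<bullet> b)"
    unfolding cell_def by (rule emeasure_lborel_cbox) (auto simp: Basis_vec_def inner_axis)
  also have "(\<Prod>b\<in>(Basis::(real^'n) set). ((\<chi> j. pi * real N) - (\<chi> j. - (pi * real N))) \<bullet> b)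
      = (\<Prod>b\<in>(Basis::(real^'n) set). 2 * pi * real N)"
    by (intro prod.cong refl) (auto simp: Basis_vec_def inner_axis)
  finally show ?thesis by (simp add: cell_volume_def)
qed

lemma finite_measure_cell: "finite_measure (lebesgue_on (cell N :: (real ^ 'n) set))"
  by (rule finite_measureI) (simp add: emeasure_restrict_space emeasure_cell)

lemma mean_cong: "(\<And>x. f x = g x) \<Longrightarrow> mean N f = mean N g"
  by (simp add: mean_def)

lemma mean_of_real: "complex_of_real (mean N f) = mean N (\<lambda>x. complex_of_real (f x))"
  by (simp add: mean_def scaleR_conv_of_real)

lemma mean_cmult: "mean N (\<lambda>x. c * f x) = c * mean N (f :: real ^ 'n \<Rightarrow> complex)"
  by (simp add: mean_def)

lemma mean_const: "N > 0 \<Longrightarrow> mean N (\<lambda>x :: real ^ 'n. c) = (c :: complex)"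
  using mean_cmult[of N c "wave (0 :: real ^ 'n)"] mean_wave[of N "0 :: real ^ 'n"] by simp

lemma mean_diff:
  fixes f g :: "real ^ 'n \<Rightarrow> 'b::euclidean_space"
  assumes "continuous_on UNIV f" "continuous_on UNIV g"
  shows "mean N f - mean N g = mean N (\<lambda>x. f x - g x)"
  unfolding mean_def
  by (subst Bochner_Integration.integral_diff) (auto intro!: integrable_on_cell assms simp:
      scaleR_diff_right)

lemma mean_sum:
  fixes f :: "'i \<Rightarrow> real ^ 'n \<Rightarrow> complex"
  assumes "\<And>i. i \<in> I \<Longrightarrow> continuous_on UNIV (f i)"
  shows "mean N (\<lambda>x. \<Sum>i\<in>I. f i x) = (\<Sum>i\<in>I. mean N (f i))"
  unfolding mean_def
  by (subst Bochner_Integration.integral_sum) (auto intro!: integrable_on_cell assms simp: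
      scaleR_right.sum)

text \<open>Orthogonality of the waves turns the mean of a weighted square into a finite sum over pairs of
  frequencies. Two things are read off from the right-hand side: it does not depend on \<open>N\<close>, and a
  pair contributes only if its difference is a frequency of the weight.\<close>

lemma mean_trig_weight:
  fixes A F :: "(real ^ 'n) set"
  assumes N: "N > 0" and F: "F \<subseteq> lattice N" and A: "differences A \<subseteq> lattice N"
  shows "mean N (\<lambda>x. trig F c x * of_real ((norm (trig A a x))\<^sup>2)) =
    (\<Sum>k\<in>A. \<Sum>l\<in>A. a k * cnj (a l) * (\<Sum>h\<in>F. if h + k - l = 0 then c h else 0))"
proof -
  have "trig F c x * of_real ((norm (trig A a x))\<^sup>2) =
     (\<Sum>k\<in>A. \<Sum>l\<in>A. \<Sum>h\<in>F. a k * cnj (a l) * c h * wave (h + k - l) x)" for x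
  proof -
    have "trig F c x * of_real ((norm (trig A a x))\<^sup>2) =
       (\<Sum>h\<in>F. c h * wave h x) * (\<Sum>k\<in>A. \<Sum>l\<in>A. (a k * wave k x) * cnj (a l * wave l x))"
      unfolding complex_norm_square trig_def cnj_sum sum_product ..
    also have "\<dots> = (\<Sum>k\<in>A. \<Sum>l\<in>A. \<Sum>h\<in>F. (c h * wave h x) * ((a k * wave k x) * cnj (a l * wave l x)))"
      by (subst sum_distrib_left, intro sum.cong refl, subst sum_distrib_left, intro sum.cong refl, rule
          sum_distrib_right)
    also have "\<dots> = (\<Sum>k\<in>A. \<Sum>l\<in>A. \<Sum>h\<in>F. a k * cnj (a l) * c h * wave (h + k - l) x)"
      by (intro sum.cong refl) (simp add: wave_diff wave_add)
    finally show ?thesis .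
  qed
  hence "mean N (\<lambda>x. trig F c x * of_real ((norm (trig A a x))\<^sup>2)) =
     mean N (\<lambda>x. \<Sum>k\<in>A. \<Sum>l\<in>A. \<Sum>h\<in>F. a k * cnj (a l) * c h * wave (h + k - l) x)"
    by (rule mean_cong)
  also have "\<dots> = (\<Sum>k\<in>A. \<Sum>l\<in>A. \<Sum>h\<in>F. a k * cnj (a l) * c h * mean N (wave (h + k - l)))"
    by (simp add: mean_sum mean_cmult continuous_intros)
  also have "\<dots> = (\<Sum>k\<in>A. \<Sum>l\<in>A. a k * cnj (a l) * (\<Sum>h\<in>F. if h + k - l = 0 then c h else 0))"
  proof (intro sum.cong refl)
    fix k l assume kl: "k \<in> A" "l \<in> A"
    have "h + k - l \<in> lattice N" if "h \<in> F" for h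
    proof -
      have "k - l \<in> lattice N" using A kl by (auto simp: differences_def)
      moreover have "h \<in> lattice N" using F that by auto
      ultimately have "h + (k - l) \<in> lattice N" by (rule lattice_add[rotated])
      thus ?thesis by (simp add: algebra_simps)
    qed
    hence "(\<Sum>h\<in>F. a k * cnj (a l) * c h * mean N (wave (h + k - l)))
        = (\<Sum>h\<in>F. a k * cnj (a l) * (if h + k - l = 0 then c h else 0))"
      by (intro sum.cong refl) (simp add: mean_wave[OF N])
    thus "(\<Sum>h\<in>F. a k * cnj (a l) * c h * mean N (wave (h + k - l)))
        = a k * cnj (a l) * (\<Sum>h\<in>F. if h + k - l = 0 then c h else 0)"
      by (simp add: sum_distrib_left)
  qed
  finally show ?thesis .
qed

lemma mean_norm_trig:
  fixes A :: "(real ^ 'n) set"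
  assumes N: "N > 0" and fin: "finite A" and A: "differences A \<subseteq> lattice N"
  shows "mean N (\<lambda>x. (norm (trig A a x))\<^sup>2) = sum_norm_sq A a"
proof -
  have "complex_of_real (mean N (\<lambda>x. (norm (trig A a x))\<^sup>2))
      = mean N (\<lambda>x. trig {0} (\<lambda>_. 1) x * of_real ((norm (trig A a x))\<^sup>2))"
    by (simp add: mean_of_real trig_def)
  also have "\<dots> = (\<Sum>k\<in>A. \<Sum>l\<in>A. a k * cnj (a l) * (if k = l then 1 else 0))"
    by (subst mean_trig_weight[OF N _ A]) auto
  also have "\<dots> = (\<Sum>k\<in>A. a k * cnj (a k))"
    using fin by (intro sum.cong refl) (simp add: if_distrib[of "\<lambda>x. _ * x"] cong: if_cong)
  also have "\<dots> = complex_of_real (sum_norm_sq A a)" by (simp flip: complex_norm_square)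
  finally show ?thesis using of_real_eq_iff by blast
qed

lemma mean_weight_approx:
  fixes A :: "(real ^ 'n) set"
  assumes N: "N > 0" and fin: "finite A" and A: "differences A \<subseteq> lattice N"
    and \<psi>: "continuous_on UNIV \<psi>" and approx: "\<And>x. norm (complex_of_real (\<psi> x) - trig F c x) \<le> \<eta>"
  shows "norm (complex_of_real (mean N (\<lambda>x. \<psi> x * (norm (trig A a x))\<^sup>2))
     - mean N (\<lambda>x. trig F c x * of_real ((norm (trig A a x))\<^sup>2))) \<le> \<eta> * sum_norm_sq A a"
proof -
  let ?P = "\<lambda>x. (norm (trig A a x))\<^sup>2" and ?V = "cell_volume N TYPE('n)"
  have cP: "continuous_on UNIV ?P" by (intro continuous_intros)
  have "complex_of_real (mean N (\<lambda>x. \<psi> x * ?P x)) - mean N (\<lambda>x. trig F c x * of_real (?P x))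
     = mean N (\<lambda>x. complex_of_real (\<psi> x * ?P x) - trig F c x * of_real (?P x))"
    unfolding mean_of_real by (intro mean_diff continuous_intros \<psi> cP)
  also have "\<dots> = (LINT x|cell_measure N. (complex_of_real (\<psi> x) - trig F c x) * of_real (?P x)) /\<^sub>R ?V"
    by (simp add: mean_def left_diff_distrib)
  also have "norm \<dots> = norm (LINT x|cell_measure N. (complex_of_real (\<psi> x) - trig F c x) * of_real (?P x))
      /\<^sub>R ?V"
    by (simp add: cell_volume_def)
  also have "\<dots> \<le> (LINT x|cell_measure N. \<eta> * ?P x) /\<^sub>R ?V"
  proof (intro scaleR_left_mono order_trans[OF integral_norm_bound] integral_mono)
    show "integrable (cell_measure N) (\<lambda>x. norm ((complex_of_real (\<psi> x) - trig F c x) * of_real (?P x)))"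
      by (intro integrable_on_cell continuous_intros \<psi> cP)
    show "integrable (cell_measure N) (\<lambda>x. \<eta> * ?P x)"
      by (intro integrable_on_cell continuous_intros cP)
    show "norm ((complex_of_real (\<psi> x) - trig F c x) * of_real (?P x)) \<le> \<eta> * ?P x" for x
      using mult_right_mono[OF approx[of x], of "?P x"] by (simp add: norm_mult norm_power)
  qed (simp add: cell_volume_def)
  also have "\<dots> = \<eta> * mean N ?P" by (simp add: mean_def)
  also have "\<dots> = \<eta> * sum_norm_sq A a" by (simp add: mean_norm_trig[OF N fin A])
  finally show ?thesis .
qed

section \<open>Trigonometric approximation\<close>

text \<open>Composing functions on the torus with \<open>torus_map N\<close> produces functions of period \<open>2\<pi>N\<close> in every
  coordinate, and turns polynomials in the real and imaginary parts of the coordinates into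
  trigonometric polynomials. The Stone-Weierstrass theorem can thus be applied on the torus.\<close>

definition torus_map :: "nat \<Rightarrow> real ^ 'n \<Rightarrow> complex ^ 'n" where
  "torus_map N x = (\<chi> j. cis (x $ j / real N))"

definition torus :: "(complex ^ 'n) set" where
  "torus = {z. \<forall>j. norm (z $ j) = 1}"

inductive trig_poly :: "nat \<Rightarrow> (real ^ 'n \<Rightarrow> complex) \<Rightarrow> bool" for N where
  monomial: "k \<in> lattice N \<Longrightarrow> trig_poly N (\<lambda>x. c * wave k x)"
| add: "trig_poly N f \<Longrightarrow> trig_poly N g \<Longrightarrow> trig_poly N (\<lambda>x. f x + g x)"

lemma trig_poly_const: "trig_poly N (\<lambda>x. c)"
  using trig_poly.monomial[OF lattice_zero, of N c] by simp

lemma trig_poly_mult: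
  assumes "trig_poly N f" "trig_poly N g"
  shows "trig_poly N (\<lambda>x. f x * g x)"
  using assms(1)
proof induction
  case (monomial k c)
  show ?case using assms(2)
  proof induction
    case (monomial l d)
    have "trig_poly N (\<lambda>x. (c * d) * wave (k + l) x)"
      by (intro trig_poly.monomial lattice_add \<open>k \<in> lattice N\<close> monomial)
    thus ?case by (simp add: wave_add mult_ac)
  next
    case (add f g)
    thus ?case using trig_poly.add[OF add.IH] by (simp add: distrib_left)
  qed
next
  case (add f1 f2)
  thus ?case using trig_poly.add[OF add.IH] by (simp add: distrib_right)
qed

lemma trig_poly_sum: "finite I \<Longrightarrow> (\<And>i. i \<in> I \<Longrightarrow> trig_poly N (f i)) \<Longrightarrow> trig_poly N (\<lambda>x. \<Sum>i\<in>I. f i x)"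
  by (induction I rule: finite_induct) (auto intro: trig_poly_const trig_poly.add)

lemma trig_add:
  assumes "finite F" "finite G"
  shows "\<exists>e. \<forall>x. trig F c x + trig G d x = trig (F \<union> G) e x"
proof -
  define e where "e k = (if k \<in> F then c k else 0) + (if k \<in> G then d k else 0)" for k
  have "trig F c x + trig G d x = trig (F \<union> G) e x" for x
  proof -
    have "trig (F \<union> G) e x = (\<Sum>k\<in>F \<union> G. (if k \<in> F then c k * wave k x else 0))
        + (\<Sum>k\<in>F \<union> G. (if k \<in> G then d k * wave k x else 0))"
      unfolding trig_def e_def sum.distrib[symmetric] by (intro sum.cong) (auto simp: algebra_simps)
    also have "\<dots> = (\<Sum>k\<in>(F \<union> G) \<inter> F. c k * wave k x) + (\<Sum>k\<in>(F \<union> G) \<inter> G. d k * wave k x)"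
      using assms by (simp only: sum.inter_restrict finite_UnI)
    also have "\<dots> = trig F c x + trig G d x" by (simp add: trig_def Int_absorb1)
    finally show ?thesis by simp
  qed
  thus ?thesis by blast
qed

lemma trig_poly_eq_trig:
  assumes "trig_poly N f"
  shows "\<exists>F c. finite F \<and> F \<subseteq> lattice N \<and> f = trig F c"
  using assms
proof induction
  case (monomial k c)
  thus ?case by (intro exI[of _ "{k}"] exI[of _ "\<lambda>_. c"]) (auto simp: trig_def)
next
  case (add f g)
  then obtain F c G d where *: "finite F" "F \<subseteq> lattice N" "f = trig F c" "finite G" "G \<subseteq> lattice N"
      "g = trig G d" by blast
  then obtain e where "\<And>x. trig F c x + trig G d x = trig (F \<union> G) e x" using trig_add by metis
  thus ?case using * by (intro exI[of _ "F \<union> G"] exI[of _ e]) auto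
qed

lemma trig_poly_coordinate:
  assumes N: "N > 0"
  shows "trig_poly N (\<lambda>x :: real ^ 'n. complex_of_real (cos (x $ j / real N)))"
    "trig_poly N (\<lambda>x :: real ^ 'n. complex_of_real (sin (x $ j / real N)))"
proof -
  let ?k = "axis j (1 / real N) :: real ^ 'n"
  have k: "?k \<in> lattice N" using N by (auto simp: lattice_def axis_def)
  have w: "wave ?k x = cis (x $ j / real N)" "wave (- ?k) x = cis (- (x $ j / real N))"
      for x :: "real ^ 'n"
    by (simp_all add: wave_def inner_axis inner_commute[of "axis _ _"])
  have "trig_poly N (\<lambda>x. 1/2 * wave ?k x + 1/2 * wave (- ?k) x)"
    by (intro trig_poly.intros lattice_uminus k)
  also have "(\<lambda>x. 1/2 * wave ?k x + 1/2 * wave (- ?k) x)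
      = (\<lambda>x :: real ^ 'n. complex_of_real (cos (x $ j / real N)))"
    by (rule ext) (simp add: w complex_eq_iff)
  finally show "trig_poly N (\<lambda>x :: real ^ 'n. complex_of_real (cos (x $ j / real N)))" .
  have "trig_poly N (\<lambda>x. - \<i>/2 * wave ?k x + \<i>/2 * wave (- ?k) x)"
    by (intro trig_poly.intros lattice_uminus k)
  also have "(\<lambda>x. - \<i>/2 * wave ?k x + \<i>/2 * wave (- ?k) x)
      = (\<lambda>x :: real ^ 'n. complex_of_real (sin (x $ j / real N)))"
    by (rule ext) (simp add: w complex_eq_iff)
  finally show "trig_poly N (\<lambda>x :: real ^ 'n. complex_of_real (sin (x $ j / real N)))" .
qed

text \<open>A linear functional of the torus coordinates is a combination of cosines and sines; sums and
  products stay within trigonometric polynomials.\<close>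

lemma trig_poly_polynomial_function:
  assumes N: "N > 0" and "real_polynomial_function (g :: complex ^ 'n \<Rightarrow> real)"
  shows "trig_poly N (\<lambda>x. complex_of_real (g (torus_map N x)))"
  using assms(2)
proof induction
  case (linear f)
  interpret bounded_linear f by fact
  have "f (torus_map N x) = (\<Sum>j\<in>UNIV. cos (x $ j / real N) * f (axis j 1) + sin (x $ j / real N) * f
      (axis j \<i>))" for x
  proof -
    have "torus_map N x = (\<Sum>j\<in>UNIV. cos (x $ j / real N) *\<^sub>R axis j 1 + sin (x $ j / real N) *\<^sub>R axis j
        \<i>)"
      unfolding vec_eq_iff
    proof
      fix i
      have "(\<Sum>j\<in>UNIV. cos (x $ j / real N) *\<^sub>R axis j 1 + sin (x $ j / real N) *\<^sub>R axis j \<i>) $ i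
          = (\<Sum>j\<in>UNIV. if j = i then cis (x $ i / real N) else 0)"
        unfolding sum_component by (intro sum.cong) (auto simp: axis_def complex_eq_iff)
      thus "torus_map N x $ i = (\<Sum>j\<in>UNIV. cos (x $ j / real N) *\<^sub>R axis j 1 + sin (x $ j / real N) *\<^sub>R
          axis j \<i>) $ i"
        by (simp add: torus_map_def)
    qed
    thus ?thesis by (simp add: sum add scaleR)
  qed
  moreover have "trig_poly N (\<lambda>x. \<Sum>j\<in>UNIV. complex_of_real (cos (x $ j / real N)) * complex_of_real
      (f (axis j 1))
     + complex_of_real (sin (x $ j / real N)) * complex_of_real (f (axis j \<i>)))"
    by (intro trig_poly_sum trig_poly.add trig_poly_mult trig_poly_const trig_poly_coordinate N) auto
  ultimately show ?case by simp
next
  case (const c)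
  show ?case by (rule trig_poly_const)
next
  case (add f g)
  thus ?case using trig_poly.add[OF add.IH] by simp
next
  case (mult f g)
  thus ?case using trig_poly_mult[OF mult.IH] by simp
qed

lemma torus_map_in_torus: "torus_map N x \<in> torus"
  by (simp add: torus_def torus_map_def)

lemma continuous_on_torus_map [continuous_intros]: "continuous_on S (torus_map N)"
  unfolding torus_map_def divide_inverse by (intro continuous_intros)

lemma compact_torus: "compact (torus :: (complex ^ 'n) set)"
proof -
  have "closed (torus :: (complex ^ 'n) set)" unfolding torus_def
    by (intro closed_Collect_all closed_Collect_eq continuous_intros)
  moreover have "bounded (torus :: (complex ^ 'n) set)"
    unfolding bounded_iff
  proof (intro exI ballI)
    fix z :: "complex ^ 'n" assume "z \<in> torus"
    thus "norm z \<le> CARD('n)"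
      using L2_set_le_sum[of UNIV "\<lambda>i. norm (z $ i)"] by (simp add: torus_def norm_vec_def)
  qed
  ultimately show ?thesis by (simp add: compact_eq_bounded_closed)
qed

proposition trig_approximation:
  assumes N: "N > 0" and g: "continuous_on torus (g :: complex ^ 'n \<Rightarrow> real)" and e: "\<eta> > 0"
  shows "\<exists>F c. finite F \<and> F \<subseteq> lattice N \<and> (\<forall>x. norm (complex_of_real (g (torus_map N x)) - trig F c x)
      \<le> \<eta>)"
proof -
  obtain p where p: "real_polynomial_function p" "\<And>z. z \<in> torus \<Longrightarrow> \<bar>g z - p z\<bar> < \<eta>"
    using Stone_Weierstrass_real_polynomial_function[OF compact_torus g e] by blast
  obtain F c where F: "finite F" "F \<subseteq> lattice N" "(\<lambda>x. complex_of_real (p (torus_map N x))) = trig F c"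
    using trig_poly_eq_trig[OF trig_poly_polynomial_function[OF N p(1)]] by blast
  have "norm (complex_of_real (g (torus_map N x)) - trig F c x) \<le> \<eta>" for x
    using p(2)[OF torus_map_in_torus[of N x]] unfolding F(3)[symmetric]
    by (simp flip: of_real_diff)
  thus ?thesis using F by blast
qed

section \<open>Finitely many frequencies\<close>

lemma integrable_ball:
  fixes f :: "'a::euclidean_space \<Rightarrow> real"
  assumes "continuous_on UNIV f"
  shows "integrable lborel (\<lambda>x. indicator (ball x0 r) x *\<^sub>R f x)"
proof -
  have "set_integrable lborel (cball x0 r) f"
    unfolding set_integrable_def by (rule borel_integrable_compact)
        (auto intro: continuous_on_subset[OF assms])
  hence "set_integrable lborel (ball x0 r) f"
    by (rule set_integrable_subset) auto
  thus ?thesis by (simp add: set_integrable_def)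
qed

lemma norm_add_squared_le: "(norm (u + v))\<^sup>2 \<le> 2 * (norm u)\<^sup>2 + 2 * (norm (v :: complex))\<^sup>2"
proof -
  have "(norm (u + v))\<^sup>2 \<le> (norm u + norm v)\<^sup>2" by (intro power_mono norm_triangle_ineq) auto
  also have "\<dots> \<le> 2 * (norm u)\<^sup>2 + 2 * (norm v)\<^sup>2"
    using sum_squares_bound[of "norm u" "norm v"] by (simp add: power2_sum)
  finally show ?thesis .
qed

text \<open>Induction on the set of competing frequencies. To remove a frequency \<open>l\<close>, replace the sum \<open>p\<close> by
  \<open>p (x + y) - wave l y * p x\<close>: this kills the coefficient at \<open>l\<close> and multiplies the one at \<open>h\<close> by
  \<open>wave h y - wave l y\<close>, which is nonzero for a short \<open>y\<close> in the direction of \<open>h - l\<close>. The shift costs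
  only a smaller ball, which is why the radius is general in the induction.\<close>

lemma single_coefficient_bound:
  fixes K :: "(real ^ 'n) set"
  assumes "finite K" "h \<notin> K" "r > 0"
  shows "\<exists>c>0. \<forall>a. c * (norm (a h))\<^sup>2 \<le> (LINT x|lborel. indicator (ball x0 r) x *\<^sub>R
      (norm (trig (insert h K) a x))\<^sup>2)"
  using assms
proof (induction K arbitrary: r rule: finite_induct)
  case empty
  have "measure lborel (ball x0 r) * (norm (a h))\<^sup>2
      \<le> (LINT x|lborel. indicator (ball x0 r) x *\<^sub>R (norm (trig (insert h {}) a x))\<^sup>2)" for a
    using emeasure_bounded_finite[OF bounded_ball, of x0 r] by (simp add: trig_def norm_mult)
  moreover have "measure lborel (ball x0 r) > 0" using content_ball_pos[OF empty(2)]
      by (simp add: measure_def)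
  ultimately show ?case by blast
next
  case (insert l K)
  have hl: "h \<noteq> l" "h \<notin> K" using insert by auto
  define d where "d = norm (h - l)"
  have d: "d > 0" using hl by (simp add: d_def)
  \<comment> \<open>The first entry makes the shift shorter than \<open>r / 2\<close>; the second keeps the phase
  \<open>(h - l) \<bullet> y = t * d\<^sup>2\<close> in \<open>(0, 1]\<close>, hence away from the multiples of \<open>2\<pi>\<close>.\<close>
  define t where "t = min (r / (4 * d)) (1 / d\<^sup>2)"
  have t: "t > 0" "t * d < r / 2" "t * d\<^sup>2 \<le> 1"
  proof -
    show "t > 0" using d insert.prems by (simp add: t_def)
    have "t * d \<le> r / (4 * d) * d" using d by (intro mult_right_mono) (auto simp: t_def)
    also have "\<dots> < r / 2" using d insert.prems by simp
    finally show "t * d < r / 2" .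
    have "t * d\<^sup>2 \<le> (1 / d\<^sup>2) * d\<^sup>2" using d by (intro mult_right_mono) (auto simp: t_def)
    thus "t * d\<^sup>2 \<le> 1" using d by simp
  qed
  define y where "y = t *\<^sub>R (h - l)"
  have ny: "norm y < r / 2" using t by (simp add: y_def d_def)
  have ne: "wave h y - wave l y \<noteq> 0"
  proof
    assume "wave h y - wave l y = 0"
    hence "wave (h - l) y = 1" by (simp add: wave_diff complex_norm_square[symmetric])
    hence "cos (t * d\<^sup>2) = 1" by (simp add: wave_def y_def d_def power2_norm_eq_inner complex_eq_iff)
    moreover have "t * d\<^sup>2 > 0" using t d by simp
    moreover have "cos (t * d\<^sup>2) < cos 0"
      using t d pi_gt3 by (intro cos_monotone_0_pi) auto
    ultimately show False by simp
  qed
  obtain c where c: "c > 0" "\<And>a. c * (norm (a h))\<^sup>2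
      \<le> (LINT x|lborel. indicator (ball x0 (r/2)) x *\<^sub>R (norm (trig (insert h K) a x))\<^sup>2)"
    using insert.IH[of "r/2"] insert.prems hl by auto
  let ?c = "c * (norm (wave h y - wave l y))\<^sup>2 / 4"
  have "?c * (norm (a h))\<^sup>2 \<le> (LINT x|lborel. indicator (ball x0 r) x *\<^sub>R
      (norm (trig (insert h (insert l K)) a x))\<^sup>2)" for a
  proof -
    let ?p = "trig (insert h (insert l K)) a"
    define b where "b k = a k * (wave k y - wave l y)" for k
    have q: "trig (insert h K) b x = ?p (x + y) - wave l y * ?p x" for x
    proof -
      have "?p (x + y) - wave l y * ?p x = (\<Sum>k\<in>insert h (insert l K). b k * wave k x)"
        unfolding trig_def sum_distrib_left sum_subtractf[symmetric]
        by (intro sum.cong) (auto simp: b_def wave_translate algebra_simps)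
      also have "\<dots> = (\<Sum>k\<in>insert h K. b k * wave k x)"
        using insert hl by (intro sum.mono_neutral_right) (auto simp: b_def)
      finally show ?thesis by (simp add: trig_def)
    qed
    let ?I = "\<lambda>r f. LINT x|lborel. indicator (ball x0 r) x *\<^sub>R (f x :: real)"
    have cP: "continuous_on UNIV (\<lambda>x. (norm (?p x))\<^sup>2)" by (intro continuous_intros)
    have [simp]: "(\<lambda>x. (norm (?p x))\<^sup>2) \<in> borel_measurable borel"
      by (rule borel_measurable_continuous_onI[OF cP])
    have cPy: "continuous_on UNIV (\<lambda>x. (norm (?p (x + y)))\<^sup>2)"
      by (intro continuous_on_compose2[OF cP] continuous_intros) auto
    have cQ: "continuous_on UNIV (\<lambda>x. (norm (trig (insert h K) b x))\<^sup>2)" by (intro continuous_intros)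
    have "?c * (norm (a h))\<^sup>2 * 4 = c * (norm (b h))\<^sup>2"
      by (simp add: b_def norm_mult power_mult_distrib)
    also have "\<dots> \<le> ?I (r/2) (\<lambda>x. (norm (trig (insert h K) b x))\<^sup>2)" by (rule c)
    also have "\<dots> \<le> (LINT x|lborel. 2 * (indicator (ball x0 (r/2)) x *\<^sub>R (norm (?p (x + y)))\<^sup>2)
        + 2 * (indicator (ball x0 (r/2)) x *\<^sub>R (norm (?p x))\<^sup>2))"
    proof (intro integral_mono integrable_ball cQ Bochner_Integration.integrable_add
        Bochner_Integration.integrable_mult_right cP cPy)
      fix x
      show "indicator (ball x0 (r/2)) x *\<^sub>R (norm (trig (insert h K) b x))\<^sup>2 \<le>
        2 * (indicator (ball x0 (r/2)) x *\<^sub>R (norm (?p (x + y)))\<^sup>2)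
            + 2 * (indicator (ball x0 (r/2)) x *\<^sub>R (norm (?p x))\<^sup>2)"
        using norm_add_squared_le[of "?p (x + y)" "- (wave l y * ?p x)"]
            by (auto simp: q norm_mult indicator_def)
    qed
    also have "\<dots> = 2 * ?I (r/2) (\<lambda>x. (norm (?p (x + y)))\<^sup>2) + 2 * ?I (r/2) (\<lambda>x. (norm (?p x))\<^sup>2)"
      by (subst Bochner_Integration.integral_add; (intro Bochner_Integration.integrable_mult_right
          integrable_ball cP cPy)?)
         (simp only: integral_mult_right_zero)
    also have "?I (r/2) (\<lambda>x. (norm (?p x))\<^sup>2) \<le> ?I r (\<lambda>x. (norm (?p x))\<^sup>2)"
      by (intro integral_mono integrable_ball cP) (use insert.prems in \<open>auto simp: indicator_def\<close>)
    also have "?I (r/2) (\<lambda>x. (norm (?p (x + y)))\<^sup>2) \<le> ?I r (\<lambda>x. (norm (?p x))\<^sup>2)"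
    proof -
      have "?I r (\<lambda>x. (norm (?p x))\<^sup>2) = (LINT x|distr lborel borel ((+) y). indicator (ball x0 r) x *\<^sub>R
          (norm (?p x))\<^sup>2)"
        by (simp only: lborel_distr_plus)
      also have "\<dots> = (LINT x|lborel. indicator (ball x0 r) (y + x) *\<^sub>R (norm (?p (y + x)))\<^sup>2)"
        by (rule integral_distr) (auto intro!: borel_measurable_times borel_measurable_indicator)
      also have "\<dots> \<ge> ?I (r/2) (\<lambda>x. (norm (?p (x + y)))\<^sup>2)"
      proof (intro integral_mono integrable_ball cPy)
        have "integrable lborel (\<lambda>x. indicator (ball (x0 - y) r) x *\<^sub>R (norm (?p (x + y)))\<^sup>2)"
          by (intro integrable_ball cPy)
        moreover have "indicator (ball (x0 - y) r) x = (indicator (ball x0 r) (y + x) :: real)" for x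
          by (simp add: indicator_def dist_norm algebra_simps)
        ultimately show "integrable lborel (\<lambda>x. indicator (ball x0 r) (y + x) *\<^sub>R (norm (?p (y + x)))\<^sup>2)"
          by (simp add: add.commute)
        fix x
        have "y + x \<in> ball x0 r" if "x \<in> ball x0 (r/2)"
        proof -
          have "dist x0 (y + x) \<le> dist x0 x + norm y" by (simp add: dist_norm) norm
          thus ?thesis using that ny by auto
        qed
        thus "indicator (ball x0 (r/2)) x *\<^sub>R (norm (?p (x + y)))\<^sup>2 \<le> indicator (ball x0 r) (y + x) *\<^sub>R
            (norm (?p (y + x)))\<^sup>2"
          by (simp add: indicator_def add.commute)
      qed
      finally show ?thesis .
    qed
    finally show ?thesis by simp
  qed
  moreover have "?c > 0" using c ne by simp
  ultimately show ?case by blast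
qed

section \<open>Lower bounds for weighted means\<close>

text \<open>Periodicity is encoded as uniform approximability by trigonometric polynomials with integer
  frequencies, because this is the form in which the weight acts on Fourier coefficients.\<close>

locale periodic_weight =
  fixes \<psi> :: "real ^ 'n \<Rightarrow> real" and x0 :: "real ^ 'n"
  assumes continuous: "continuous_on UNIV \<psi>"
    and nonneg: "\<psi> x \<ge> 0"
    and le_one: "\<psi> x \<le> 1"
    and pos: "\<psi> x0 > 0"
    and approximable: "\<eta> > 0 \<Longrightarrow> \<exists>F c. finite F \<and> F \<subseteq> lattice 1 \<and>
        (\<forall>x. norm (complex_of_real (\<psi> x) - trig F c x) \<le> \<eta>)"
begin

abbreviation weighted :: "nat \<Rightarrow> (real ^ 'n) set \<Rightarrow> (real ^ 'n \<Rightarrow> complex) \<Rightarrow> real" where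
  "weighted N A a \<equiv> mean N (\<lambda>x. \<psi> x * (norm (trig A a x))\<^sup>2)"

text \<open>The means of the approximating trigonometric polynomials do not depend on the period, and the
  approximation error is uniform in it.\<close>

lemma weighted_period_independent:
  assumes NM: "N > 0" "M > 0" and A: "finite A" "differences A \<subseteq> lattice 1"
  shows "weighted N A a = weighted M A a"
proof (rule ccontr)
  let ?S = "sum_norm_sq A a"
  define \<delta> where "\<delta> = \<bar>weighted N A a - weighted M A a\<bar>"
  assume "weighted N A a \<noteq> weighted M A a"
  hence \<delta>: "\<delta> > 0" by (simp add: \<delta>_def)
  have S: "?S \<ge> 0" by (intro sum_nonneg) auto
  define \<eta> where "\<eta> = \<delta> / (2 * ?S + 2)"
  have \<eta>: "\<eta> > 0" using \<delta> S by (simp add: \<eta>_def)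
  obtain F c where F: "finite F" "F \<subseteq> lattice 1" "\<And>x. norm (complex_of_real (\<psi> x) - trig F c x) \<le> \<eta>"
    using approximable[OF \<eta>] by blast
  let ?T = "\<lambda>N. mean N (\<lambda>x. trig F c x * of_real ((norm (trig A a x))\<^sup>2))"
  have lat: "F \<subseteq> lattice K" "differences A \<subseteq> lattice K" for K
    using F A lattice_one_subset by blast+
  have "?T N = ?T M" using mean_trig_weight[OF NM(1) lat] mean_trig_weight[OF NM(2) lat] by simp
  moreover have "norm (complex_of_real (weighted N A a) - ?T N) \<le> \<eta> * ?S"
    by (rule mean_weight_approx[OF NM(1) A(1) lat(2) continuous F(3)])
  moreover have "norm (complex_of_real (weighted M A a) - ?T M) \<le> \<eta> * ?S"
    by (rule mean_weight_approx[OF NM(2) A(1) lat(2) continuous F(3)])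
  ultimately have "norm (complex_of_real (weighted N A a) - complex_of_real (weighted M A a))
      \<le> \<eta> * ?S + \<eta> * ?S"
    using dist_triangle2[of "complex_of_real (weighted N A a)" "complex_of_real (weighted M A a)" "?T N"]
    unfolding dist_norm by simp
  hence "\<delta> \<le> 2 * \<eta> * ?S" by (simp add: \<delta>_def flip: of_real_diff)
  also have "\<dots> < \<eta> * (2 * ?S + 2)" using \<eta> by (simp add: algebra_simps)
  also have "\<dots> = \<delta>" using S by (simp add: \<eta>_def)
  finally show False by simp
qed

text \<open>Translating one frequency to the origin only multiplies the sum by a unimodular factor, so all
  frequencies may be taken in the finite set \<open>H\<close> of integer vectors of length at most \<open>D\<close>. The
  weight is bounded below on a ball around \<open>x0\<close>, and there each coefficient is controlled by the
  integral of the squared sum. The constant does not depend on \<open>N\<close> because one cell that contains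
  the ball can be used for all periods.\<close>

lemma bounded_frequencies:
  "\<exists>c>0. \<forall>N A a. N > 0 \<longrightarrow> finite A \<longrightarrow> differences A \<subseteq> lattice 1 \<longrightarrow> (\<forall>k\<in>A. \<forall>l\<in>A. norm (k - l) \<le> D) \<longrightarrow>
     c * sum_norm_sq A a \<le> weighted N A a"
proof -
  define H where "H = {h \<in> (lattice 1 :: (real ^ 'n) set). norm h \<le> D}"
  have finH: "finite H" unfolding H_def by (rule finite_lattice_ball) simp
  obtain \<rho> where \<rho>: "\<rho> > 0" "\<And>x. x \<in> ball x0 \<rho> \<Longrightarrow> \<psi> x0 / 2 \<le> \<psi> x"
  proof -
    have "isCont \<psi> x0" using continuous by (simp add: continuous_on_eq_continuous_at)
    then obtain d where d: "d > 0" "\<And>x. dist x x0 < d \<Longrightarrow> dist (\<psi> x) (\<psi> x0) < \<psi> x0 / 2"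
      unfolding continuous_at_eps_delta using pos by (meson half_gt_zero)
    have "\<psi> x0 / 2 \<le> \<psi> x" if "x \<in> ball x0 d" for x
      using d(2)[of x] that by (simp add: dist_commute dist_real_def abs_if split: if_splits)
    thus ?thesis using d that by blast
  qed
  obtain N0 :: nat where N0: "norm x0 + \<rho> < real N0" using reals_Archimedean2 by blast
  have N0pos: "N0 > 0" using N0 \<rho>(1) norm_ge_zero[of x0] by (cases N0) (auto simp del: norm_ge_zero)
  have sub: "ball x0 \<rho> \<subseteq> cell N0"
  proof
    fix x assume "x \<in> ball x0 \<rho>"
    hence "norm x \<le> norm x0 + \<rho>" using norm_triangle_sub[of x x0]
        by (simp add: dist_norm norm_minus_commute)
    hence "norm x \<le> 1 * real N0" using N0 by simp
    also have "\<dots> \<le> pi * real N0" using pi_gt3 by (intro mult_right_mono) auto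
    finally have "\<bar>x $ j\<bar> \<le> pi * real N0" for j using component_le_norm_cart[of x j]
        by (rule order_trans[rotated])
    thus "x \<in> cell N0" by (auto simp: cell_def mem_box_cart abs_le_iff minus_le_iff)
  qed
  let ?I = "\<lambda>b. LINT x|lborel. indicator (ball x0 \<rho>) x *\<^sub>R (norm (trig H b x))\<^sup>2"
  have "\<forall>h\<in>H. \<exists>c>0. \<forall>b. c * (norm (b h))\<^sup>2 \<le> ?I b"
  proof
    fix h assume "h \<in> H"
    hence eq: "insert h (H - {h}) = H" by blast
    have "finite (H - {h})" "h \<notin> H - {h}" using finH by auto
    from single_coefficient_bound[OF this \<rho>(1), of x0]
    show "\<exists>c>0. \<forall>b. c * (norm (b h))\<^sup>2 \<le> ?I b" unfolding eq .
  qed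
  from bchoice[OF this] obtain c where c: "\<And>h. h \<in> H \<Longrightarrow> c h > 0" "\<And>h b. h \<in> H \<Longrightarrow> c h * (norm (b h))\<^sup>2
      \<le> ?I b"
    by blast
  \<comment> \<open>the summand \<open>1\<close> only keeps \<open>\<kappa>\<close> positive when \<open>H\<close> is empty\<close>
  define \<kappa> where "\<kappa> = 1 + (\<Sum>h\<in>H. 1 / c h)"
  have \<kappa>: "\<kappa> > 0" using sum_nonneg[of H "\<lambda>h. 1 / c h"] c(1)
      by (simp add: \<kappa>_def less_imp_le add_pos_nonneg)
  let ?V = "cell_volume N0 TYPE('n)"
  have V: "?V > 0" by (rule cell_volume_pos[OF N0pos])
  define C where "C = \<psi> x0 / (2 * \<kappa> * ?V)"
  have bound: "C * (\<Sum>h\<in>H. (norm (b h))\<^sup>2) \<le> weighted N0 H b" for b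
  proof -
    have I: "?I b \<ge> 0" by (intro Bochner_Integration.integral_nonneg) auto
    have "(\<Sum>h\<in>H. (norm (b h))\<^sup>2) \<le> (\<Sum>h\<in>H. 1 / c h * ?I b)"
      using c by (intro sum_mono) (simp add: field_simps)
    also have "\<dots> \<le> \<kappa> * ?I b" using I by (simp add: \<kappa>_def sum_distrib_right distrib_right)
    also have "?I b \<le> (LINT x|lborel. indicator (cell N0) x *\<^sub>R
        (2 / \<psi> x0 * (\<psi> x * (norm (trig H b x))\<^sup>2)))"
    proof (intro integral_mono integrable_ball continuous_intros)
      show "integrable lborel (\<lambda>x. indicator (cell N0) x *\<^sub>R (2 / \<psi> x0 * (\<psi> x * (norm (trig H b x))\<^sup>2)))"
        by (intro borel_integrable_compact compact_cell continuous_intros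
            continuous_on_subset[OF continuous]) auto
      fix x
      show "indicator (ball x0 \<rho>) x *\<^sub>R (norm (trig H b x))\<^sup>2
          \<le> indicator (cell N0) x *\<^sub>R (2 / \<psi> x0 * (\<psi> x * (norm (trig H b x))\<^sup>2))"
      proof (cases "x \<in> ball x0 \<rho>")
        case True
        have "1 \<le> 2 / \<psi> x0 * \<psi> x" using \<rho>(2)[OF True] pos by (simp add: field_simps)
        hence "1 * (norm (trig H b x))\<^sup>2 \<le> 2 / \<psi> x0 * \<psi> x * (norm (trig H b x))\<^sup>2"
            by (rule mult_right_mono) simp
        thus ?thesis using True sub by (auto simp: indicator_def mult_ac)
      qed (use nonneg pos in \<open>auto simp: indicator_def\<close>)
    qed
    also have "\<dots> = (LINT x|cell_measure N0. 2 / \<psi> x0 * (\<psi> x * (norm (trig H b x))\<^sup>2))"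
      by (rule integral_on_cell[symmetric]) (intro borel_measurable_continuous_onI continuous_intros
          continuous)
    also have "\<dots> = 2 / \<psi> x0 * ?V * weighted N0 H b" using V by (simp add: mean_def)
    finally have "(\<Sum>h\<in>H. (norm (b h))\<^sup>2) \<le> \<kappa> * (2 / \<psi> x0 * ?V * weighted N0 H b)"
      using \<kappa> by simp
    thus ?thesis using \<kappa> V pos by (simp add: C_def field_simps)
  qed
  have "C * sum_norm_sq A a \<le> weighted N A a"
    if N: "N > 0" and A: "finite A" "differences A \<subseteq> lattice 1" "\<forall>k\<in>A. \<forall>l\<in>A. norm (k - l) \<le> D" for N A a
  proof (cases "A = {}")
    case True
    thus ?thesis by (simp add: trig_def mean_def)
  next
    case False
    then obtain k0 where k0: "k0 \<in> A" by blast
    define b where "b h = (if k0 + h \<in> A then a (k0 + h) else 0)" for h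
    have reindex: "(\<Sum>h\<in>H. if k0 + h \<in> A then f (k0 + h) else 0) = (\<Sum>k\<in>A. f k)"
        for f :: "real ^ 'n \<Rightarrow> 'x::comm_monoid_add"
    proof -
      have "(\<Sum>h\<in>H. if k0 + h \<in> A then f (k0 + h) else 0) = (\<Sum>h | h \<in> H \<and> k0 + h \<in> A. f (k0 + h))"
        by (rule sum.inter_filter[OF finH, symmetric])
      also have "\<dots> = (\<Sum>k\<in>A. f k)"
        using A k0 by (intro sum.reindex_bij_witness[of _ "\<lambda>k. k - k0" "\<lambda>h. k0 + h"])
          (auto simp: H_def differences_def)
      finally show ?thesis .
    qed
    have "trig H b x = wave (- k0) x * trig A a x" for x
    proof -
      have "trig H b x = (\<Sum>h\<in>H. if k0 + h \<in> A then a (k0 + h) * wave (k0 + h - k0) x else 0)"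
        unfolding trig_def by (intro sum.cong) (auto simp: b_def)
      also have "\<dots> = (\<Sum>k\<in>A. a k * wave (k - k0) x)" by (rule reindex)
      also have "\<dots> = wave (- k0) x * trig A a x"
          by (simp add: trig_def sum_distrib_left wave_diff cnj_wave mult_ac)
      finally show ?thesis .
    qed
    hence "weighted N0 H b = weighted N0 A a" by (intro mean_cong) (simp add: norm_mult)
    also have "\<dots> = weighted N A a" by (rule weighted_period_independent[OF N0pos N A(1,2)])
    finally have "weighted N0 H b = weighted N A a" .
    moreover have "(\<Sum>h\<in>H. (norm (b h))\<^sup>2) = sum_norm_sq A a"
      using reindex[of "\<lambda>k. (norm (a k))\<^sup>2"]
          by (simp add: b_def if_distrib[of norm] if_distrib[of "\<lambda>z. z\<^sup>2"] cong: if_cong)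
    ultimately show ?thesis using bound[of b] by simp
  qed
  moreover have "C > 0" using pos \<kappa> V by (simp add: C_def)
  ultimately show ?thesis by blast
qed

text \<open>For the trigonometric polynomial in place of the weight, the terms pairing frequencies from
  different classes vanish, so the quadratic form is exactly the sum of the forms of the classes.
  Replacing the weight by the polynomial costs \<open>\<eta>\<close> once in every class and once for all of \<open>A\<close>.\<close>

lemma weighted_partition:
  assumes N: "N > 0" and A: "finite A" "differences A \<subseteq> lattice N" and r: "equiv A r"
    and F: "F \<subseteq> lattice 1" "\<And>x. norm (complex_of_real (\<psi> x) - trig F d x) \<le> \<eta>"
    and sep: "\<And>k l. k \<in> A \<Longrightarrow> l \<in> A \<Longrightarrow> l - k \<in> F \<Longrightarrow> (k, l) \<in> r"
    and classes: "\<And>B. B \<in> A // r \<Longrightarrow> c * sum_norm_sq B a \<le> weighted N B a"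
  shows "(c - 2 * \<eta>) * sum_norm_sq A a \<le> weighted N A a"
proof -
  define G where "G k l = a k * cnj (a l) * (\<Sum>h\<in>F. if h + k - l = 0 then d h else 0)" for k l
  let ?T = "\<lambda>B. mean N (\<lambda>x. trig F d x * of_real ((norm (trig B a x))\<^sup>2))"
  let ?S = "\<lambda>B. \<Sum>k\<in>B. (norm (a k))\<^sup>2"
  have FN: "F \<subseteq> lattice N" using F lattice_one_subset by blast
  have BA: "B \<subseteq> A" if "B \<in> A // r" for B using that r in_quotient_imp_subset by blast
  have latB: "differences B \<subseteq> lattice N" if "B \<subseteq> A" for B using differences_mono[OF that] A by blast
  have split: "sum f A = (\<Sum>B\<in>A // r. sum f B)" for f :: "real ^ 'n \<Rightarrow> 'x::comm_monoid_add"
  proof -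
    have "sum f (\<Union>(A // r)) = (sum \<circ> sum) f (A // r)"
      using A(1) BA quotient_disj[OF r] by (intro sum.Union_disjoint) (blast intro: finite_subset)+
    thus ?thesis by (simp add: Union_quotient[OF r])
  qed
  have "?T A = (\<Sum>k\<in>A. \<Sum>l\<in>A. G k l)" unfolding G_def by (rule mean_trig_weight[OF N FN A(2)])
  also have "\<dots> = (\<Sum>B\<in>A // r. \<Sum>k\<in>B. \<Sum>l\<in>A. G k l)" by (rule split)
  also have "\<dots> = (\<Sum>B\<in>A // r. \<Sum>k\<in>B. \<Sum>l\<in>B. G k l)"
  proof (rule sum.cong[OF refl], rule sum.cong[OF refl], rule sum.mono_neutral_right)
    fix B k assume B: "B \<in> A // r" and k: "k \<in> B"
    show "finite A" "B \<subseteq> A" using A BA[OF B] by auto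
    show "\<forall>l\<in>A - B. G k l = 0"
    proof
      fix l assume l: "l \<in> A - B"
      have "l - k \<notin> F"
      proof
        assume "l - k \<in> F"
        hence "(k, l) \<in> r" using sep[of k l] k l BA[OF B] by blast
        hence "l \<in> B" using B k r by (meson in_quotient_imp_closed)
        thus False using l by blast
      qed
      hence "(\<Sum>h\<in>F. if h + k - l = 0 then d h else 0) = 0"
        by (intro sum.neutral) (auto simp: algebra_simps eq_diff_eq)
      thus "G k l = 0" by (simp add: G_def)
    qed
  qed
  also have "\<dots> = (\<Sum>B\<in>A // r. ?T B)"
    unfolding G_def by (intro sum.cong refl mean_trig_weight[OF N FN, symmetric] latB BA)
  finally have T: "Re (?T A) = (\<Sum>B\<in>A // r. Re (?T B))" by simp
  have approx: "\<bar>weighted N B a - Re (?T B)\<bar> \<le> \<eta> * ?S B" if "B \<subseteq> A" for B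
  proof -
    have "\<bar>Re (complex_of_real (weighted N B a) - ?T B)\<bar> \<le> norm (complex_of_real (weighted N B a) - ?T B)"
      by (rule abs_Re_le_cmod)
    also have "\<dots> \<le> \<eta> * ?S B"
      by (rule mean_weight_approx[OF N finite_subset[OF that A(1)] latB[OF that] continuous F(2)])
    finally show ?thesis by simp
  qed
  have "(c - \<eta>) * ?S A = (\<Sum>B\<in>A // r. (c - \<eta>) * ?S B)"
    by (subst split) (rule sum_distrib_left)
  also have "\<dots> \<le> (\<Sum>B\<in>A // r. Re (?T B))"
  proof (rule sum_mono)
    fix B assume B: "B \<in> A // r"
    show "(c - \<eta>) * ?S B \<le> Re (?T B)"
      using classes[OF B] approx[OF BA[OF B]] unfolding left_diff_distrib by linarith
  qed
  finally have "(c - \<eta>) * ?S A \<le> Re (?T A)" by (simp only: T)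
  moreover have "(c - 2 * \<eta>) * ?S A = (c - \<eta>) * ?S A - \<eta> * ?S A" by (simp add: algebra_simps)
  ultimately show ?thesis using approx[of A] by auto
qed

definition coset_bound :: "real \<Rightarrow> nat \<Rightarrow> bool" where
  "coset_bound c d \<longleftrightarrow> c > 0 \<and> (\<forall>N \<mu> A a. N > 0 \<longrightarrow> finite A \<longrightarrow> A \<subseteq> shell \<mu> \<longrightarrow> differences A \<subseteq> lattice 1 \<longrightarrow>
     dim (differences A) \<le> d \<longrightarrow> c * sum_norm_sq A a \<le> weighted N A a)"

lemma coset_boundD:
  "coset_bound c d \<Longrightarrow> N > 0 \<Longrightarrow> finite A \<Longrightarrow> A \<subseteq> shell \<mu> \<Longrightarrow> differences A \<subseteq> lattice 1 \<Longrightarrow>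
     dim (differences A) \<le> d \<Longrightarrow> c * sum_norm_sq A a \<le> weighted N A a"
  unfolding coset_bound_def by blast

text \<open>Approximating the weight within \<open>c / 4\<close>, where \<open>c\<close> is the constant for dimension \<open>d\<close>, fixes the
  range \<open>R\<close> of the interaction, and \<open>R\<close> fixes a diameter \<open>D\<close>. A set of dimension \<open>d + 1\<close> with
  diameter above \<open>D\<close> has no cluster of full dimension, so the bound for dimension \<open>d\<close> holds on each
  cluster and half of it survives. Sets of diameter at most \<open>D\<close> have a constant of their own.\<close>

lemma ex_coset_bound: "\<exists>c. coset_bound c d"
proof (induction d)
  case 0
  obtain c where c: "c > 0" "\<And>N A a. N > 0 \<Longrightarrow> finite A \<Longrightarrow> differences A \<subseteq> lattice 1 \<Longrightarrow>
      \<forall>k\<in>A. \<forall>l\<in>A. norm (k - l) \<le> 0 \<Longrightarrow>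
     c * sum_norm_sq A a \<le> weighted N A a"
    using bounded_frequencies[of 0] by blast
  have trivial: "\<forall>k\<in>A. \<forall>l\<in>A. norm (k - l) \<le> 0" if "dim (differences A) \<le> 0" for A :: "(real ^ 'n) set"
  proof -
    have "differences A \<subseteq> {0}" using that dim_eq_0[of "differences A"] by simp
    moreover have "k - l \<in> differences A" if "k \<in> A" "l \<in> A" for k l
      using that by (auto simp: differences_def)
    ultimately show ?thesis by fastforce
  qed
  have "coset_bound c 0"
    unfolding coset_bound_def by (intro conjI allI impI c trivial)
  thus ?case by blast
next
  case (Suc d)
  then obtain c where c: "coset_bound c d" by blast
  hence c0: "c > 0" by (simp add: coset_bound_def)
  obtain F e where F: "finite F" "F \<subseteq> lattice 1" "\<And>x. norm (complex_of_real (\<psi> x) - trig F e x) \<le> c / 4"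
    using approximable[of "c / 4"] c0 by auto
  define R where "R = (\<Sum>h\<in>F. norm h)"
  have R: "R \<ge> 0" "\<And>h. h \<in> F \<Longrightarrow> norm h \<le> R"
    using F(1) by (auto simp: R_def intro!: sum_nonneg member_le_sum)
  obtain D where D: "diameter_bound R (Suc d) D TYPE('n)" using cluster_diameter[OF R(1)] by blast
  obtain c1 where c1: "c1 > 0" "\<And>N A a. N > 0 \<Longrightarrow> finite A \<Longrightarrow> differences A \<subseteq> lattice 1 \<Longrightarrow>
      \<forall>k\<in>A. \<forall>l\<in>A. norm (k - l) \<le> D \<Longrightarrow>
     c1 * sum_norm_sq A a \<le> weighted N A a"
    using bounded_frequencies[of D] by blast
  have "min (c / 2) c1 * sum_norm_sq A a \<le> weighted N A a"
    if N: "N > 0" and A: "finite A" "A \<subseteq> shell \<mu>" "differences A \<subseteq> lattice 1" "dim (differences A)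
        \<le> Suc d" for N \<mu> A a
  proof (cases "\<forall>k\<in>A. \<forall>l\<in>A. norm (k - l) \<le> D")
    case True
    have "min (c / 2) c1 * sum_norm_sq A a \<le> c1 * sum_norm_sq A a"
      by (intro mult_right_mono sum_nonneg) auto
    also have "\<dots> \<le> weighted N A a" by (rule c1(2)[OF N A(1,3) True])
    finally show ?thesis .
  next
    case False
    have "(c - 2 * (c / 4)) * sum_norm_sq A a \<le> weighted N A a"
    proof (rule weighted_partition[OF N A(1) _ equiv_near_rel F(2,3)])
      show "differences A \<subseteq> lattice N" using A lattice_one_subset by blast
      show "(k, l) \<in> near_rel R A" if "k \<in> A" "l \<in> A" "l - k \<in> F" for k l
        using that R(2)[of "l - k"] by (auto simp: near_rel_def norm_minus_commute)
      fix B assume B: "B \<in> A // near_rel R A"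
      have BA: "B \<subseteq> A" and ne: "B \<noteq> {}" and finB: "finite B"
        using B equiv_near_rel A(1) in_quotient_imp_subset in_quotient_imp_non_empty finite_subset
            by metis+
      have "dim (differences B) \<le> d"
      proof (rule ccontr)
        assume "\<not> ?thesis"
        hence "span (differences B) = span (differences A)"
          using A(4) by (intro dim_eq_span differences_mono BA) simp
        moreover have "dim (differences B) \<le> Suc d" using dim_subset[OF differences_mono[OF BA]] A(4)
            by simp
        ultimately have "\<forall>k\<in>A. \<forall>l\<in>A. norm (k - l) \<le> D"
          using D finB ne BA A(2,3) chained_near_rel_class[OF B] unfolding diameter_bound_def by blast
        thus False using False by blast
      qed
      moreover have "B \<subseteq> shell \<mu>" "differences B \<subseteq> lattice 1" using BA A differences_mono[OF BA] by blast+
      ultimately show "c * sum_norm_sq B a \<le> weighted N B a"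
        by (intro coset_boundD[OF c N finB])
    qed
    moreover have "min (c / 2) c1 * sum_norm_sq A a \<le> (c - 2 * (c / 4)) * sum_norm_sq A a"
      by (intro mult_right_mono sum_nonneg) auto
    ultimately show ?thesis by linarith
  qed
  moreover have "min (c / 2) c1 > 0" using c0 c1 by simp
  ultimately have "coset_bound (min (c / 2) c1) (Suc d)"
    unfolding coset_bound_def by (intro conjI allI impI)
  thus ?case by blast
qed

text \<open>Distinct cosets of the integer lattice do not interact, because the weight has integer
  frequencies. Inside one coset the dimension of the differences is at most that of the space.\<close>

theorem shell_bound:
  "\<exists>c>0. \<forall>N \<mu> A a. N > 0 \<longrightarrow> finite A \<longrightarrow> A \<subseteq> lattice N \<longrightarrow> A \<subseteq> shell \<mu> \<longrightarrow>
     c * sum_norm_sq A a \<le> weighted N A a"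
proof -
  obtain c where c: "coset_bound c CARD('n)" using ex_coset_bound by blast
  hence c0: "c > 0" by (simp add: coset_bound_def)
  obtain F e where F: "finite F" "F \<subseteq> lattice 1" "\<And>x. norm (complex_of_real (\<psi> x) - trig F e x) \<le> c / 4"
    using approximable[of "c / 4"] c0 by auto
  have "c / 2 * sum_norm_sq A a \<le> weighted N A a"
    if N: "N > 0" and A: "finite A" "A \<subseteq> lattice N" "A \<subseteq> shell \<mu>" for N \<mu> A a
  proof -
    define r where "r = {(k, l). k \<in> A \<and> l \<in> A \<and> k - l \<in> lattice 1}"
    have r: "equiv A r"
    proof (rule equivI)
      show "refl_on A r" by (auto simp: r_def refl_on_def)
      show "sym r" unfolding r_def sym_def using lattice_uminus by fastforce
      show "trans r" unfolding r_def trans_def using lattice_add by fastforce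
      show "r \<subseteq> A \<times> A" by (auto simp: r_def)
    qed
    have "(c - 2 * (c / 4)) * sum_norm_sq A a \<le> weighted N A a"
    proof (rule weighted_partition[OF N A(1) _ r F(2,3)])
      show "differences A \<subseteq> lattice N" using A lattice_diff by (fastforce simp: differences_def)
      show "(k, l) \<in> r" if "k \<in> A" "l \<in> A" "l - k \<in> F" for k l
        using that F(2) lattice_uminus[of "l - k"] by (auto simp: r_def)
      fix B assume B: "B \<in> A // r"
      have BA: "B \<subseteq> A" using B r in_quotient_imp_subset by blast
      have "differences B \<subseteq> lattice 1"
        using quotient_eq_iff[OF r B B] by (fastforce simp: differences_def r_def)
      moreover have "dim (differences B) \<le> CARD('n)" using dim_subset_UNIV[of "differences B"] by simp
      ultimately show "c * sum_norm_sq B a \<le> weighted N B a"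
        using BA A by (intro coset_boundD[OF c N]) (auto intro: finite_subset)
    qed
    thus ?thesis by simp
  qed
  thus ?thesis using c0 by (intro exI[of _ "c / 2"]) auto
qed

end

section \<open>Square-integrable functions\<close>

definition l2 :: "'a measure \<Rightarrow> ('a \<Rightarrow> complex) set" where
  "l2 M = {u \<in> borel_measurable M. integrable M (\<lambda>x. (norm (u x))\<^sup>2)}"

lemma l2D: "u \<in> l2 M \<Longrightarrow> u \<in> borel_measurable M" "u \<in> l2 M \<Longrightarrow> integrable M (\<lambda>x. (norm (u x))\<^sup>2)"
  by (auto simp: l2_def)

lemma l2_boundI:
  assumes "u \<in> borel_measurable M" "integrable M g" "\<And>x. x \<in> space M \<Longrightarrow> (norm (u x))\<^sup>2 \<le> g x"
  shows "u \<in> l2 M"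
  unfolding l2_def
proof (intro CollectI conjI)
  show "integrable M (\<lambda>x. (norm (u x))\<^sup>2)"
    by (rule Bochner_Integration.integrable_bound[OF assms(2)])
        (use assms in \<open>auto intro!: AE_I2 order_trans[OF _ abs_ge_self]\<close>)
qed fact

lemma l2_add:
  assumes "u \<in> l2 M" "v \<in> l2 M"
  shows "(\<lambda>x. u x + v x) \<in> l2 M"
  by (rule l2_boundI[where g="\<lambda>x. 2 * (norm (u x))\<^sup>2 + 2 * (norm (v x))\<^sup>2"])
     (use assms norm_add_squared_le in \<open>auto simp: l2_def\<close>)

lemma l2_mult_bounded:
  assumes "u \<in> l2 M" and "b \<in> borel_measurable M" "\<And>x. x \<in> space M \<Longrightarrow> norm (b x) \<le> B"
  shows "(\<lambda>x. b x * u x) \<in> l2 M"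
proof (rule l2_boundI[where g="\<lambda>x. B\<^sup>2 * (norm (u x))\<^sup>2"])
  show "(norm (b x * u x))\<^sup>2 \<le> B\<^sup>2 * (norm (u x))\<^sup>2" if "x \<in> space M" for x
    unfolding norm_mult power_mult_distrib by (intro mult_right_mono power_mono assms(3) that) auto
qed (use assms in \<open>auto simp: l2_def\<close>)

lemma l2_cmult: "u \<in> l2 M \<Longrightarrow> (\<lambda>x. c * u x) \<in> l2 M"
  by (rule l2_mult_bounded[where B="norm c"]) auto

lemma l2_diff: "u \<in> l2 M \<Longrightarrow> v \<in> l2 M \<Longrightarrow> (\<lambda>x. u x - v x) \<in> l2 M"
  using l2_add[of u M "\<lambda>x. (-1) * v x"] l2_cmult[of v M "-1"] by simp

lemma l2_zero: "(\<lambda>x. 0) \<in> l2 M"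
  by (simp add: l2_def)

lemma l2_sum: "(\<And>i. i \<in> I \<Longrightarrow> f i \<in> l2 M) \<Longrightarrow> (\<lambda>x. \<Sum>i\<in>I. f i x) \<in> l2 M"
  by (induction I rule: infinite_finite_induct) (auto intro: l2_zero l2_add)

lemma l2_cnj: "u \<in> l2 M \<Longrightarrow> (\<lambda>x. cnj (u x)) \<in> l2 M"
  by (auto simp: l2_def intro!: measurable_compose[OF _ borel_measurable_continuous_onI[of cnj]]
      continuous_intros)

lemma l2_mult_integrable:
  assumes "u \<in> l2 M" "v \<in> l2 M"
  shows "integrable M (\<lambda>x. u x * v x)"
proof (rule Bochner_Integration.integrable_bound)
  show "integrable M (\<lambda>x. (norm (u x))\<^sup>2 + (norm (v x))\<^sup>2)" using assms by (auto simp: l2_def)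
  show "AE x in M. norm (u x * v x) \<le> norm ((norm (u x))\<^sup>2 + (norm (v x))\<^sup>2)"
  proof (rule AE_I2)
    fix x
    have "2 * (norm (u x) * norm (v x)) \<le> (norm (u x))\<^sup>2 + (norm (v x))\<^sup>2"
      using sum_squares_bound[of "norm (u x)" "norm (v x)"] by simp
    moreover have "norm (u x) * norm (v x) \<ge> 0" by simp
    ultimately show "norm (u x * v x) \<le> norm ((norm (u x))\<^sup>2 + (norm (v x))\<^sup>2)"
      unfolding norm_mult real_norm_def by linarith
  qed
qed (use assms in \<open>auto simp: l2_def\<close>)

text \<open>The Cauchy-Schwarz inequality with a free parameter, in the form in which it is used for absorption.\<close>

lemma norm_integral_mult_le:
  assumes u: "u \<in> l2 M" and v: "v \<in> l2 M" and \<delta>: "\<delta> > 0"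
  shows "norm (LINT x|M. u x * v x) \<le> \<delta> / 2 * (LINT x|M. (norm (u x))\<^sup>2)
      + 1 / (2 * \<delta>) * (LINT x|M. (norm (v x))\<^sup>2)"
proof -
  have "norm (LINT x|M. u x * v x) \<le> (LINT x|M. norm (u x * v x))" by (rule integral_norm_bound)
  also have "\<dots> \<le> (LINT x|M. \<delta> / 2 * (norm (u x))\<^sup>2 + 1 / (2 * \<delta>) * (norm (v x))\<^sup>2)"
  proof (rule integral_mono)
    show "integrable M (\<lambda>x. norm (u x * v x))" using l2_mult_integrable[OF u v] by (rule integrable_norm)
    show "integrable M (\<lambda>x. \<delta> / 2 * (norm (u x))\<^sup>2 + 1 / (2 * \<delta>) * (norm (v x))\<^sup>2)"
      using l2D(2)[OF u] l2D(2)[OF v] by auto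
    fix x
    have "0 \<le> (\<delta> * norm (u x) - norm (v x))\<^sup>2" by simp
    moreover have "(\<delta> * norm (u x) - norm (v x))\<^sup>2 = \<delta> * \<delta> * (norm (u x))\<^sup>2 + (norm (v x))\<^sup>2
        - 2 * \<delta> * (norm (u x) * norm (v x))"
      by (simp add: power2_eq_square algebra_simps)
    ultimately have "2 * \<delta> * (norm (u x) * norm (v x)) \<le> \<delta> * \<delta> * (norm (u x))\<^sup>2 + (norm (v x))\<^sup>2"
      by linarith
    thus "norm (u x * v x) \<le> \<delta> / 2 * (norm (u x))\<^sup>2 + 1 / (2 * \<delta>) * (norm (v x))\<^sup>2"
      using \<delta> by (simp add: norm_mult field_simps power2_eq_square)
  qed
  also have "\<dots> = \<delta> / 2 * (LINT x|M. (norm (u x))\<^sup>2) + 1 / (2 * \<delta>) * (LINT x|M. (norm (v x))\<^sup>2)"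
    using l2D(2)[OF u] l2D(2)[OF v] by (subst Bochner_Integration.integral_add) auto
  finally show ?thesis .
qed

section \<open>Fourier series on a cell\<close>

abbreviation cell_l2 :: "nat \<Rightarrow> (real ^ 'n \<Rightarrow> complex) set" where
  "cell_l2 N \<equiv> l2 (cell_measure N)"

definition msq :: "nat \<Rightarrow> (real ^ 'n \<Rightarrow> complex) \<Rightarrow> real" where
  "msq N w = mean N (\<lambda>x. (norm (w x))\<^sup>2)"

definition fourier :: "nat \<Rightarrow> (real ^ 'n \<Rightarrow> complex) \<Rightarrow> real ^ 'n \<Rightarrow> complex" where
  "fourier N w k = mean N (\<lambda>x. w x * cnj (wave k x))"

lemma continuous_cell_l2:
  assumes "continuous_on UNIV u"
  shows "u \<in> cell_l2 N"
proof -
  have "integrable (cell_measure N) u" by (rule integrable_on_cell[OF assms])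
  moreover have "integrable (cell_measure N) (\<lambda>x. (norm (u x))\<^sup>2)"
    by (intro integrable_on_cell continuous_intros assms)
  ultimately show ?thesis by (simp add: l2_def)
qed

lemma trig_cell_l2: "trig A a \<in> cell_l2 N"
  by (intro continuous_cell_l2 continuous_intros)

lemma msq_nonneg: "msq N w \<ge> 0"
  unfolding msq_def mean_def by (auto simp: cell_volume_def intro!: Bochner_Integration.integral_nonneg)

lemma mean_mono_integrable:
  fixes f g :: "real ^ 'n \<Rightarrow> real"
  assumes "integrable (cell_measure N) f" "integrable (cell_measure N) g" "\<And>x. x \<in> cell N \<Longrightarrow> f x \<le> g x"
  shows "mean N f \<le> mean N g"
  unfolding mean_def
  by (intro scaleR_left_mono integral_mono assms) (auto simp: cell_volume_def)

lemma mean_add: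
  assumes "integrable (cell_measure N) f" "integrable (cell_measure N) g"
  shows "mean N (\<lambda>x. f x + g x) = mean N f + mean N g"
  using assms by (simp add: mean_def scaleR_add_right)

lemma mean_diff_integrable:
  assumes "integrable (cell_measure N) f" "integrable (cell_measure N) g"
  shows "mean N f - mean N g = mean N (\<lambda>x. f x - g x)"
  using assms by (simp add: mean_def scaleR_diff_right)

lemma mean_real_cmult: "mean N (\<lambda>x. c * f x) = c * mean N (f :: real ^ 'n \<Rightarrow> real)"
  by (simp add: mean_def)

lemma msq_add_le:
  assumes "u \<in> cell_l2 N" "v \<in> cell_l2 N"
  shows "msq N (\<lambda>x. u x + v x) \<le> 2 * msq N u + 2 * msq N v"
proof -
  note int = l2D(2)[OF assms(1)] l2D(2)[OF assms(2)] l2D(2)[OF l2_add[OF assms]]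
  have "msq N (\<lambda>x. u x + v x) \<le> mean N (\<lambda>x. 2 * (norm (u x))\<^sup>2 + 2 * (norm (v x))\<^sup>2)"
    unfolding msq_def
    by (intro mean_mono_integrable int Bochner_Integration.integrable_add
        Bochner_Integration.integrable_mult_right norm_add_squared_le)
  also have "\<dots> = 2 * msq N u + 2 * msq N v"
    using int by (simp add: msq_def mean_add mean_real_cmult)
  finally show ?thesis .
qed

lemma msq_cmult: "msq N (\<lambda>x. c * u x) = (norm c)\<^sup>2 * msq N u"
  by (simp add: msq_def norm_mult power_mult_distrib mean_real_cmult)

definition trig_dense :: "nat \<Rightarrow> (real ^ 'n \<Rightarrow> complex) \<Rightarrow> bool" where
  "trig_dense N w \<longleftrightarrow> (\<forall>\<epsilon>>0. \<exists>A a. finite A \<and> A \<subseteq> lattice N \<and> msq N (\<lambda>x. w x - trig A a x) < \<epsilon>)"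

lemma trig_dense_add:
  assumes "u \<in> cell_l2 N" "v \<in> cell_l2 N" "trig_dense N u" "trig_dense N v"
  shows "trig_dense N (\<lambda>x. u x + v x)"
  unfolding trig_dense_def
proof (intro allI impI)
  fix \<epsilon> :: real assume "\<epsilon> > 0"
  hence e: "\<epsilon> / 4 > 0" by simp
  obtain A a where A: "finite A" "A \<subseteq> lattice N" "msq N (\<lambda>x. u x - trig A a x) < \<epsilon> / 4"
    using assms(3) e unfolding trig_dense_def by blast
  obtain B b where B: "finite B" "B \<subseteq> lattice N" "msq N (\<lambda>x. v x - trig B b x) < \<epsilon> / 4"
    using assms(4) e unfolding trig_dense_def by blast
  obtain c where c: "\<And>x. trig A a x + trig B b x = trig (A \<union> B) c x" using trig_add A(1) B(1) by metis
  have eq: "(u x + v x) - trig (A \<union> B) c x = (u x - trig A a x) + (v x - trig B b x)" for x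
    by (simp flip: c)
  have "msq N (\<lambda>x. (u x + v x) - trig (A \<union> B) c x) \<le> 2 * msq N (\<lambda>x. u x - trig A a x)
      + 2 * msq N (\<lambda>x. v x - trig B b x)"
    unfolding eq by (intro msq_add_le l2_diff assms trig_cell_l2)
  also have "\<dots> < \<epsilon>" using A B by simp
  finally show "\<exists>A a. finite A \<and> A \<subseteq> lattice N \<and> msq N (\<lambda>x. (u x + v x) - trig A a x) < \<epsilon>"
    using A B by (intro exI[of _ "A \<union> B"] exI[of _ c]) auto
qed

lemma trig_dense_cmult:
  assumes "trig_dense N u"
  shows "trig_dense N (\<lambda>x. c * u x)"
  unfolding trig_dense_def
proof (intro allI impI)
  fix \<epsilon> :: real assume e: "\<epsilon> > 0"
  have p: "(norm c)\<^sup>2 + 1 > 0" by (simp add: add_nonneg_pos)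
  obtain A a where A: "finite A" "A \<subseteq> lattice N" "msq N (\<lambda>x. u x - trig A a x) < \<epsilon> / ((norm c)\<^sup>2 + 1)"
    using assms divide_pos_pos[OF e p] unfolding trig_dense_def by blast
  have eq: "c * u x - trig A (\<lambda>k. c * a k) x = c * (u x - trig A a x)" for x
    by (simp add: trig_def right_diff_distrib sum_distrib_left mult_ac)
  have "msq N (\<lambda>x. c * u x - trig A (\<lambda>k. c * a k) x) \<le> ((norm c)\<^sup>2 + 1) * msq N (\<lambda>x. u x - trig A a x)"
    unfolding eq msq_cmult by (intro mult_right_mono msq_nonneg) auto
  also have "\<dots> < \<epsilon>" using A(3) p by (simp add: field_simps)
  finally show "\<exists>A a. finite A \<and> A \<subseteq> lattice N \<and> msq N (\<lambda>x. c * u x - trig A a x) < \<epsilon>"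
    using A by blast
qed

lemma trig_dense_sum:
  assumes "finite I" "\<And>i. i \<in> I \<Longrightarrow> f i \<in> cell_l2 N" "\<And>i. i \<in> I \<Longrightarrow> trig_dense N (f i)"
  shows "trig_dense N (\<lambda>x. \<Sum>i\<in>I. f i x)"
  using assms
proof (induction I rule: finite_induct)
  case empty
  show ?case unfolding trig_dense_def
    by (intro allI impI exI[of _ "{}"] exI[of _ "\<lambda>_. 0"]) (simp add: trig_def msq_def mean_def)
next
  case (insert i I)
  thus ?case by (simp add: trig_dense_add l2_sum)
qed

lemma torus_map_inj:
  assumes N: "N > 0" and x: "x \<in> box (\<chi> j. - (pi * real N)) (\<chi> j. pi * real N)"
      and y: "y \<in> box (\<chi> j. - (pi * real N)) (\<chi> j. pi * real N)"
    and eq: "torus_map N x = torus_map N (y :: real ^ 'n)"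
  shows "x = y"
  unfolding vec_eq_iff
proof
  fix j
  have "x $ j / real N \<in> {-pi<..pi}" "y $ j / real N \<in> {-pi<..pi}"
    using x y N by (auto simp: mem_box_cart field_simps less_imp_le)
  moreover have "cis (x $ j / real N) = cis (y $ j / real N)"
    using eq by (simp add: torus_map_def vec_eq_iff)
  ultimately have "x $ j / real N = y $ j / real N" by (metis Arg_cis)
  thus "x $ j = y $ j" using N by simp
qed

text \<open>Up to small measure, the set and its complement in the open cell are compact sets \<open>K\<close> and \<open>L\<close>.
  The torus map is injective on the open cell, so it takes them to disjoint compact sets, which a
  continuous function on the torus separates; that function is approximated by trigonometric
  polynomials.\<close>

lemma trig_dense_indicator:
  assumes N: "N > 0" and S: "S \<in> sets (lebesgue_on (cell N :: (real ^ 'n) set))"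
  shows "trig_dense N (\<lambda>x. indicator S x :: complex)"
  unfolding trig_dense_def
proof (intro allI impI)
  fix \<epsilon> :: real assume \<epsilon>: "\<epsilon> > 0"
  let ?V = "cell_volume N TYPE('n)"
  have V: "?V > 0" by (rule cell_volume_pos[OF N])
  let ?W = "cell N :: (real ^ 'n) set" and ?I = "box (\<chi> j. - (pi * real N)) (\<chi> j. pi * real N) ::
      (real ^ 'n) set"
  have IW: "?I \<subseteq> ?W" by (auto simp: cell_def box_subset_cbox)
  have S': "S \<in> sets lebesgue" "S \<subseteq> ?W" using S by (auto simp: sets_restrict_space_iff)
  define e where "e = \<epsilon> * ?V / 16"
  have e: "e > 0" using \<epsilon> V by (simp add: e_def)
  have "S \<inter> ?I \<in> sets lebesgue" "?I - S \<in> sets lebesgue" using S' by auto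
  then obtain K L where K: "closed K" "K \<subseteq> S \<inter> ?I" "S \<inter> ?I - K \<in> lmeasurable"
      "emeasure lebesgue (S \<inter> ?I - K) < ennreal e"
    and L: "closed L" "L \<subseteq> ?I - S" "?I - S - L \<in> lmeasurable" "emeasure lebesgue (?I - S - L) < ennreal e"
    using sets_lebesgue_inner_closed e by metis
  have bdd: "bounded ?I" by (rule bounded_box)
  have "compact K" "compact L" using K(1,2) L(1,2) bounded_subset[OF bdd, of K] bounded_subset[OF bdd, of
      L] by (auto simp: compact_eq_bounded_closed)
  hence comp: "compact (torus_map N ` K)" "compact (torus_map N ` L)"
    by (auto intro!: compact_continuous_image continuous_intros)
  have disj: "torus_map N ` K \<inter> torus_map N ` L = {}"
    using K(2) L(2) torus_map_inj[OF N] by blast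
  obtain g :: "complex ^ 'n \<Rightarrow> real" where g: "continuous_on UNIV g" "\<And>z. g z \<in> closed_segment 1 0"
     "\<And>z. z \<in> torus_map N ` K \<Longrightarrow> g z = 1" "\<And>z. z \<in> torus_map N ` L \<Longrightarrow> g z = 0"
    using Urysohn[OF compact_imp_closed[OF comp(1)] compact_imp_closed[OF comp(2)] disj, of 1 0] by metis
  have g01: "0 \<le> g z" "g z \<le> 1" for z using g(2)[of z] by (auto simp: closed_segment_eq_real_ivl)
  define \<eta> where "\<eta> = sqrt (\<epsilon> / 8)"
  have \<eta>: "\<eta> > 0" "\<eta>\<^sup>2 = \<epsilon> / 8" using \<epsilon> by (auto simp: \<eta>_def)
  obtain A a where A: "finite A" "A \<subseteq> lattice N" "\<And>x. norm (complex_of_real (g (torus_map N x))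
      - trig A a x) \<le> \<eta>"
    using trig_approximation[OF N continuous_on_subset[OF g(1)] \<eta>(1)] by blast
  let ?E = "?W - (K \<union> L)"
  have E: "?E \<in> sets lebesgue" using K(1) L(1) by auto
  have mE: "measure lebesgue ?E \<le> 2 * e"
  proof -
    have null: "?W - ?I \<in> null_sets lebesgue"
      using negligible_frontier_interval[of "(\<chi> j. - (pi * real N)) :: real ^ 'n" "\<chi> j. pi * real N"]
      by (simp add: cell_def negligible_iff_null_sets)
    have "measure lebesgue ?E \<le> measure lebesgue ((?W - ?I) \<union> ((S \<inter> ?I - K) \<union> (?I - S - L)))"
      by (intro measure_mono_fmeasurable E fmeasurable.Un fmeasurableI_null_sets null K(3) L(3)) auto
    also have "\<dots> = measure lebesgue ((S \<inter> ?I - K) \<union> (?I - S - L))"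
      using null K(3) L(3) by (subst Un_commute, intro measure_Un_null_set) auto
    also have "\<dots> \<le> measure lebesgue (S \<inter> ?I - K) + measure lebesgue (?I - S - L)"
      using K(3) L(3) by (intro measure_Un_le) auto
    also have "\<dots> \<le> e + e"
      unfolding measure_def using less_imp_le[OF K(4)] less_imp_le[OF L(4)] e
          by (intro add_mono enn2real_leI) auto
    finally show ?thesis by simp
  qed
  have int: "(\<lambda>x. indicator S x - trig A a x) \<in> cell_l2 N"
  proof (intro l2_diff trig_cell_l2 l2_boundI)
    show "(\<lambda>x. indicator S x :: complex) \<in> borel_measurable (lebesgue_on ?W)" using S by simp
    show "integrable (lebesgue_on ?W) (\<lambda>x. 1 :: real)" by (intro integrable_on_cell continuous_intros)
  qed (auto simp: indicator_def)
  have iE: "integrable (lebesgue_on ?W) (\<lambda>x. indicator ?E x :: real)"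
    using E finite_measure.emeasure_finite[OF finite_measure_cell, of N]
    by (intro integrable_real_indicator) (auto simp: sets_restrict_space_iff less_top)
  have "msq N (\<lambda>x. indicator S x - trig A a x) \<le> mean N (\<lambda>x. 2 * indicator ?E x + 2 * \<eta>\<^sup>2)"
    unfolding msq_def
  proof (rule mean_mono_integrable)
    show "integrable (lebesgue_on ?W) (\<lambda>x. (norm (indicator S x - trig A a x))\<^sup>2)" using l2D(2)[OF int] .
    show "integrable (lebesgue_on ?W) (\<lambda>x. 2 * indicator ?E x + 2 * \<eta>\<^sup>2)"
      by (intro Bochner_Integration.integrable_add Bochner_Integration.integrable_mult_right iE
          integrable_on_cell[of "\<lambda>x. 2 * \<eta>\<^sup>2"] continuous_intros)
    fix x assume x: "x \<in> ?W"
    let ?g = "complex_of_real (g (torus_map N x))"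
    have "(norm (indicator S x - trig A a x))\<^sup>2 \<le> 2 * (norm (indicator S x - ?g))\<^sup>2
        + 2 * (norm (?g - trig A a x))\<^sup>2"
      using norm_add_squared_le[of "indicator S x - ?g" "?g - trig A a x"] by simp
    also have "(norm (?g - trig A a x))\<^sup>2 \<le> \<eta>\<^sup>2" by (intro power_mono A) auto
    also have "(norm (indicator S x - ?g))\<^sup>2 \<le> indicator ?E x"
    proof (cases "x \<in> K \<union> L")
      case True
      hence "indicator S x = ?g" using K(2) L(2) g(3,4) by (auto simp: indicator_def)
      thus ?thesis by simp
    next
      case False
      have "indicator S x - ?g = complex_of_real (indicator S x - g (torus_map N x))"
          by (simp add: indicator_def)
      hence "norm (indicator S x - ?g) = \<bar>indicator S x - g (torus_map N x)\<bar>" by (simp only: norm_of_real)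
      also have "\<dots> \<le> 1" using g01[of "torus_map N x"] by (auto simp: indicator_def)
      finally have "(norm (indicator S x - ?g))\<^sup>2 \<le> 1" by (simp add: power_le_one)
      thus ?thesis using x False by simp
    qed
    finally show "(norm (indicator S x - trig A a x))\<^sup>2 \<le> 2 * indicator ?E x + 2 * \<eta>\<^sup>2" by simp
  qed
  also have "\<dots> = 2 * mean N (\<lambda>x. indicator ?E x) + 2 * mean N (\<lambda>x :: real ^ 'n. \<eta>\<^sup>2)"
  proof -
    have "integrable (lebesgue_on ?W) (\<lambda>x. 2 * \<eta>\<^sup>2 :: real)"
        by (intro integrable_on_cell continuous_on_const)
    moreover have "integrable (lebesgue_on ?W) (\<lambda>x. 2 * indicator ?E x :: real)" using iE by simp
    ultimately show ?thesis by (simp only: mean_add mean_real_cmult)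
  qed
  also have "mean N (\<lambda>x :: real ^ 'n. \<eta>\<^sup>2) = \<eta>\<^sup>2"
    using mean_const[OF N, of "complex_of_real (\<eta>\<^sup>2)", where ?'n='n]
        by (simp only: mean_of_real[symmetric] of_real_eq_iff)
  also have "mean N (\<lambda>x. indicator ?E x) = measure lebesgue ?E / ?V"
    using E by (simp add: mean_def measure_restrict_space Int_absorb2 divide_inverse mult.commute)
  also have "2 * (measure lebesgue ?E / ?V) + 2 * \<eta>\<^sup>2 \<le> 2 * (2 * e / ?V) + 2 * \<eta>\<^sup>2"
    using mE V by (intro add_mono mult_left_mono divide_right_mono) auto
  also have "\<dots> < \<epsilon>" using V \<epsilon> by (simp add: \<eta>(2) e_def)
  finally show "\<exists>A a. finite A \<and> A \<subseteq> lattice N \<and> msq N (\<lambda>x. indicator S x - trig A a x) < \<epsilon>"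
    using A by blast
qed

theorem trig_dense_l2:
  assumes N: "N > 0" and w: "w \<in> cell_l2 N"
  shows "trig_dense N (w :: real ^ 'n \<Rightarrow> complex)"
proof -
  let ?M = "lebesgue_on (cell N :: (real ^ 'n) set)"
  obtain s where s': "\<forall>i. simple_function ?M (s i)" "\<forall>x\<in>space ?M. (\<lambda>i. s i x) \<longlonglongrightarrow> w x"
     "\<forall>i. \<forall>x\<in>space ?M. dist (s i x) 0 \<le> 2 * dist (w x) 0"
    using borel_measurable_implies_sequence_metric[OF l2D(1)[OF w], of 0] by blast
  have s: "\<And>i. simple_function ?M (s i)" "\<And>x. x \<in> space ?M \<Longrightarrow> (\<lambda>i. s i x) \<longlonglongrightarrow> w x"
     "\<And>i x. x \<in> space ?M \<Longrightarrow> norm (s i x) \<le> 2 * norm (w x)"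
    using s' by (simp_all add: dist_norm)
  have sl2: "s i \<in> cell_l2 N" for i
  proof (rule l2_boundI)
    show "s i \<in> borel_measurable ?M" by (rule borel_measurable_simple_function[OF s(1)])
    show "integrable ?M (\<lambda>x. 4 * (norm (w x))\<^sup>2)" using l2D(2)[OF w] by simp
    show "(norm (s i x))\<^sup>2 \<le> 4 * (norm (w x))\<^sup>2" if "x \<in> space ?M" for x
      using power_mono[OF s(3)[OF that, of i] norm_ge_zero, of 2] by (simp add: power_mult_distrib)
  qed
  have sdense: "trig_dense N (s i)" for i
  proof -
    have ind: "indicator (s i -` {y} \<inter> space ?M) \<in> cell_l2 N" for y :: complex
    proof (rule l2_boundI)
      show "(indicator (s i -` {y} \<inter> space ?M) :: _ \<Rightarrow> complex) \<in> borel_measurable ?M"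
        using simple_functionD(2)[OF s(1)] by (intro borel_measurable_indicator)
      show "integrable ?M (\<lambda>x. 1 :: real)" by (intro integrable_on_cell continuous_intros)
    qed (auto simp: indicator_def)
    have dense: "trig_dense N (\<lambda>x. \<Sum>y\<in>s i ` space ?M. y * indicator (s i -` {y} \<inter> space ?M) x)"
    proof (intro trig_dense_sum l2_cmult trig_dense_cmult)
      show "finite (s i ` space ?M)" by (rule simple_functionD(1)[OF s(1)])
      show "trig_dense N (indicator (s i -` {y} \<inter> space ?M) :: _ \<Rightarrow> complex)" for y
        using simple_functionD(2)[OF s(1), of i "{y}"] by (rule trig_dense_indicator[OF N])
    qed (rule ind)
    have eq: "(\<Sum>y\<in>s i ` space ?M. y * indicator (s i -` {y} \<inter> space ?M) x) = s i x" if x: "x \<in> space ?M"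
        for x
    proof -
      have "(\<Sum>y\<in>s i ` space ?M. y * indicator (s i -` {y} \<inter> space ?M) x) = (\<Sum>y\<in>s i ` space ?M. if y
          = s i x then y else 0)"
        using x by (intro sum.cong) (auto simp: indicator_def)
      also have "\<dots> = s i x" using x simple_functionD(1)[OF s(1)] by simp
      finally show ?thesis .
    qed
    have "msq N (\<lambda>x. (\<Sum>y\<in>s i ` space ?M. y * indicator (s i -` {y} \<inter> space ?M) x) - trig A a x)
        = msq N (\<lambda>x. s i x - trig A a x)" for A a
      unfolding msq_def mean_def by (intro arg_cong[where f="\<lambda>z. z /\<^sub>R
          _"] Bochner_Integration.integral_cong refl) (simp only: eq)
    thus ?thesis using dense unfolding trig_dense_def by simp
  qed
  have "(\<lambda>i. LINT x|?M. (norm (w x - s i x))\<^sup>2) \<longlonglongrightarrow> (LINT x|?M. 0)"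
  proof (rule integral_dominated_convergence)
    show "integrable ?M (\<lambda>x. 9 * (norm (w x))\<^sup>2)" using l2D(2)[OF w] by simp
    show "(\<lambda>x. (norm (w x - s i x))\<^sup>2) \<in> borel_measurable ?M" for i
      using l2D(1)[OF l2_diff[OF w sl2]] by simp
    show "AE x in ?M. (\<lambda>i. (norm (w x - s i x))\<^sup>2) \<longlonglongrightarrow> 0"
    proof (rule AE_I2)
      fix x assume "x \<in> space ?M"
      from tendsto_power[OF tendsto_norm[OF tendsto_diff[OF tendsto_const[of "w x"] s(2)[OF this]]], of 2]
      show "(\<lambda>i. (norm (w x - s i x))\<^sup>2) \<longlonglongrightarrow> 0" by simp
    qed
    show "AE x in ?M. norm ((norm (w x - s i x))\<^sup>2) \<le> 9 * (norm (w x))\<^sup>2" for i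
    proof (rule AE_I2)
      fix x assume x: "x \<in> space ?M"
      have "norm (w x - s i x) \<le> 3 * norm (w x)"
        using norm_triangle_ineq4[of "w x" "s i x"] s(3)[OF x, of i] by simp
      thus "norm ((norm (w x - s i x))\<^sup>2) \<le> 9 * (norm (w x))\<^sup>2"
        using power_mono[of "norm (w x - s i x)" "3 * norm (w x)" 2] by (simp add: power_mult_distrib)
    qed
  qed simp
  hence lim: "(\<lambda>i. msq N (\<lambda>x. w x - s i x)) \<longlonglongrightarrow> 0"
    unfolding msq_def mean_def by (auto intro!: tendsto_eq_intros)
  show ?thesis unfolding trig_dense_def
  proof (intro allI impI)
    fix \<epsilon> :: real assume "\<epsilon> > 0"
    hence e: "\<epsilon> / 4 > 0" by simp
    obtain i where i: "msq N (\<lambda>x. w x - s i x) < \<epsilon> / 4"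
      using order_tendstoD(2)[OF lim e] by (auto simp: eventually_sequentially)
    obtain A a where A: "finite A" "A \<subseteq> lattice N" "msq N (\<lambda>x. s i x - trig A a x) < \<epsilon> / 4"
      using sdense[of i] e unfolding trig_dense_def by blast
    have "msq N (\<lambda>x. (w x - s i x) + (s i x - trig A a x)) \<le> 2 * msq N (\<lambda>x. w x - s i x)
        + 2 * msq N (\<lambda>x. s i x - trig A a x)"
      by (intro msq_add_le l2_diff w sl2 trig_cell_l2)
    hence "msq N (\<lambda>x. w x - trig A a x) < \<epsilon>" using i A by simp
    thus "\<exists>A a. finite A \<and> A \<subseteq> lattice N \<and> msq N (\<lambda>x. w x - trig A a x) < \<epsilon>" using A by blast
  qed
qed

lemma mean_mult_cnj_trig:
  assumes "w \<in> cell_l2 N"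
  shows "mean N (\<lambda>x. w x * cnj (trig A b x)) = (\<Sum>k\<in>A. cnj (b k) * fourier N w k)"
proof -
  have wave: "(\<lambda>x. cnj (wave k x)) \<in> cell_l2 N" for k
    by (intro l2_cnj continuous_cell_l2 continuous_intros)
  have "(LINT x|cell_measure N. w x * cnj (trig A b x))
      = (LINT x|cell_measure N. (\<Sum>k\<in>A. cnj (b k) * (w x * cnj (wave k x))))"
    by (intro Bochner_Integration.integral_cong refl) (simp add: trig_def sum_distrib_left mult_ac)
  also have "\<dots> = (\<Sum>k\<in>A. cnj (b k) * (LINT x|cell_measure N. w x * cnj (wave k x)))"
    by (subst Bochner_Integration.integral_sum; (intro Bochner_Integration.integrable_mult_right
        l2_mult_integrable assms wave)?) simp
  finally show ?thesis by (simp add: mean_def fourier_def scaleR_right.sum)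
qed

text \<open>Completing the square. The choice \<open>b = fourier N w\<close> minimises the left-hand side.\<close>

lemma msq_diff_trig:
  assumes N: "N > 0" and w: "w \<in> cell_l2 N" and A: "finite A" "A \<subseteq> lattice N"
  shows "msq N (\<lambda>x. w x - trig A b x) = msq N w - sum_norm_sq A (fourier N w)
      + (\<Sum>k\<in>A. (norm (fourier N w k - b k))\<^sup>2)"
proof -
  let ?p = "trig A b"
  have p: "?p \<in> cell_l2 N" by (rule trig_cell_l2)
  have lat: "differences A \<subseteq> lattice N" using A lattice_diff by (fastforce simp: differences_def)
  have ip: "integrable (cell_measure N) (\<lambda>x. w x * cnj (?p x))" by (intro l2_mult_integrable l2_cnj w p)
  have sq: "(norm (z - y))\<^sup>2 = (norm z)\<^sup>2 + (norm y)\<^sup>2 - 2 * Re (z * cnj y)" for z y :: complex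
    by (simp add: cmod_power2 power2_diff algebra_simps)
  have "(LINT x|cell_measure N. (norm (w x - ?p x))\<^sup>2) = (LINT x|cell_measure N. (norm (w x))\<^sup>2
      + (norm (?p x))\<^sup>2 - 2 * Re (w x * cnj (?p x)))"
    by (simp only: sq)
  also have "\<dots> = (LINT x|cell_measure N. (norm (w x))\<^sup>2) + (LINT x|cell_measure N. (norm (?p x))\<^sup>2)
      - 2 * Re (LINT x|cell_measure N. w x * cnj (?p x))"
    using l2D(2)[OF w] l2D(2)[OF p] integrable_Re[OF ip]
    by (simp only: Bochner_Integration.integral_diff Bochner_Integration.integral_add
        Bochner_Integration.integrable_add
        Bochner_Integration.integrable_mult_right integral_mult_right_zero integral_Re[OF ip])
  finally have int: "(LINT x|cell_measure N. (norm (w x - ?p x))\<^sup>2)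
      = (LINT x|cell_measure N. (norm (w x))\<^sup>2) + (LINT x|cell_measure N. (norm (?p x))\<^sup>2)
          - 2 * Re (LINT x|cell_measure N. w x * cnj (?p x))" .
  have "msq N (\<lambda>x. w x - ?p x) = msq N w + msq N ?p - 2 * Re (mean N (\<lambda>x. w x * cnj (?p x)))"
    unfolding msq_def mean_def int by (simp add: algebra_simps)
  also have "\<dots> = msq N w + (\<Sum>k\<in>A. (norm (b k))\<^sup>2 - 2 * Re (cnj (b k) * fourier N w k))"
    using mean_norm_trig[OF N A(1) lat] by (simp add: msq_def mean_mult_cnj_trig[OF w] sum_subtractf
        sum_distrib_left)
  also have "(\<Sum>k\<in>A. (norm (b k))\<^sup>2 - 2 * Re (cnj (b k) * fourier N w k))
      = (\<Sum>k\<in>A. (norm (fourier N w k - b k))\<^sup>2 - (norm (fourier N w k))\<^sup>2)"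
    by (intro sum.cong refl) (simp add: sq mult.commute)
  finally show ?thesis by (simp add: sum_subtractf)
qed

lemma bessel:
  assumes "N > 0" "w \<in> cell_l2 N" "finite A" "A \<subseteq> lattice N"
  shows "sum_norm_sq A (fourier N w) \<le> msq N w"
  using msq_diff_trig[OF assms, of "fourier N w"] msq_nonneg[of N "\<lambda>x. w x - trig A (fourier N w) x"]
      by simp

lemma parseval_approx:
  assumes N: "N > 0" and w: "w \<in> cell_l2 N" and "\<epsilon> > 0"
  shows "\<exists>A. finite A \<and> A \<subseteq> lattice N \<and> (\<forall>B. finite B \<longrightarrow> B \<subseteq> lattice N \<longrightarrow> A \<subseteq> B \<longrightarrow>
      msq N (\<lambda>x. w x - trig B (fourier N w) x) < \<epsilon>)"
proof -
  obtain A a where A: "finite A" "A \<subseteq> lattice N" "msq N (\<lambda>x. w x - trig A a x) < \<epsilon>"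
    using trig_dense_l2[OF N w] assms(3) unfolding trig_dense_def by blast
  have "msq N (\<lambda>x. w x - trig B (fourier N w) x) < \<epsilon>" if B: "finite B" "B \<subseteq> lattice N" "A \<subseteq> B" for B
  proof -
    have "trig A a = trig B (\<lambda>k. if k \<in> A then a k else 0)"
    proof
      fix x show "trig A a x = trig B (\<lambda>k. if k \<in> A then a k else 0) x"
        unfolding trig_def using B by (intro sum.mono_neutral_cong_left) auto
    qed
    moreover have "msq N (\<lambda>x. w x - trig B (fourier N w) x)
        \<le> msq N (\<lambda>x. w x - trig B (\<lambda>k. if k \<in> A then a k else 0) x)"
      unfolding msq_diff_trig[OF N w B(1,2)] by (auto intro!: sum_nonneg)
    ultimately show ?thesis using A by simp
  qed
  thus ?thesis using A by blast
qed

text \<open>The mean is the sum of \<open>|k|\<^sup>2 * |fourier N w k|\<^sup>2\<close>. Since the series is infinite, the mean is instead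
  shown to lie within any \<open>e\<close> of a finite partial sum, which is real and nonnegative.\<close>

lemma mean_mult_cnj_laplacian:
  fixes w G :: "real ^ 'n \<Rightarrow> complex"
  assumes N: "N > 0" and w: "w \<in> cell_l2 N" and G: "G \<in> cell_l2 N"
    and eq: "\<And>k. k \<in> lattice N \<Longrightarrow> fourier N G k = of_real ((norm k)\<^sup>2) * fourier N w k"
  shows "Im (mean N (\<lambda>x. G x * cnj (w x))) = 0" "Re (mean N (\<lambda>x. G x * cnj (w x))) \<ge> 0"
proof -
  let ?z = "mean N (\<lambda>x. G x * cnj (w x))"
  have near: "\<exists>r\<ge>0. norm (?z - complex_of_real r) \<le> e" if e: "e > 0" for e
  proof -
    \<comment> \<open>balances the two terms of \<open>norm_integral_mult_le\<close>: each becomes at most \<open>e / 2\<close>\<close>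
    define \<delta> where "\<delta> = e / (msq N G + 1)"
    have \<delta>: "\<delta> > 0" using e msq_nonneg[of N G] by (simp add: \<delta>_def add_nonneg_pos)
    obtain A where A: "finite A" "A \<subseteq> lattice N" "msq N (\<lambda>x. w x - trig A (fourier N w) x) < \<delta> * e"
      using parseval_approx[OF N w, of "\<delta> * e"] \<delta> e by (metis mult_pos_pos order_refl)
    let ?p = "trig A (fourier N w)"
    define r where "r = (\<Sum>k\<in>A. (norm k)\<^sup>2 * (norm (fourier N w k))\<^sup>2)"
    have r: "r \<ge> 0" unfolding r_def by (intro sum_nonneg) auto
    have "mean N (\<lambda>x. G x * cnj (?p x)) = (\<Sum>k\<in>A. cnj (fourier N w k) * (of_real ((norm k)\<^sup>2) * fourier N w
        k))"
      unfolding mean_mult_cnj_trig[OF G] by (intro sum.cong refl) (use A eq in auto)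
    also have "\<dots> = complex_of_real r"
      unfolding r_def of_real_sum of_real_mult complex_norm_square[of "fourier _ _ _"]
          by (intro sum.cong refl) (simp add: mult_ac)
    finally have p: "mean N (\<lambda>x. G x * cnj (?p x)) = complex_of_real r" .
    have d: "(\<lambda>x. cnj (w x - ?p x)) \<in> cell_l2 N" by (intro l2_cnj l2_diff w trig_cell_l2)
    have "?z - complex_of_real r = mean N (\<lambda>x. G x * cnj (w x) - G x * cnj (?p x))"
      unfolding p[symmetric] by (intro mean_diff_integrable l2_mult_integrable l2_cnj w trig_cell_l2 G)
    also have "\<dots> = (LINT x|cell_measure N. G x * cnj (w x - ?p x)) /\<^sub>R cell_volume N TYPE('n)"
      by (simp add: mean_def right_diff_distrib)
    also have "norm \<dots> = norm (LINT x|cell_measure N. G x * cnj (w x - ?p x)) /\<^sub>R cell_volume N TYPE('n)"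
      by (simp add: cell_volume_def)
    also have "\<dots> \<le> (\<delta> / 2 * (LINT x|cell_measure N. (norm (G x))\<^sup>2)
        + 1 / (2 * \<delta>) * (LINT x|cell_measure N. (norm (cnj (w x - ?p x)))\<^sup>2)) /\<^sub>R cell_volume N TYPE('n)"
      by (intro scaleR_left_mono norm_integral_mult_le G d \<delta>) (simp add: cell_volume_def)
    also have "\<dots> = \<delta> / 2 * msq N G + 1 / (2 * \<delta>) * msq N (\<lambda>x. w x - ?p x)"
      by (simp add: msq_def mean_def distrib_left mult_ac flip: complex_cnj_diff)
    also have "\<delta> / 2 * msq N G \<le> e / 2" using msq_nonneg[of N G] e
        by (simp add: \<delta>_def field_simps add_pos_nonneg)
    also have "1 / (2 * \<delta>) * msq N (\<lambda>x. w x - ?p x) \<le> 1 / (2 * \<delta>) * (\<delta> * e)"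
      using A(3) \<delta> by (intro mult_left_mono) auto
    also have "e / 2 + 1 / (2 * \<delta>) * (\<delta> * e) = e" using \<delta> by simp
    finally show ?thesis using r by auto
  qed
  show "Im ?z = 0"
  proof (rule ccontr)
    assume n: "Im ?z \<noteq> 0"
    then obtain r where "norm (?z - complex_of_real r) \<le> \<bar>Im ?z\<bar> / 2" using near[of "\<bar>Im ?z\<bar> / 2"] by auto
    moreover have "\<bar>Im ?z\<bar> \<le> norm (?z - complex_of_real r)"
        using abs_Im_le_cmod[of "?z - complex_of_real r"] by simp
    ultimately show False using n by simp
  qed
  show "Re ?z \<ge> 0"
  proof (rule ccontr)
    assume n: "\<not> Re ?z \<ge> 0"
    then obtain r where "r \<ge> 0" "norm (?z - complex_of_real r) \<le> \<bar>Re ?z\<bar> / 2" using near[of "\<bar>Re ?z\<bar> / 2"]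
        by auto
    moreover have "\<bar>Re ?z - r\<bar> \<le> norm (?z - complex_of_real r)"
        using abs_Re_le_cmod[of "?z - complex_of_real r"] by simp
    ultimately show False using n by simp
  qed
qed

context periodic_weight
begin

lemma weight_mult_integrable:
  assumes "u \<in> cell_l2 N"
  shows "integrable (cell_measure N) (\<lambda>x. \<psi> x * (norm (u x))\<^sup>2)"
proof (rule Bochner_Integration.integrable_bound[OF l2D(2)[OF assms]])
  have "integrable (cell_measure N) \<psi>" by (rule integrable_on_cell[OF continuous])
  thus "(\<lambda>x. \<psi> x * (norm (u x))\<^sup>2) \<in> borel_measurable (cell_measure N)" using l2D(1)[OF assms] by simp
  show "AE x in lebesgue_on (cell N). norm (\<psi> x * (norm (u x))\<^sup>2) \<le> norm ((norm (u x))\<^sup>2)"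
    using nonneg le_one by (auto simp: abs_mult intro!: AE_I2 mult_left_le_one_le)
qed

text \<open>Split \<open>w\<close> into the part \<open>p\<close> with frequencies in the shell and the rest \<open>q\<close>. On the frequencies of
  \<open>q\<close> the factor \<open>|k|\<^sup>2 - \<mu>\<close> has absolute value at least one, so \<open>q\<close> is bounded by \<open>G\<close>; on \<open>p\<close> the
  lower bound for shells applies, and \<open>p = w - q\<close> brings the weighted mean back to \<open>w\<close>.\<close>

theorem cell_estimate:
  "\<exists>C>0. \<forall>N \<mu> w G. N > 0 \<longrightarrow> w \<in> cell_l2 N \<longrightarrow> G \<in> cell_l2 N \<longrightarrow>
     (\<forall>k\<in>lattice N. fourier N G k = (of_real ((norm k)\<^sup>2) - of_real \<mu>) * fourier N w k) \<longrightarrow>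
     msq N w \<le> C * (msq N G + mean N (\<lambda>x. \<psi> x * (norm (w x))\<^sup>2))"
proof -
  obtain c where c: "c > 0" "\<And>N \<mu> A a. N > 0 \<Longrightarrow> finite A \<Longrightarrow> A \<subseteq> lattice N \<Longrightarrow> A \<subseteq> shell \<mu> \<Longrightarrow>
     c * sum_norm_sq A a \<le> weighted N A a"
    using shell_bound by blast
  have "msq N w \<le> (1 + 2 / c) * (msq N G + mean N (\<lambda>x. \<psi> x * (norm (w x))\<^sup>2))"
    if N: "N > 0" and w: "w \<in> cell_l2 N" and G: "G \<in> cell_l2 N" and
     eq: "\<forall>k\<in>lattice N. fourier N G k = (of_real ((norm k)\<^sup>2) - of_real \<mu>) * fourier N w k" for N \<mu> w G
  proof -
    let ?a = "fourier N w"
    define S where "S = {k \<in> lattice N. k \<in> (shell \<mu> :: (real ^ 'n) set)}"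
    have S: "S \<subseteq> lattice N" "S \<subseteq> shell \<mu>" by (auto simp: S_def)
    have finS: "finite S"
    proof (rule finite_subset[OF _ finite_lattice_ball[OF N]])
      show "S \<subseteq> {k \<in> lattice N. norm k \<le> \<bar>\<mu>\<bar> + 2}"
      proof
        fix k assume k: "k \<in> S"
        have "norm k \<le> \<bar>\<mu>\<bar> + 2"
        proof (rule ccontr)
          assume "\<not> norm k \<le> \<bar>\<mu>\<bar> + 2"
          hence *: "\<bar>\<mu>\<bar> + 2 < norm k" by simp
          moreover have "norm k * 1 \<le> norm k * norm k" using * by (intro mult_left_mono) auto
          moreover have "norm k * norm k \<le> \<mu> + 1" using k
              by (simp add: S_def shell_def power2_eq_square abs_le_iff)
          ultimately show False by linarith
        qed
        thus "k \<in> {k \<in> lattice N. norm k \<le> \<bar>\<mu>\<bar> + 2}" using k by (simp add: S_def)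
      qed
    qed
    let ?p = "trig S ?a"
    define q where "q x = w x - ?p x" for x
    have q: "q \<in> cell_l2 N" unfolding q_def by (intro l2_diff w trig_cell_l2)
    have msq_q: "msq N q = msq N w - sum_norm_sq S ?a"
      unfolding q_def by (subst msq_diff_trig[OF N w finS S(1)]) simp
    have qG: "msq N q \<le> msq N G"
    proof (rule field_le_epsilon)
      fix \<epsilon> :: real assume "\<epsilon> > 0"
      from parseval_approx[OF N w this] obtain A where A: "finite A" "A \<subseteq> lattice N" and
        approx: "\<forall>B. finite B \<longrightarrow> B \<subseteq> lattice N \<longrightarrow> A \<subseteq> B \<longrightarrow> msq N (\<lambda>x. w x - trig B ?a x) < \<epsilon>"
        by (elim exE conjE)
      define K where "K = A \<union> S"
      have K: "finite K" "K \<subseteq> lattice N" "A \<subseteq> K" "S \<subseteq> K" using A finS S by (auto simp: K_def)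
      have "msq N w - sum_norm_sq K ?a < \<epsilon>"
        using approx[rule_format, OF K(1-3)] msq_diff_trig[OF N w K(1,2), of ?a] by simp
      moreover have "sum_norm_sq K ?a = sum_norm_sq (K - S) ?a + sum_norm_sq S ?a"
        by (rule sum.subset_diff[OF K(4,1)])
      moreover have "sum_norm_sq (K - S) ?a \<le> sum_norm_sq (K - S) (fourier N G)"
      proof (rule sum_mono)
        fix k assume k: "k \<in> K - S"
        have "1 \<le> \<bar>(norm k)\<^sup>2 - \<mu>\<bar>" using k K by (auto simp: S_def shell_def)
        hence "1 * norm (?a k) \<le> \<bar>(norm k)\<^sup>2 - \<mu>\<bar> * norm (?a k)" by (intro mult_right_mono) auto
        also have "\<dots> = norm (fourier N G k)" using eq k K
          by (subst bspec[OF eq]) (auto simp: norm_mult simp flip: of_real_diff of_real_power)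
        finally show "(norm (?a k))\<^sup>2 \<le> (norm (fourier N G k))\<^sup>2" by (intro power_mono) auto
      qed
      moreover have "sum_norm_sq (K - S) (fourier N G) \<le> msq N G"
        using K by (intro bessel[OF N G]) auto
      ultimately show "msq N q \<le> msq N G + \<epsilon>" unfolding msq_q by linarith
    qed
    let ?m = "\<lambda>u. mean N (\<lambda>x. \<psi> x * (norm (u x))\<^sup>2)"
    have "c * sum_norm_sq S ?a \<le> ?m ?p" by (rule c(2)[OF N finS S])
    also have "\<dots> \<le> mean N (\<lambda>x. 2 * (\<psi> x * (norm (w x))\<^sup>2) + 2 * (norm (q x))\<^sup>2)"
    proof (rule mean_mono_integrable)
      show "integrable (cell_measure N) (\<lambda>x. \<psi> x * (norm (?p x))\<^sup>2)"
        by (intro weight_mult_integrable trig_cell_l2)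
      show "integrable (cell_measure N) (\<lambda>x. 2 * (\<psi> x * (norm (w x))\<^sup>2) + 2 * (norm (q x))\<^sup>2)"
        using weight_mult_integrable[OF w] l2D(2)[OF q] by auto
      fix x
      have "\<psi> x * (norm (?p x))\<^sup>2 \<le> \<psi> x * (2 * (norm (w x))\<^sup>2 + 2 * (norm (q x))\<^sup>2)"
        using norm_add_squared_le[of "w x" "- q x"] nonneg
        by (intro mult_left_mono) (auto simp: q_def norm_minus_commute[of "?p x"])
      also have "\<dots> = 2 * (\<psi> x * (norm (w x))\<^sup>2) + \<psi> x * (2 * (norm (q x))\<^sup>2)" by (simp add: algebra_simps)
      also have "\<psi> x * (2 * (norm (q x))\<^sup>2) \<le> 2 * (norm (q x))\<^sup>2" using le_one nonneg
          by (intro mult_left_le_one_le) auto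
      finally show "\<psi> x * (norm (?p x))\<^sup>2 \<le> 2 * (\<psi> x * (norm (w x))\<^sup>2) + 2 * (norm (q x))\<^sup>2" by simp
    qed
    also have "\<dots> = 2 * ?m w + 2 * msq N q"
      using weight_mult_integrable[OF w] l2D(2)[OF q] by (simp add: mean_add mean_real_cmult msq_def)
    finally have "c * sum_norm_sq S ?a \<le> 2 * ?m w + 2 * msq N G" using qG by linarith
    hence "sum_norm_sq S ?a \<le> 2 / c * (msq N G + ?m w)" using c(1) by (simp add: field_simps)
    moreover have "?m w \<ge> 0" unfolding mean_def
      by (auto simp: cell_volume_def nonneg intro!: Bochner_Integration.integral_nonneg)
    ultimately have "msq N w \<le> (msq N G + ?m w) + 2 / c * (msq N G + ?m w)" using msq_q qG by linarith
    thus ?thesis by (simp add: distrib_right)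
  qed
  moreover have "1 + 2 / c > 0" using c by (simp add: add_pos_pos)
  ultimately show ?thesis by blast
qed

end

section \<open>A smooth cutoff function\<close>

text \<open>Functions of one variable with \<open>k\<close> continuous derivatives.\<close>

primrec smooth :: "nat \<Rightarrow> (real \<Rightarrow> complex) set" where
  "smooth 0 = {g. continuous_on UNIV g}"
| "smooth (Suc k) = {g. \<exists>g'. (\<forall>t. (g has_vector_derivative g' t) (at t)) \<and> g' \<in> smooth k}"

lemma smoothI: "(\<And>t. (g has_vector_derivative g' t) (at t)) \<Longrightarrow> g' \<in> smooth k \<Longrightarrow> g \<in> smooth (Suc k)"
  by auto

lemma smooth_Suc_subset: "smooth (Suc k) \<subseteq> smooth k"
proof (induction k)
  case 0
  show ?case by (auto intro!: continuous_at_imp_continuous_on intro: has_vector_derivative_continuous)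
qed auto

lemma smooth_const: "(\<lambda>t. c) \<in> smooth k"
  by (induction k arbitrary: c) (auto intro!: exI[of _ "\<lambda>_. 0"])

lemma smooth_add: "f \<in> smooth k \<Longrightarrow> g \<in> smooth k \<Longrightarrow> (\<lambda>t. f t + g t) \<in> smooth k"
proof (induction k arbitrary: f g)
  case (Suc k)
  then obtain f' g' where "\<And>t. (f has_vector_derivative f' t) (at t)" "f' \<in> smooth k"
    "\<And>t. (g has_vector_derivative g' t) (at t)" "g' \<in> smooth k" by auto
  thus ?case by (intro smoothI[where g'="\<lambda>t. f' t + g' t"] Suc.IH has_vector_derivative_add)
qed (auto intro: continuous_intros)

lemma smooth_mult: "f \<in> smooth k \<Longrightarrow> g \<in> smooth k \<Longrightarrow> (\<lambda>t. f t * g t) \<in> smooth k"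
proof (induction k arbitrary: f g)
  case (Suc k)
  then obtain f' g' where *: "\<And>t. (f has_vector_derivative f' t) (at t)" "f' \<in> smooth k"
    "\<And>t. (g has_vector_derivative g' t) (at t)" "g' \<in> smooth k" by auto
  have "f \<in> smooth k" "g \<in> smooth k" using Suc.prems smooth_Suc_subset by blast+
  thus ?case using *
    by (intro smoothI[where g'="\<lambda>t. f t * g' t + f' t * g t"] smooth_add Suc.IH
        has_vector_derivative_mult)
qed (auto intro: continuous_intros)

lemma smooth_affine: "f \<in> smooth k \<Longrightarrow> (\<lambda>t. f (c + a * t)) \<in> smooth k"
proof (induction k arbitrary: f)
  case 0
  thus ?case by (auto intro!: continuous_on_compose2[of UNIV f] continuous_intros)
next
  case (Suc k)
  then obtain f' where *: "\<And>t. (f has_vector_derivative f' t) (at t)" "f' \<in> smooth k" by auto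
  show ?case
  proof (rule smoothI)
    fix t
    have "((\<lambda>t. c + a * t) has_field_derivative a) (at t)" by (auto intro!: derivative_eq_intros)
    from vector_diff_chain_at[OF this[unfolded has_real_derivative_iff_has_vector_derivative] *(1)]
    show "((\<lambda>t. f (c + a * t)) has_vector_derivative of_real a * f' (c + a * t)) (at t)"
      by (simp add: o_def scaleR_conv_of_real)
    show "(\<lambda>t. of_real a * f' (c + a * t)) \<in> smooth k"
      by (intro smooth_mult smooth_const Suc.IH *)
  qed
qed

lemma cis_has_vector_derivative: "((\<lambda>t. cis (c * t)) has_vector_derivative \<i> * of_real c * cis (c * t))
    (at t)"
proof -
  have "((\<lambda>t. exp (t *\<^sub>R (\<i> * of_real c))) has_vector_derivative exp (t *\<^sub>R (\<i> * of_real c)) *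
      (\<i> * of_real c)) (at t)"
    by (rule exp_scaleR_has_vector_derivative_right)
  thus ?thesis by (simp add: cis_conv_exp scaleR_conv_of_real mult_ac)
qed

lemma smooth_cis: "(\<lambda>t. cis (c * t)) \<in> smooth k"
proof (induction k)
  case (Suc k)
  show ?case by (intro smoothI[OF cis_has_vector_derivative] smooth_mult smooth_const Suc)
qed (auto intro!: continuous_intros)

text \<open>The derivative of each member is an integer combination of two others, so all members are smooth
  at once, including at the origin.\<close>

definition flat :: "nat \<Rightarrow> real \<Rightarrow> real" where
  "flat m t = (if t > 0 then inverse t ^ m * exp (- inverse t) else 0)"

lemma flat_tendsto_0: "(flat m \<longlongrightarrow> 0) (at 0)"
proof -
  have "((\<lambda>t. inverse t ^ m / exp (inverse t)) \<longlongrightarrow> 0) (at_right (0::real))"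
    by (rule filterlim_compose[OF tendsto_power_div_exp_0 filterlim_inverse_at_top_right])
  hence "(flat m \<longlongrightarrow> 0) (at_right 0)"
    by (rule Lim_transform_eventually) (auto simp: flat_def exp_minus divide_inverse
        eventually_at_right_less
        intro!: eventually_mono[OF eventually_at_right_less])
  moreover have "(flat m \<longlongrightarrow> 0) (at_left 0)"
    by (rule Lim_transform_eventually[OF tendsto_const])
       (auto simp: flat_def eventually_at_filter)
  ultimately show ?thesis by (simp add: filterlim_split_at)
qed

lemma flat_deriv: "(flat m has_real_derivative flat (m + 2) t - real m * flat (m + 1) t) (at t)"
proof -
  consider "t > 0" | "t < 0" | "t = 0" by linarith
  thus ?thesis
  proof cases
    case 1
    have "((\<lambda>t. inverse t ^ m * exp (- inverse t)) has_real_derivative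
        (real m * (- (inverse t ^ Suc (Suc 0)) * inverse t ^ (m - Suc 0))) * exp (- inverse t) +
        (exp (- inverse t) * - (- (inverse t ^ Suc (Suc 0)))) * inverse t ^ m) (at t)"
      using 1 by (intro DERIV_mult DERIV_power DERIV_inverse DERIV_fun_exp DERIV_minus) auto
    hence "((\<lambda>t. inverse t ^ m * exp (- inverse t)) has_real_derivative flat (m + 2) t
        - real m * flat (m + 1) t) (at t)"
      using 1 by (cases m) (simp_all add: flat_def algebra_simps)
    moreover have "eventually (\<lambda>x. x > 0) (nhds t)" using 1
        by (intro eventually_nhds_in_open[of "{0<..}", simplified]) auto
    hence "eventually (\<lambda>t. inverse t ^ m * exp (- inverse t) = flat m t) (nhds t)"
      by eventually_elim (simp add: flat_def)
    ultimately show ?thesis using 1 by (subst DERIV_cong_ev[OF refl, symmetric]) (auto simp: flat_def)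
  next
    case 2
    have "eventually (\<lambda>x. x < 0) (nhds t)" using 2
        by (intro eventually_nhds_in_open[of "{..<0}", simplified]) auto
    hence ev: "eventually (\<lambda>t. 0 = flat m t) (nhds t)" by eventually_elim (simp add: flat_def)
    have "(flat m has_real_derivative 0) (at t)"
      by (rule iffD1[OF DERIV_cong_ev[OF refl ev refl] DERIV_const])
    moreover have "flat (m + 2) t - real m * flat (m + 1) t = 0" using 2 by (simp add: flat_def)
    ultimately show ?thesis by metis
  next
    case 3
    have "((\<lambda>h. (flat m (0 + h) - flat m 0) / h) \<longlongrightarrow> 0) (at 0)"
      by (rule Lim_transform_eventually[OF flat_tendsto_0[of "Suc m"]])
         (auto simp: flat_def eventually_at_filter field_simps)
    thus ?thesis using 3 by (simp add: DERIV_def flat_def)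
  qed
qed

lemma smooth_flat: "(\<lambda>t. complex_of_real (flat m t)) \<in> smooth k"
proof (induction k arbitrary: m)
  case 0
  show ?case using flat_deriv by (auto intro!: continuous_at_imp_continuous_on continuous_intros intro:
      DERIV_isCont)
next
  case (Suc k)
  show ?case
  proof (rule smoothI)
    fix t
    show "((\<lambda>t. complex_of_real (flat m t)) has_vector_derivative complex_of_real (flat (m + 2) t) +
        - of_nat m * complex_of_real (flat (m + 1) t)) (at t)"
      using has_vector_derivative_of_real[OF flat_deriv[of m t]] by simp
    show "(\<lambda>t. complex_of_real (flat (m + 2) t) + - of_nat m * complex_of_real (flat (m + 1) t)) \<in> smooth
        k"
      by (intro smooth_add smooth_mult smooth_const Suc)
  qed
qed

text \<open>The derivative provided by membership in \<open>smooth (Suc k)\<close> might depend on \<open>k\<close>; uniqueness of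
  derivatives shows that it does not.\<close>

lemma smooth_derivative:
  assumes "\<And>k. b \<in> smooth k"
  obtains b' where "\<And>t. (b has_vector_derivative b' t) (at t)" "\<And>k. b' \<in> smooth k"
proof -
  obtain b' where b': "\<And>t. (b has_vector_derivative b' t) (at t)" using assms[of 1] by auto
  have "b' \<in> smooth k" for k
  proof -
    obtain c where c: "\<And>t. (b has_vector_derivative c t) (at t)" "c \<in> smooth k" using assms[of "Suc k"]
        by auto
    have "c = b'" using vector_derivative_unique_at[OF c(1) b'] by blast
    thus ?thesis using c by simp
  qed
  thus ?thesis using b' that by blast
qed

lemma derivative_zero_outside:
  assumes "\<And>t. (b has_vector_derivative b' t) (at t)" "\<And>t. \<bar>t\<bar> > 1 \<Longrightarrow> b t = 0" "\<bar>t\<bar> > 1"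
  shows "b' t = (0 :: complex)"
proof -
  have "open {t::real. \<bar>t\<bar> > 1}" by (intro open_Collect_less continuous_intros)
  hence "(b has_vector_derivative 0) (at t)"
    by (rule has_vector_derivative_transform_within_open[OF has_vector_derivative_const[of 0]])
        (use assms(2,3) in auto)
  thus ?thesis using vector_derivative_unique_at[OF assms(1)] by blast
qed

lemma continuous_bounded_support:
  fixes b :: "real \<Rightarrow> complex"
  assumes "continuous_on UNIV b" "\<And>t. \<bar>t\<bar> > 1 \<Longrightarrow> b t = 0"
  shows "\<exists>B. \<forall>t. norm (b t) \<le> B"
proof -
  have "bounded (b ` {-1..1})"
    by (intro compact_imp_bounded compact_continuous_image continuous_on_subset[OF assms(1)]) auto
  then obtain B where B: "\<And>t. t \<in> {-1..1} \<Longrightarrow> norm (b t) \<le> B" unfolding bounded_iff by (metis imageI)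
  have "norm (b t) \<le> B" for t
  proof (cases "\<bar>t\<bar> > 1")
    case True
    thus ?thesis using assms(2)[OF True] B[of 0] norm_ge_zero[of "b 0"]
        by (auto intro: order_trans simp del: norm_ge_zero)
  next
    case False
    hence "t \<in> {-1..1}" by auto
    thus ?thesis by (rule B)
  qed
  thus ?thesis by blast
qed

text \<open>The functions \<open>b 0\<close>, \<open>b 1\<close>, \<open>b 2\<close> are a bump function on \<open>[-1, 1]\<close> and its first two derivatives.\<close>

definition cutoff :: "(nat \<Rightarrow> real \<Rightarrow> complex) \<Rightarrow> real \<Rightarrow> bool" where
  "cutoff b B \<longleftrightarrow> b 0 0 = 1 \<and> (\<forall>m k. b m \<in> smooth k) \<and> (\<forall>m t. \<bar>t\<bar> > 1 \<longrightarrow> b m t = 0) \<and>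
     (\<forall>m\<le>2. \<forall>t. norm (b m t) \<le> B) \<and> (\<forall>m<2. \<forall>t. (b m has_vector_derivative b (Suc m) t) (at t))"

text \<open>The product of \<open>flat 0 (1 + t)\<close> and \<open>flat 0 (1 - t)\<close> is smooth and supported in \<open>[-1, 1]\<close>, and
  equals \<open>exp (-2)\<close> at the origin.\<close>

lemma ex_cutoff: "\<exists>b B. cutoff b B \<and> B \<ge> 1"
proof -
  define b0 where "b0 t = of_real (exp 2) * (of_real (flat 0 (1 + 1 * t)) * of_real
      (flat 0 (1 + (-1) * t)) :: complex)" for t
  have b0: "b0 \<in> smooth k" for k
    unfolding b0_def by (intro smooth_mult smooth_const smooth_affine[of "\<lambda>t. of_real (flat 0 t)"]
        smooth_flat)
  have z0: "b0 t = 0" if "\<bar>t\<bar> > 1" for t using that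
      by (auto simp: b0_def flat_def abs_if split: if_splits)
  have one: "b0 0 = 1" by (simp add: b0_def flat_def flip: of_real_mult exp_add)
  obtain b1 where b1: "\<And>t. (b0 has_vector_derivative b1 t) (at t)" "\<And>k. b1 \<in> smooth k"
    using smooth_derivative[OF b0] by blast
  obtain b2 where b2: "\<And>t. (b1 has_vector_derivative b2 t) (at t)" "\<And>k. b2 \<in> smooth k"
    using smooth_derivative[OF b1(2)] by blast
  have z1: "b1 t = 0" if "\<bar>t\<bar> > 1" for t using derivative_zero_outside[OF b1(1) z0 that] .
  have z2: "b2 t = 0" if "\<bar>t\<bar> > 1" for t using derivative_zero_outside[OF b2(1) z1 that] .
  have cont: "continuous_on UNIV b0" "continuous_on UNIV b1" "continuous_on UNIV b2"
    using b0[of 0] b1(2)[of 0] b2(2)[of 0] by auto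
  obtain B0 where B0: "\<And>t. norm (b0 t) \<le> B0" using continuous_bounded_support[OF cont(1) z0] by blast
  obtain B1 where B1: "\<And>t. norm (b1 t) \<le> B1" using continuous_bounded_support[OF cont(2) z1] by blast
  obtain B2 where B2: "\<And>t. norm (b2 t) \<le> B2" using continuous_bounded_support[OF cont(3) z2] by blast
  define B where "B = max 1 (max B0 (max B1 B2))"
  define b where "b m = (if m = 0 then b0 else if m = Suc 0 then b1 else if m = 2 then b2 else (\<lambda>_. 0))"
      for m :: nat
  have "norm (b m t) \<le> B" for m t
    using B0[of t] B1[of t] B2[of t] by (auto simp: b_def B_def le_max_iff_disj)
  moreover have "b m \<in> smooth k" for m k using b0 b1 b2 smooth_const[of 0] by (auto simp: b_def)
  moreover have "b m t = 0" if "\<bar>t\<bar> > 1" for m t using z0 z1 z2 that by (auto simp: b_def)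
  moreover have "(b m has_vector_derivative b (Suc m) t) (at t)" if "m < 2" for m t
    using that b1(1) b2(1) by (auto simp: b_def less_2_cases_iff numeral_2_eq_2)
  moreover have "b 0 0 = 1" using one by (simp add: b_def)
  ultimately have "cutoff b B" unfolding cutoff_def by blast
  moreover have "B \<ge> 1" by (simp add: B_def)
  ultimately show ?thesis by blast
qed

section \<open>Test functions of product form\<close>

text \<open>Test functions of several variables are needed only as products of functions of one coordinate. A
  partial derivative of such a product is again such a product, with one factor differentiated.\<close>

definition tensor :: "('n \<Rightarrow> real \<Rightarrow> complex) \<Rightarrow> real ^ 'n \<Rightarrow> complex" where
  "tensor g x = (\<Prod>j\<in>UNIV. g j (x $ j))"

lemma tensor_slot: "tensor (g(j := f)) x = f (x $ j) * (\<Prod>i\<in>UNIV - {j}. g i (x $ i))"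
proof -
  have "tensor (g(j := f)) x = (g(j := f)) j (x $ j) * (\<Prod>i\<in>UNIV - {j}. (g(j := f)) i (x $ i))"
    unfolding tensor_def by (rule prod.remove) auto
  also have "(\<Prod>i\<in>UNIV - {j}. (g(j := f)) i (x $ i)) = (\<Prod>i\<in>UNIV - {j}. g i (x $ i))"
    by (intro prod.cong) auto
  finally show ?thesis by (simp only: fun_upd_same)
qed

lemma tensor_has_derivative:
  fixes g :: "'n::finite \<Rightarrow> real \<Rightarrow> complex"
  assumes "\<forall>j t. (g j has_vector_derivative g' j t) (at t)"
  shows "(tensor g has_derivative (\<lambda>h. \<Sum>i\<in>UNIV. (h $ i *\<^sub>R g' i (x $ i)) * (\<Prod>j\<in>UNIV - {i}. g j (x $ j))))
      (at x)"
  unfolding tensor_def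
proof (rule has_derivative_prod)
  fix i
  have "((\<lambda>x. x $ i) has_derivative (\<lambda>h. h $ i)) (at x)"
    by (rule bounded_linear_imp_has_derivative) (rule bounded_linear_vec_nth)
  moreover have "(g i has_derivative (\<lambda>s. s *\<^sub>R g' i (x $ i))) (at (x $ i))"
    using assms by (simp add: has_vector_derivative_def)
  ultimately show "((\<lambda>x. g i (x $ i)) has_derivative (\<lambda>h. h $ i *\<^sub>R g' i (x $ i))) (at x)"
    by (rule has_derivative_compose)
qed

lemma partial_tensor:
  assumes "\<forall>j t. (g j has_vector_derivative g' j t) (at t)"
  shows "partial i (tensor g) = tensor (g(i := g' i))"
proof
  fix x
  have "partial i (tensor g) x = (\<Sum>j\<in>UNIV. (axis i 1 $ j *\<^sub>R g' j (x $ j)) * (\<Prod>l\<in>UNIV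
      - {j}. g l (x $ l)))"
    unfolding partial_def using frechet_derivative_at[OF tensor_has_derivative[OF assms, where x=x],
        symmetric] by simp
  also have "\<dots> = (\<Sum>j\<in>UNIV. if j = i then g' i (x $ i) * (\<Prod>l\<in>UNIV - {i}. g l (x $ l)) else 0)"
    by (intro sum.cong) (auto simp: axis_def)
  finally show "partial i (tensor g) x = tensor (g(i := g' i)) x" by (simp add: tensor_slot)
qed

lemma tensor_C_k:
  fixes g :: "'n::finite \<Rightarrow> real \<Rightarrow> complex"
  shows "(\<And>j. g j \<in> smooth k) \<Longrightarrow> tensor g \<in> C_k k"
proof (induction k arbitrary: g)
  case 0
  have "continuous_on UNIV (\<lambda>x :: real ^ 'n. g j (x $ j))" for j
    using 0[of j] by (auto intro!: continuous_on_compose2[of UNIV "g j"] continuous_intros)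
  thus ?case unfolding tensor_def by (auto intro!: continuous_on_prod)
next
  case (Suc k)
  have "\<forall>j. \<exists>g'. (\<forall>t. (g j has_vector_derivative g' t) (at t)) \<and> g' \<in> smooth k" using Suc.prems by simp
  then obtain g' where g': "\<forall>j t. (g j has_vector_derivative g' j t) (at t)" "\<And>j. g' j \<in> smooth k"
      by metis
  have "tensor g differentiable (at x)" for x
    using tensor_has_derivative[OF g'(1)] unfolding differentiable_def by blast
  moreover have "partial i (tensor g) \<in> C_k k" for i
  proof -
    have "g j \<in> smooth k" for j using Suc.prems smooth_Suc_subset by blast
    thus ?thesis unfolding partial_tensor[OF g'(1)] using g'(2) by (intro Suc.IH) auto
  qed
  ultimately show ?case by simp
qed

lemma tensor_test_function:
  fixes g :: "'n::finite \<Rightarrow> real \<Rightarrow> complex"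
  assumes "\<And>j k. g j \<in> smooth k" "\<And>j t. \<bar>t\<bar> > R \<Longrightarrow> g j t = 0"
  shows "tensor g \<in> test_functions"
proof -
  have "{x. tensor g x \<noteq> 0} \<subseteq> cbox (\<chi> j. -R) (\<chi> j. R)"
  proof
    fix x assume "x \<in> {x. tensor g x \<noteq> 0}"
    hence "g j (x $ j) \<noteq> 0" for j by (auto simp: tensor_def)
    hence "\<bar>x $ j\<bar> \<le> R" for j using assms(2)[of "x $ j" j] by force
    thus "x \<in> cbox (\<chi> j. -R) (\<chi> j. R)" by (auto simp: mem_box_cart abs_le_iff minus_le_iff)
  qed
  hence "bounded {x. tensor g x \<noteq> 0}" by (rule bounded_subset[OF bounded_cbox])
  thus ?thesis using tensor_C_k[OF assms(1)] by (auto simp: test_functions_def compact_closure)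
qed

text \<open>A product of \<open>modulated b N (k $ i) 0\<close> over the coordinates is the cutoff on scale \<open>N\<close> times the
  conjugate of \<open>wave k\<close>, and \<open>window\<close> is the cutoff with its \<open>j\<close>-th factor replaced by the \<open>m\<close>-th
  derivative.\<close>

definition modulated :: "(nat \<Rightarrow> real \<Rightarrow> complex) \<Rightarrow> nat \<Rightarrow> real \<Rightarrow> nat \<Rightarrow> real \<Rightarrow> complex" where
  "modulated b N c m t = b m (t / real N) * cis (- c * t)"

definition window :: "(nat \<Rightarrow> real \<Rightarrow> complex) \<Rightarrow> nat \<Rightarrow> 'n \<Rightarrow> nat \<Rightarrow> real ^ 'n \<Rightarrow> complex" where
  "window b N j m x = tensor ((\<lambda>i t. b 0 (t / real N))(j := (\<lambda>t. b m (t / real N)))) x"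

lemma tensor_modulated:
  "tensor ((\<lambda>i. modulated b N (k $ i) 0)(j := modulated b N (k $ j) m)) x
      = window b N j m x * cnj (wave k x)"
proof -
  have w: "cnj (wave k x) = (\<Prod>i\<in>UNIV. cis (- (k $ i) * (x $ i)))"
    by (simp add: wave_def inner_vec_def cis_conv_exp exp_cnj cnj_sum exp_sum[symmetric] sum_distrib_left
        sum_negf)
  show ?thesis
    unfolding w tensor_def window_def prod.distrib[symmetric]
    by (intro prod.cong) (auto simp: modulated_def)
qed

context
  fixes b :: "nat \<Rightarrow> real \<Rightarrow> complex" and B :: real and N :: nat
  assumes cut: "cutoff b B" and N: "N > 0"
begin

lemma modulated_smooth: "modulated b N c m \<in> smooth k"
proof -
  have "(\<lambda>t. b m (0 + (1 / real N) * t) * cis ((- c) * t)) \<in> smooth k"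
    using cut unfolding cutoff_def by (intro smooth_mult smooth_affine[of "b m"] smooth_cis) auto
  thus ?thesis by (simp add: modulated_def[abs_def])
qed

lemma modulated_zero: "\<bar>t\<bar> > real N \<Longrightarrow> modulated b N c m t = 0"
  using cut N by (simp add: cutoff_def modulated_def)

lemma modulated_derivative:
  assumes "m < 2"
  shows "(modulated b N c m has_vector_derivative modulated b N c (Suc m) t / of_nat N
      - \<i> * of_real c * modulated b N c m t) (at t)"
proof -
  have 1: "((\<lambda>t. t / real N) has_vector_derivative 1 / real N) (at t)"
    unfolding has_real_derivative_iff_has_vector_derivative[symmetric] using N
        by (auto intro!: derivative_eq_intros)
  have 2: "(b m has_vector_derivative b (Suc m) (t / real N)) (at (t / real N))"
    using cut assms by (auto simp: cutoff_def)
  from has_vector_derivative_mult[OF vector_diff_chain_at[OF 1 2] cis_has_vector_derivative[of "- c" t]]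
  show ?thesis
    by (simp add: modulated_def[abs_def] o_def scaleR_conv_of_real algebra_simps)
qed

abbreviation mode :: "real ^ 'n \<Rightarrow> 'n \<Rightarrow> nat \<Rightarrow> real ^ 'n \<Rightarrow> complex" where
  "mode k j m \<equiv> tensor ((\<lambda>i. modulated b N (k $ i) 0)(j := modulated b N (k $ j) m))"

lemma mode_test_function: "mode k j m \<in> test_functions"
  by (rule tensor_test_function[where R="real N"]) (auto simp: modulated_smooth modulated_zero)

lemma mode_0_eq: "mode k j 0 = tensor (\<lambda>i. modulated b N (k $ i) 0)"
  by (simp add: fun_upd_idem)

lemma partial_mode:
  fixes k :: "real ^ 'n"
  assumes "m < 2"
  shows "partial j (mode k j m) = (\<lambda>x. mode k j (Suc m) x / of_nat N - \<i> * of_real (k $ j) * mode k j m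
      x)"
proof -
  let ?D = "\<lambda>i m t. modulated b N (k $ i) (Suc m) t / of_nat N - \<i> * of_real (k $ i) * modulated b N
      (k $ i) m t"
  let ?g = "(\<lambda>i. modulated b N (k $ i) 0)(j := modulated b N (k $ j) m)"
  have "\<forall>i t. (?g i has_vector_derivative ((\<lambda>i. ?D i 0)(j := ?D j m)) i t) (at t)"
    using modulated_derivative[OF assms, of "k $ j"] modulated_derivative[of 0] by auto
  from partial_tensor[OF this, of j]
  have "partial j (mode k j m) = tensor ((\<lambda>i. modulated b N (k $ i) 0)(j := ?D j m))"
    by (simp only: fun_upd_same fun_upd_upd)
  thus ?thesis by (simp add: tensor_slot fun_eq_iff algebra_simps diff_divide_distrib)
qed

text \<open>The term \<open>2 * \<i> * k $ j\<close> times a first derivative of the cutoff, which would grow with the frequency,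
  is rewritten as a derivative of the test function \<open>mode k j 1\<close>. Integration against \<open>u\<close> then moves
  this derivative onto \<open>u\<close>, and no factor \<open>k $ j\<close> is left on the right.\<close>

lemma partial_partial_mode:
  fixes k :: "real ^ 'n"
  shows "partial j (mode k j 0) \<in> test_functions"
    "of_real ((k $ j)\<^sup>2) * mode k j 0 x =
       - partial j (partial j (mode k j 0)) x + 2 / of_nat N * partial j (mode k j 1) x
           - mode k j 2 x / (of_nat N)\<^sup>2"
proof -
  let ?D = "\<lambda>m t. modulated b N (k $ j) (Suc m) t / of_nat N - \<i> * of_real (k $ j) * modulated b N (k $ j)
      m t"
  let ?D2 = "\<lambda>t. ?D 1 t / of_nat N - \<i> * of_real (k $ j) * ?D 0 t"
  let ?E = "\<lambda>i t. modulated b N (k $ i) (Suc 0) t / of_nat N - \<i> * of_real (k $ i) * modulated b N (k $ i)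
      0 t"
  have eq: "partial j (mode k j 0) = tensor ((\<lambda>i. modulated b N (k $ i) 0)(j := ?D 0))"
    unfolding partial_mode[OF zero_less_numeral]
        by (simp add: tensor_slot fun_eq_iff algebra_simps diff_divide_distrib)
  show "partial j (mode k j 0) \<in> test_functions"
    unfolding eq
  proof (rule tensor_test_function[where R="real N"])
    have "(\<lambda>t. (1 / of_nat N) * modulated b N (k $ j) (Suc 0) t + (- \<i> * of_real (k $ j)) * modulated b N
        (k $ j) 0 t) \<in> smooth l" for l
      by (intro smooth_add smooth_mult smooth_const modulated_smooth)
    hence "?D 0 \<in> smooth l" for l by (simp add: algebra_simps)
    thus "((\<lambda>i. modulated b N (k $ i) 0)(j := ?D 0)) i \<in> smooth l" for i l
        by (auto simp: modulated_smooth)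
  qed (auto simp: modulated_zero)
  have "\<forall>i t. (((\<lambda>i. modulated b N (k $ i) 0)(j := ?D 0)) i has_vector_derivative (?E(j := ?D2)) i t)
      (at t)"
  proof (intro allI)
    fix i t
    show "(((\<lambda>i. modulated b N (k $ i) 0)(j := ?D 0)) i has_vector_derivative (?E(j := ?D2)) i t) (at t)"
    proof (cases "i = j")
      case True
      have "((\<lambda>t. modulated b N (k $ j) (Suc 0) t / of_nat N - \<i> * of_real (k $ j) * modulated b N (k $ j)
          0 t) has_vector_derivative ?D2 t) (at t)"
        using modulated_derivative[of 0 "k $ j" t] modulated_derivative[of 1 "k $ j" t]
        by (intro has_vector_derivative_diff has_vector_derivative_divide
            has_vector_derivative_mult_right) auto
      thus ?thesis using True by simp
    next
      case False
      thus ?thesis using modulated_derivative[of 0 "k $ i" t] by simp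
    qed
  qed
  from partial_tensor[OF this, of j]
  have eq2: "partial j (partial j (mode k j 0)) = tensor ((\<lambda>i. modulated b N (k $ i) 0)(j := ?D2))"
    unfolding eq by (simp only: fun_upd_same fun_upd_upd)
  have lt: "1 < (2::nat)" by simp
  show "of_real ((k $ j)\<^sup>2) * mode k j 0 x =
       - partial j (partial j (mode k j 0)) x + 2 / of_nat N * partial j (mode k j 1) x
           - mode k j 2 x / (of_nat N)\<^sup>2"
    unfolding eq2 partial_mode[OF lt] using N
    by (simp add: tensor_slot field_simps power2_eq_square numeral_2_eq_2)
qed

end

section \<open>From cells to the whole space\<close>

lemma test_function_l2:
  assumes "\<phi> \<in> test_functions"
  shows "\<phi> \<in> l2 lebesgue" "continuous_on UNIV \<phi>"
proof -
  let ?K = "closure {x. \<phi> x \<noteq> 0}"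
  have K: "compact ?K" using assms by (simp add: test_functions_def)
  show c: "continuous_on UNIV \<phi>" using assms unfolding test_functions_def by (auto dest!: spec[of _ 0])
  have "continuous_on ?K (\<lambda>x. (norm (\<phi> x))\<^sup>2)" by (intro continuous_intros continuous_on_subset[OF c])
      auto
  from borel_integrable_compact[OF K this]
  have "integrable lborel (\<lambda>x. indicator ?K x *\<^sub>R (norm (\<phi> x))\<^sup>2)" .
  also have "(\<lambda>x. indicator ?K x *\<^sub>R (norm (\<phi> x))\<^sup>2) = (\<lambda>x. (norm (\<phi> x))\<^sup>2)"
    using closure_subset[of "{x. \<phi> x \<noteq> 0}"] by (auto simp: indicator_def fun_eq_iff)
  finally have "integrable lborel (\<lambda>x. (norm (\<phi> x))\<^sup>2)" .
  moreover have m: "\<phi> \<in> borel_measurable borel" by (rule borel_measurable_continuous_onI[OF c])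
  ultimately have "integrable lebesgue (\<lambda>x. (norm (\<phi> x))\<^sup>2)" by (subst integrable_completion) auto
  moreover have "\<phi> \<in> borel_measurable lebesgue" using m by (simp add: measurable_completion)
  ultimately show "\<phi> \<in> l2 lebesgue" by (simp add: l2_def)
qed

lemma L2_eq_l2: "L2 = l2 lebesgue"
  by (simp add: L2_def l2_def)

lemma L1_loc_mult_test_integrable:
  assumes h: "h \<in> L1_loc" and \<phi>: "\<phi> \<in> test_functions"
  shows "integrable lebesgue (\<lambda>x. h x * \<phi> x)"
proof -
  let ?K = "closure {x. \<phi> x \<noteq> 0}"
  have K: "compact ?K" using \<phi> by (simp add: test_functions_def)
  have c: "continuous_on UNIV \<phi>" by (rule test_function_l2[OF \<phi>])
  have "bounded (\<phi> ` ?K)" by (intro compact_imp_bounded compact_continuous_image K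
      continuous_on_subset[OF c]) auto
  then obtain B where B: "\<And>x. x \<in> ?K \<Longrightarrow> norm (\<phi> x) \<le> B" unfolding bounded_iff by (metis imageI)
  have int: "integrable lebesgue (\<lambda>x. indicator ?K x *\<^sub>R h x)"
    using h K by (auto simp: L1_loc_def set_integrable_def)
  have eq: "(\<lambda>x. (indicator ?K x *\<^sub>R h x) * \<phi> x) = (\<lambda>x. h x * \<phi> x)"
    using closure_subset[of "{x. \<phi> x \<noteq> 0}"] by (auto simp: indicator_def fun_eq_iff)
  have "integrable lebesgue (\<lambda>x. (indicator ?K x *\<^sub>R h x) * \<phi> x)"
  proof (rule Bochner_Integration.integrable_bound)
    show "integrable lebesgue (\<lambda>x. B * norm (indicator ?K x *\<^sub>R h x))" using int
        by (intro integrable_mult_right integrable_norm)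
    show "(\<lambda>x. (indicator ?K x *\<^sub>R h x) * \<phi> x) \<in> borel_measurable lebesgue"
      using int l2D(1)[OF test_function_l2(1)[OF \<phi>]] by (intro borel_measurable_times) auto
    show "AE x in lebesgue. norm ((indicator ?K x *\<^sub>R h x) * \<phi> x)
        \<le> norm (B * norm (indicator ?K x *\<^sub>R h x))"
    proof (rule AE_I2)
      fix x
      show "norm ((indicator ?K x *\<^sub>R h x) * \<phi> x) \<le> norm (B * norm (indicator ?K x *\<^sub>R h x))"
      proof (cases "x \<in> ?K")
        case True
        have "norm (h x) * norm (\<phi> x) \<le> \<bar>B\<bar> * norm (h x)"
          using B[OF True] by (simp add: mult.commute mult_right_mono)
        thus ?thesis using True by (simp add: norm_mult abs_mult)
      qed simp
    qed
  qed
  thus ?thesis by (simp only: eq)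
qed

lemma cell_integral_eq:
  fixes f :: "real ^ 'n \<Rightarrow> 'b::{banach, second_countable_topology}"
  assumes "\<And>x. x \<notin> cell N \<Longrightarrow> f x = 0"
  shows "(LINT x|cell_measure N. f x) = (LINT x|lebesgue. f x)"
proof -
  have "(\<lambda>x. indicator (cell N) x *\<^sub>R f x) = f" using assms by (auto simp: indicator_def fun_eq_iff)
  thus ?thesis by (subst integral_restrict_space) auto
qed

lemma cell_l2I: "u \<in> l2 lebesgue \<Longrightarrow> u \<in> cell_l2 N"
  unfolding l2_def
  by (auto intro!: measurable_restrict_space1 integrable_mult_indicator simp: integrable_restrict_space
      simp del: real_scaleR_def)

lemma integral_weighted_square_tendsto:
  fixes f :: "nat \<Rightarrow> 'a \<Rightarrow> complex" and \<rho> :: "'a \<Rightarrow> real"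
  assumes f: "\<And>i. f i \<in> borel_measurable M" "F \<in> borel_measurable M" "\<And>x. (\<lambda>i. f i x) \<longlonglongrightarrow> F x"
    and h: "\<And>i x. norm (f i x) \<le> h x" "integrable M (\<lambda>x. (h x)\<^sup>2)"
    and \<rho>: "\<rho> \<in> borel_measurable M" "\<And>x. \<bar>\<rho> x\<bar> \<le> 1"
  shows "(\<lambda>i. LINT x|M. \<rho> x * (norm (f i x))\<^sup>2) \<longlonglongrightarrow> (LINT x|M. \<rho> x * (norm (F x))\<^sup>2)"
proof (rule integral_dominated_convergence[OF _ _ h(2)])
  show "AE x in M. (\<lambda>i. \<rho> x * (norm (f i x))\<^sup>2) \<longlonglongrightarrow> \<rho> x * (norm (F x))\<^sup>2"
    by (intro AE_I2 tendsto_intros f)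
  show "AE x in M. norm (\<rho> x * (norm (f i x))\<^sup>2) \<le> (h x)\<^sup>2" for i
  proof (rule AE_I2)
    fix x
    have "\<bar>\<rho> x\<bar> * (norm (f i x))\<^sup>2 \<le> 1 * (h x)\<^sup>2"
      by (intro mult_mono \<rho> power_mono h) auto
    thus "norm (\<rho> x * (norm (f i x))\<^sup>2) \<le> (h x)\<^sup>2" by (simp add: abs_mult)
  qed
qed (use f(1,2) \<rho>(1) in auto)

text \<open>The two integral identities are all that is used of the weak derivatives. Testing them avoids
  comparing different representatives of the first derivatives of \<open>u\<close>.\<close>

locale weak_laplacian =
  fixes u v :: "real ^ 'n \<Rightarrow> complex" and g :: "'n \<Rightarrow> real ^ 'n \<Rightarrow> complex"
  assumes u: "u \<in> l2 lebesgue" and v: "v \<in> l2 lebesgue" and g: "\<And>j. g j \<in> l2 lebesgue"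
    and gradient: "\<And>\<phi> j. \<phi> \<in> test_functions \<Longrightarrow> (LINT x|lebesgue. u x * partial j \<phi> x)
        = - (LINT x|lebesgue. g j x * \<phi> x)"
    and laplacian: "\<And>\<phi>. \<phi> \<in> test_functions \<Longrightarrow> (\<And>j. partial j \<phi> \<in> test_functions) \<Longrightarrow>
       (LINT x|lebesgue. v x * \<phi> x) = - (\<Sum>j\<in>UNIV. LINT x|lebesgue. u x * partial j (partial j \<phi>) x)"

text \<open>The gradient \<open>g\<close> comes from membership in the Sobolev space and is square integrable; the one
  provided by \<open>is_laplacian\<close> is only locally integrable, and enters through its pairings with test
  functions alone.\<close>

lemma weak_laplacian_sobolev:
  assumes u: "u \<in> sobolev 2" and lap: "is_laplacian u v'" and v: "v \<in> L2" and eq: "AE x in lebesgue. v' x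
      = v x"
  shows "\<exists>g. weak_laplacian u v g"
proof -
  have "u \<in> L2" and "\<forall>j. \<exists>g\<in>L2. weak_partial j u g"
    using u by (auto simp: numeral_2_eq_2)
  then obtain g where g: "\<And>j. g j \<in> L2" "\<And>j. weak_partial j u (g j)" by metis
  obtain g' h where h: "\<And>j. weak_partial j u (g' j)" "\<And>j. weak_partial j (g' j) (h j)"
    "AE x in lebesgue. v' x = - (\<Sum>j\<in>UNIV. h j x)" using lap unfolding is_laplacian_def by blast
  have "weak_laplacian u v g"
  proof
    show "u \<in> l2 lebesgue" "v \<in> l2 lebesgue" "g j \<in> l2 lebesgue" for j
      using \<open>u \<in> L2\<close> v g by (simp_all add: L2_eq_l2)
    show "(LINT x|lebesgue. u x * partial j \<phi> x) = - (LINT x|lebesgue. g j x * \<phi> x)"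
        if "\<phi> \<in> test_functions" for \<phi> j
      using g(2)[of j] that by (simp add: weak_partial_def)
    fix \<phi> :: "real ^ 'a \<Rightarrow> complex"
    assume \<phi>: "\<phi> \<in> test_functions" "\<And>j. partial j \<phi> \<in> test_functions"
    have int: "integrable lebesgue (\<lambda>x. h j x * \<phi> x)" for j
      using h(2)[of j] by (intro L1_loc_mult_test_integrable \<phi>) (simp add: weak_partial_def)
    have "(LINT x|lebesgue. h j x * \<phi> x) = (LINT x|lebesgue. u x * partial j (partial j \<phi>) x)" for j
      using h(1,2)[of j] \<phi> by (simp add: weak_partial_def)
    moreover have "(LINT x|lebesgue. v x * \<phi> x) = (LINT x|lebesgue. - (\<Sum>j\<in>UNIV. h j x * \<phi> x))"
    proof (rule integral_cong_AE)
      show "(\<lambda>x. v x * \<phi> x) \<in> borel_measurable lebesgue"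
        using v l2D(1)[OF test_function_l2(1)[OF \<phi>(1)]] by (auto simp: L2_def)
      show "(\<lambda>x. - (\<Sum>j\<in>UNIV. h j x * \<phi> x)) \<in> borel_measurable lebesgue" using int by auto
      show "AE x in lebesgue. v x * \<phi> x = - (\<Sum>j\<in>UNIV. h j x * \<phi> x)"
        using h(3) eq by eventually_elim (simp add: sum_distrib_right)
    qed
    ultimately show "(LINT x|lebesgue. v x * \<phi> x)
        = - (\<Sum>j\<in>UNIV. LINT x|lebesgue. u x * partial j (partial j \<phi>) x)"
      using int by simp
  qed
  thus ?thesis by blast
qed

locale truncated_laplacian = weak_laplacian u v g
  for u v :: "real ^ 'n \<Rightarrow> complex" and g +
  fixes b :: "nat \<Rightarrow> real \<Rightarrow> complex" and B :: real
  assumes cut: "cutoff b B" and B: "B \<ge> 1"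
begin

text \<open>For \<open>m = 0\<close> the window is the plain cutoff, whatever its index, so an arbitrary index is used.\<close>

definition truncated :: "nat \<Rightarrow> real ^ 'n \<Rightarrow> complex" where
  "truncated N x = window b N undefined 0 x * u x"

text \<open>The nonnegative Laplacian of \<open>truncated N\<close>, in which the derivatives of \<open>u\<close> are represented by \<open>v\<close> and \<open>g\<close>.\<close>

definition truncated_laplace :: "nat \<Rightarrow> real ^ 'n \<Rightarrow> complex" where
  "truncated_laplace N x = window b N undefined 0 x * v x - 2 / of_nat N * (\<Sum>j\<in>UNIV. window b N j 1 x * g
      j x)
     - 1 / (of_nat N)\<^sup>2 * (\<Sum>j\<in>UNIV. window b N j 2 x * u x)"

lemma window_0: "window b N j 0 = window b N i 0"
  unfolding window_def by (rule ext) (simp add: fun_upd_idem)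

lemma window_test_function:
  assumes "N > 0"
  shows "window b N j m \<in> test_functions"
proof -
  have eq: "window b N j m = mode b N 0 j m" by (rule ext) (use tensor_modulated[of b N 0 j m] in simp)
  show ?thesis unfolding eq by (rule mode_test_function[OF cut assms])
qed

lemma window_bound:
  fixes x :: "real ^ 'n"
  assumes "m \<le> 2"
  shows "norm (window b N j m x) \<le> B ^ CARD('n)"
proof -
  have "norm (window b N j m x) \<le> (\<Prod>i\<in>(UNIV :: 'n set). B)"
    unfolding window_def tensor_def prod_norm[symmetric]
    using cut assms by (intro prod_mono) (auto simp: cutoff_def)
  thus ?thesis by simp
qed

lemma window_zero:
  assumes N: "N > 0" and x: "x \<notin> cell N"
  shows "window b N j m x = 0"
proof -
  have "\<not> (\<forall>i. \<bar>x $ i\<bar> \<le> pi * real N)" using x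
      by (auto simp: cell_def mem_box_cart abs_le_iff minus_le_iff)
  then obtain i where i: "\<bar>x $ i\<bar> > pi * real N" by (auto simp: not_le)
  have "1 * real N < pi * real N" using pi_gt3 N by (intro mult_strict_right_mono) auto
  hence "real N < \<bar>x $ i\<bar>" using i by linarith
  hence "\<bar>x $ i / real N\<bar> > 1" using N by (simp add: field_simps)
  hence "((\<lambda>i t. b 0 (t / real N))(j := (\<lambda>t. b m (t / real N)))) i (x $ i) = 0"
    using cut by (auto simp: cutoff_def)
  thus ?thesis unfolding window_def tensor_def by (rule prod_zero[OF finite bexI[OF _ UNIV_I]])
qed

lemma window_tendsto: "(\<lambda>i. window b (Suc i) j m x) \<longlonglongrightarrow> b m 0"
proof -
  have c: "continuous_on UNIV (b m)" for m
  proof -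
    have "b m \<in> smooth 0" using cut unfolding cutoff_def by blast
    thus ?thesis by simp
  qed
  have t: "(\<lambda>i. t / real (Suc i)) \<longlonglongrightarrow> 0" for t :: real
    using tendsto_mult[OF tendsto_const[of t] LIMSEQ_inverse_real_of_nat] by (simp add: divide_inverse)
  have l: "(\<lambda>i. b m (t / real (Suc i))) \<longlonglongrightarrow> b m 0" for m t
    using continuous_on_tendsto_compose[OF c t] by simp
  have "(\<lambda>i. b m (x $ j / real (Suc i)) * (\<Prod>l\<in>UNIV - {j}. b 0 (x $ l / real (Suc i)))) \<longlonglongrightarrow> b m 0 * (\<Prod>l\<in>UNIV
      - {j}. b 0 0)"
    by (intro tendsto_mult tendsto_prod l)
  thus ?thesis using cut by (simp add: window_def tensor_slot cutoff_def)
qed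

lemma window_mult_l2:
  fixes w :: "real ^ 'n \<Rightarrow> complex"
  assumes "N > 0" "m \<le> 2" "w \<in> l2 lebesgue"
  shows "(\<lambda>x. window b N j m x * w x) \<in> l2 lebesgue"
proof (rule l2_mult_bounded[OF assms(3)])
  show "window b N j m \<in> borel_measurable lebesgue"
    by (intro l2D(1) test_function_l2(1) window_test_function assms)
  show "norm (window b N j m x) \<le> B ^ CARD('n)" for x by (rule window_bound[OF assms(2)])
qed

lemma truncated_l2: "N > 0 \<Longrightarrow> truncated N \<in> l2 lebesgue"
  unfolding truncated_def[abs_def] by (intro window_mult_l2 u) auto

lemma truncated_laplace_l2: "N > 0 \<Longrightarrow> truncated_laplace N \<in> l2 lebesgue"
  unfolding truncated_laplace_def[abs_def] by (intro window_mult_l2 l2_diff l2_cmult l2_sum u v g) auto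

lemma truncated_zero: "N > 0 \<Longrightarrow> x \<notin> cell N \<Longrightarrow> truncated N x = 0"
  by (simp add: truncated_def window_zero)

lemma truncated_laplace_zero: "N > 0 \<Longrightarrow> x \<notin> cell N \<Longrightarrow> truncated_laplace N x = 0"
  by (simp add: truncated_laplace_def window_zero)

text \<open>The test functions are the cutoff times the conjugate waves. Multiplying the identity of
  \<open>partial_partial_mode\<close> by \<open>u\<close>, integrating, and summing over \<open>j\<close> yields the claim by the defining
  identities of \<open>v\<close> and \<open>g\<close>.\<close>

lemma fourier_truncated_laplace:
  assumes N: "N > 0"
  shows "fourier N (truncated_laplace N) k = of_real ((norm k)\<^sup>2) * fourier N (truncated N) k"
proof -
  let ?I = "\<lambda>f. LINT x|lebesgue. f x :: complex"
  let ?m = "\<lambda>j m. mode b N k j m"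
  note mode = tensor_modulated[of b N k]
  have test: "?m j m \<in> test_functions" for j m by (rule mode_test_function[OF cut N])
  have int: "integrable lebesgue (\<lambda>x. w x * ?m j m x)" if "w \<in> l2 lebesgue" for w j m
    by (intro l2_mult_integrable that test_function_l2 test)
  have m0: "?m j 0 = ?m i 0" for i j by (simp add: mode_0_eq[OF cut N])
  have "?I (\<lambda>x. truncated_laplace N x * cnj (wave k x)) =
     ?I (\<lambda>x. v x * ?m undefined 0 x - 2 / of_nat N * (\<Sum>j\<in>UNIV. g j x * ?m j 1 x) - 1 / (of_nat N)\<^sup>2 *
         (\<Sum>j\<in>UNIV. u x * ?m j 2 x))"
  proof (intro Bochner_Integration.integral_cong refl)
    fix x
    have "(\<Sum>j\<in>UNIV. g j x * ?m j 1 x) = (\<Sum>j\<in>UNIV. window b N j 1 x * g j x) * cnj (wave k x)"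
      "(\<Sum>j\<in>UNIV. u x * ?m j 2 x) = (\<Sum>j\<in>UNIV. window b N j 2 x * u x) * cnj (wave k x)"
      by (simp_all only: mode sum_distrib_left mult_ac)
    thus "truncated_laplace N x * cnj (wave k x) = v x * ?m undefined 0 x
        - 2 / of_nat N * (\<Sum>j\<in>UNIV. g j x * ?m j 1 x) - 1 / (of_nat N)\<^sup>2 * (\<Sum>j\<in>UNIV. u x * ?m j 2 x)"
      unfolding truncated_laplace_def by (simp only: mode) (simp only: left_diff_distrib
          right_diff_distrib mult_ac)
  qed
  also have "\<dots> = ?I (\<lambda>x. v x * ?m undefined 0 x) - 2 / of_nat N * (\<Sum>j\<in>UNIV. ?I (\<lambda>x. g j x * ?m j 1 x))
      - 1 / (of_nat N)\<^sup>2 * (\<Sum>j\<in>UNIV. ?I (\<lambda>x. u x * ?m j 2 x))"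
    by (simp add: Bochner_Integration.integral_diff Bochner_Integration.integral_sum int u v g
        Bochner_Integration.integrable_diff Bochner_Integration.integrable_sum integrable_mult_right del:
            integrable_mult_right_iff)
  also have "?I (\<lambda>x. v x * ?m undefined 0 x)
      = (\<Sum>j\<in>UNIV. - ?I (\<lambda>x. u x * partial j (partial j (?m j 0)) x))"
  proof -
    have "partial j (?m undefined 0) \<in> test_functions" for j
      using partial_partial_mode(1)[OF cut N, of j k] by (simp only: m0[of j undefined])
    from laplacian[OF test this]
    have "?I (\<lambda>x. v x * ?m undefined 0 x)
        = - (\<Sum>j\<in>UNIV. ?I (\<lambda>x. u x * partial j (partial j (?m undefined 0)) x))" .
    also have "\<dots> = (\<Sum>j\<in>UNIV. - ?I (\<lambda>x. u x * partial j (partial j (?m j 0)) x))"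
      unfolding sum_negf[symmetric]
    proof (rule sum.cong[OF refl])
      fix j
      show "- ?I (\<lambda>x. u x * partial j (partial j (?m undefined 0)) x)
          = - ?I (\<lambda>x. u x * partial j (partial j (?m j 0)) x)"
        by (subst m0[of j undefined]) (rule refl)
    qed
    finally show ?thesis .
  qed
  also have "(\<Sum>j\<in>UNIV. - ?I (\<lambda>x. u x * partial j (partial j (?m j 0)) x))
      - 2 / of_nat N * (\<Sum>j\<in>UNIV. ?I (\<lambda>x. g j x * ?m j 1 x)) - 1 / (of_nat N)\<^sup>2 *
          (\<Sum>j\<in>UNIV. ?I (\<lambda>x. u x * ?m j 2 x))
     = (\<Sum>j\<in>UNIV. of_real ((k $ j)\<^sup>2) * ?I (\<lambda>x. u x * ?m j 0 x))"
    unfolding sum_distrib_left sum_subtractf[symmetric]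
  proof (rule sum.cong[OF refl])
    fix j
    have grad: "?I (\<lambda>x. u x * partial j (?m j 1) x) = - ?I (\<lambda>x. g j x * ?m j 1 x)"
      by (rule gradient[OF test])
    have i1: "integrable lebesgue (\<lambda>x. u x * partial j (?m j 1) x)"
    proof -
      have "(\<lambda>x. u x * partial j (?m j 1) x) = (\<lambda>x. (1 / of_nat N) * (u x * ?m j 2 x)
          - (\<i> * of_real (k $ j)) * (u x * ?m j 1 x))"
        by (rule ext, subst partial_mode[OF cut N]) (simp_all add: algebra_simps numeral_2_eq_2)
      thus ?thesis by (simp only:) (intro Bochner_Integration.integrable_diff integrable_mult_right int u)
    qed
    let ?R = "\<lambda>x. 2 / of_nat N * (u x * partial j (?m j 1) x) - 1 / (of_nat N)\<^sup>2 * (u x * ?m j 2 x)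
        - of_real ((k $ j)\<^sup>2) * (u x * ?m j 0 x)"
    have e: "u x * partial j (partial j (?m j 0)) x = ?R x" for x
    proof -
      have "partial j (partial j (?m j 0)) x = 2 / of_nat N * partial j (?m j 1) x
          - ?m j 2 x / (of_nat N)\<^sup>2 - of_real ((k $ j)\<^sup>2) * ?m j 0 x"
        using partial_partial_mode(2)[OF cut N, of k j x] by (simp only:) simp
      thus ?thesis by (simp only:) (simp add: algebra_simps)
    qed
    have "?I (\<lambda>x. u x * partial j (partial j (?m j 0)) x) = ?I ?R" by (simp only: e)
    also have "\<dots> = 2 / of_nat N * ?I (\<lambda>x. u x * partial j (?m j 1) x) - 1 / (of_nat N)\<^sup>2 * ?I
        (\<lambda>x. u x * ?m j 2 x) - of_real ((k $ j)\<^sup>2) * ?I (\<lambda>x. u x * ?m j 0 x)"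
      using i1 int[OF u, of j 2] int[OF u, of j 0]
      by (simp only: Bochner_Integration.integral_diff Bochner_Integration.integrable_diff
          integrable_mult_right integral_mult_right_zero)
    finally show "- ?I (\<lambda>x. u x * partial j (partial j (?m j 0)) x) - 2 / of_nat N * ?I
        (\<lambda>x. g j x * ?m j 1 x) - 1 / (of_nat N)\<^sup>2 * ?I (\<lambda>x. u x * ?m j 2 x)
      = of_real ((k $ j)\<^sup>2) * ?I (\<lambda>x. u x * ?m j 0 x)" by (simp only: grad) simp
  qed
  also have "\<dots> = (\<Sum>j\<in>UNIV. of_real ((k $ j)\<^sup>2) * ?I (\<lambda>x. truncated N x * cnj (wave k x)))"
  proof -
    have "u x * ?m j 0 x = truncated N x * cnj (wave k x)" for j x
      by (simp add: truncated_def mode window_0[of N j undefined])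
    thus ?thesis by (simp only:)
  qed
  also have "\<dots> = of_real ((norm k)\<^sup>2) * ?I (\<lambda>x. truncated N x * cnj (wave k x))"
    by (simp add: sum_distrib_right norm_vec_def L2_set_def sum_nonneg)
  finally have main: "?I (\<lambda>x. truncated_laplace N x * cnj (wave k x))
      = of_real ((norm k)\<^sup>2) * ?I (\<lambda>x. truncated N x * cnj (wave k x))" .
  have "(LINT x|cell_measure N. truncated_laplace N x * cnj (wave k x))
      = ?I (\<lambda>x. truncated_laplace N x * cnj (wave k x))"
    "(LINT x|cell_measure N. truncated N x * cnj (wave k x)) = ?I (\<lambda>x. truncated N x * cnj (wave k x))"
    by (rule cell_integral_eq, simp add: truncated_zero truncated_laplace_zero N)+
  thus ?thesis unfolding fourier_def mean_def by (simp only: main mult_scaleR_right)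
qed

definition majorant :: "real ^ 'n \<Rightarrow> real" where
  "majorant x = B ^ CARD('n) * (norm (v x) + 2 * (\<Sum>j\<in>UNIV. norm (g j x)) + (1 + real CARD('n)) * norm
      (u x))"

lemma l2_norm: "w \<in> l2 M \<Longrightarrow> (\<lambda>x. complex_of_real (norm (w x))) \<in> l2 M"
  by (auto simp: l2_def)

lemma majorant_l2: "(\<lambda>x. complex_of_real (majorant x)) \<in> l2 lebesgue"
proof -
  have "(\<lambda>x. of_real (B ^ CARD('n)) * ((complex_of_real (norm (v x))
      + 2 * (\<Sum>j\<in>UNIV. complex_of_real (norm (g j x)))) + of_real (1 + real CARD('n)) * complex_of_real
          (norm (u x)))) \<in> l2 lebesgue"
    by (intro l2_cmult l2_add l2_sum l2_norm u v g)
  thus ?thesis by (simp add: majorant_def)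
qed

lemma truncated_le: "norm (truncated N x) \<le> majorant x"
proof -
  have "norm (truncated N x) \<le> B ^ CARD('n) * norm (u x)"
    unfolding truncated_def norm_mult by (intro mult_right_mono window_bound) auto
  also have "\<dots> \<le> majorant x"
    unfolding majorant_def using B by (intro mult_left_mono) (auto simp: distrib_right intro!: sum_nonneg
        add_nonneg_nonneg)
  finally show ?thesis .
qed

lemma truncated_laplace_le:
  assumes N: "N > 0"
  shows "norm (truncated_laplace N x) \<le> majorant x"
proof -
  let ?B = "B ^ CARD('n)"
  have w: "norm (window b N j m x * w) \<le> ?B * norm w" if "m \<le> 2" for j m w
    unfolding norm_mult by (intro mult_right_mono window_bound that) auto
  have "norm (\<Sum>j\<in>UNIV. window b N j 1 x * g j x) \<le> (\<Sum>j\<in>UNIV. ?B * norm (g j x))"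
    by (rule sum_norm_le) (intro w, simp)
  moreover have "norm (2 / of_nat N :: complex) \<le> 2" using N by (simp add: norm_divide field_simps)
  ultimately have 1: "norm (2 / of_nat N * (\<Sum>j\<in>UNIV. window b N j 1 x * g j x))
      \<le> 2 * (\<Sum>j\<in>UNIV. ?B * norm (g j x))"
    unfolding norm_mult[of "2 / of_nat N"] by (intro mult_mono) auto
  have "norm (\<Sum>j\<in>(UNIV :: 'n set). window b N j 2 x * u x) \<le> (\<Sum>j\<in>(UNIV :: 'n set). ?B * norm (u x))"
    by (rule sum_norm_le) (intro w, simp)
  moreover have "norm (1 / (of_nat N)\<^sup>2 :: complex) \<le> 1" using N
      by (simp add: norm_divide norm_power field_simps)
  ultimately have 2: "norm (1 / (of_nat N)\<^sup>2 * (\<Sum>j\<in>(UNIV :: 'n set). window b N j 2 x * u x))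
      \<le> 1 * (\<Sum>j\<in>(UNIV :: 'n set). ?B * norm (u x))"
    unfolding norm_mult[of "1 / (of_nat N)\<^sup>2"] by (intro mult_mono) auto
  have 3: "norm (window b N undefined 0 x * v x) \<le> ?B * norm (v x)" by (intro w) simp
  have "norm (truncated_laplace N x) \<le> ?B * norm (v x) + 2 * (\<Sum>j\<in>UNIV. ?B * norm (g j x))
      + 1 * (\<Sum>j\<in>(UNIV :: 'n set). ?B * norm (u x))"
    unfolding truncated_laplace_def
    by (intro order_trans[OF norm_triangle_ineq4] add_mono 1 2 3)
  also have "\<dots> \<le> majorant x"
    using B by (simp add: majorant_def distrib_left distrib_right sum_distrib_left mult_ac)
  finally show ?thesis .
qed

lemma truncated_tendsto: "(\<lambda>i. truncated (Suc i) x) \<longlonglongrightarrow> u x"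
  using tendsto_mult[OF window_tendsto[of undefined 0 x] tendsto_const[of "u x"]] cut
      by (simp add: truncated_def cutoff_def)

lemma truncated_laplace_tendsto: "(\<lambda>i. truncated_laplace (Suc i) x) \<longlonglongrightarrow> v x"
proof -
  have 1: "(\<lambda>i. 1 / of_nat (Suc i) :: complex) \<longlonglongrightarrow> 0"
    using LIMSEQ_Suc[OF lim_inverse_n[where 'a=complex]] by (simp add: divide_inverse)
  have "(\<lambda>i. window b (Suc i) undefined 0 x * v x - (2 * (1 / of_nat (Suc i))) *
      (\<Sum>j\<in>UNIV. window b (Suc i) j 1 x * g j x)
     - (1 / of_nat (Suc i))\<^sup>2 * (\<Sum>j\<in>UNIV. window b (Suc i) j 2 x * u x))
     \<longlonglongrightarrow> b 0 0 * v x - (2 * 0) * (\<Sum>j\<in>UNIV. b 1 0 * g j x) - 0\<^sup>2 * (\<Sum>j\<in>(UNIV :: 'n set). b 2 0 * u x)"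
    by (intro tendsto_intros window_tendsto 1)
  thus ?thesis using cut by (simp add: truncated_laplace_def cutoff_def power_divide)
qed

text \<open>In terms of derivatives, the integral is that of \<open>|\<nabla>u|\<^sup>2\<close>. It is obtained as the limit of the
  corresponding integrals over cells.\<close>

lemma integral_mult_cnj_laplacian:
  "Im (LINT x|lebesgue. v x * cnj (u x)) = 0" "Re (LINT x|lebesgue. v x * cnj (u x)) \<ge> 0"
proof -
  let ?J = "\<lambda>i. LINT x|lebesgue. truncated_laplace (Suc i) x * cnj (truncated (Suc i) x)"
  have lim: "?J \<longlonglongrightarrow> (LINT x|lebesgue. v x * cnj (u x))"
  proof (rule integral_dominated_convergence)
    show "(\<lambda>x. v x * cnj (u x)) \<in> borel_measurable lebesgue"
      by (rule borel_measurable_integrable[OF l2_mult_integrable[OF v l2_cnj[OF u]]])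
    show "(\<lambda>x. truncated_laplace (Suc i) x * cnj (truncated (Suc i) x)) \<in> borel_measurable lebesgue" for i
      by (rule borel_measurable_integrable[OF l2_mult_integrable[OF truncated_laplace_l2
          l2_cnj[OF truncated_l2]]]) auto
    show "integrable lebesgue (\<lambda>x. (majorant x)\<^sup>2)" using l2D(2)[OF majorant_l2] by simp
    show "AE x in lebesgue. (\<lambda>i. truncated_laplace (Suc i) x * cnj (truncated (Suc i) x)) \<longlonglongrightarrow> v x * cnj
        (u x)"
      by (intro AE_I2 tendsto_intros truncated_tendsto truncated_laplace_tendsto)
    show "AE x in lebesgue. norm (truncated_laplace (Suc i) x * cnj (truncated (Suc i) x))
        \<le> (majorant x)\<^sup>2" for i
    proof (rule AE_I2)
      fix x
      have "norm (truncated_laplace (Suc i) x * cnj (truncated (Suc i) x)) \<le> majorant x * majorant x"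
        unfolding norm_mult complex_mod_cnj
        by (intro mult_mono truncated_laplace_le truncated_le order_trans[OF norm_ge_zero truncated_le[of
            "Suc i"]]) auto
      thus "norm (truncated_laplace (Suc i) x * cnj (truncated (Suc i) x)) \<le> (majorant x)\<^sup>2"
          by (simp add: power2_eq_square)
    qed
  qed
  have J: "Im (?J i) = 0 \<and> Re (?J i) \<ge> 0" for i
  proof -
    have N: "Suc i > 0" by simp
    have eq: "?J i = cell_volume (Suc i) TYPE('n) *\<^sub>R mean (Suc i) (\<lambda>x. truncated_laplace (Suc i) x * cnj
        (truncated (Suc i) x))"
      unfolding mean_def using cell_volume_pos[OF N, where ?'n='n]
      by (subst cell_integral_eq) (auto simp: truncated_zero)
    show ?thesis unfolding eq
      using mean_mult_cnj_laplacian[OF N cell_l2I[OF truncated_l2[OF N]]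
          cell_l2I[OF truncated_laplace_l2[OF N]] fourier_truncated_laplace[OF N]]
        cell_volume_pos[OF N, where ?'n='n] by (simp add: less_imp_le)
  qed
  show "Im (LINT x|lebesgue. v x * cnj (u x)) = 0"
    using LIMSEQ_unique[OF tendsto_Im[OF lim]] J by simp
  show "Re (LINT x|lebesgue. v x * cnj (u x)) \<ge> 0"
    using LIMSEQ_le_const[OF tendsto_Re[OF lim]] J by auto
qed

text \<open>The terms of \<open>truncated_laplace\<close> with derivatives of the cutoff carry factors \<open>1 / N\<close> and vanish in
  the limit, by dominated convergence with \<open>majorant\<close>.\<close>

lemma whole_space_estimate:
  assumes cell: "\<And>N \<mu> w G. N > 0 \<Longrightarrow> w \<in> cell_l2 N \<Longrightarrow> G \<in> cell_l2 N \<Longrightarrow>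
     (\<forall>k\<in>lattice N. fourier N G k = (of_real ((norm k)\<^sup>2) - of_real \<mu>) * fourier N w k) \<Longrightarrow>
     msq N w \<le> C * (msq N G + mean N (\<lambda>x. \<psi> x * (norm (w x))\<^sup>2))"
   and \<psi>: "continuous_on UNIV \<psi>" "\<And>x. 0 \<le> \<psi> x" "\<And>x. \<psi> x \<le> 1"
  shows "(LINT x|lebesgue. (norm (u x))\<^sup>2) \<le>
     C * ((LINT x|lebesgue. (norm (v x - of_real \<mu> * u x))\<^sup>2) + (LINT x|lebesgue. \<psi> x * (norm (u x))\<^sup>2))"
proof -
  let ?W = "\<lambda>i. truncated (Suc i)"
  let ?G = "\<lambda>i x. truncated_laplace (Suc i) x - of_real \<mu> * truncated (Suc i) x"
  have W: "?W i \<in> l2 lebesgue" for i by (rule truncated_l2) simp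
  have F: "truncated_laplace (Suc i) \<in> l2 lebesgue" for i by (rule truncated_laplace_l2) simp
  have G: "?G i \<in> l2 lebesgue" for i by (intro l2_diff l2_cmult W F)
  have mm: "integrable lebesgue (\<lambda>x. (c * majorant x)\<^sup>2)" for c
    using l2D(2)[OF l2_cmult[OF majorant_l2, of "of_real c"]] by (simp add: norm_mult power_mult_distrib)
  have psi: "\<psi> \<in> borel_measurable lebesgue"
    using borel_measurable_continuous_onI[OF \<psi>(1)] by (simp add: measurable_completion)
  have limW: "(\<lambda>i. LINT x|lebesgue. \<rho> x * (norm (?W i x))\<^sup>2) \<longlonglongrightarrow> (LINT x|lebesgue. \<rho> x * (norm (u x))\<^sup>2)"
    if "\<rho> \<in> borel_measurable lebesgue" "\<And>x. \<bar>\<rho> x\<bar> \<le> 1" for \<rho> :: "real ^ 'n \<Rightarrow> real"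
    by (rule integral_weighted_square_tendsto[OF l2D(1)[OF W] l2D(1)[OF u] truncated_tendsto _ mm[of 1]
        that])
       (simp add: truncated_le)
  have limG: "(\<lambda>i. LINT x|lebesgue. 1 * (norm (?G i x))\<^sup>2) \<longlonglongrightarrow>
      (LINT x|lebesgue. 1 * (norm (v x - of_real \<mu> * u x))\<^sup>2)"
  proof (rule integral_weighted_square_tendsto[OF l2D(1)[OF G] l2D(1)[OF l2_diff[OF v l2_cmult[OF u]]] _ _
      mm[of "1 + \<bar>\<mu>\<bar>"]])
    show "(\<lambda>i. ?G i x) \<longlonglongrightarrow> v x - of_real \<mu> * u x" for x
      by (intro tendsto_intros truncated_tendsto truncated_laplace_tendsto)
    show "norm (?G i x) \<le> (1 + \<bar>\<mu>\<bar>) * majorant x" for i x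
    proof -
      have "norm (?G i x) \<le> norm (truncated_laplace (Suc i) x) + norm (of_real \<mu> * truncated (Suc i) x)"
          by (rule norm_triangle_ineq4)
      also have "\<dots> \<le> majorant x + \<bar>\<mu>\<bar> * majorant x"
        unfolding norm_mult norm_of_real
            by (intro add_mono mult_left_mono truncated_laplace_le truncated_le) auto
      finally show ?thesis by (simp add: distrib_right)
    qed
  qed auto
  have ineq: "(LINT x|lebesgue. 1 * (norm (?W i x))\<^sup>2) \<le>
     C * ((LINT x|lebesgue. 1 * (norm (?G i x))\<^sup>2) + (LINT x|lebesgue. \<psi> x * (norm (?W i x))\<^sup>2))" for i
  proof -
    let ?N = "Suc i"
    let ?V = "cell_volume ?N TYPE('n)"
    have N: "?N > 0" by simp
    have V: "?V > 0" by (rule cell_volume_pos[OF N])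
    have "fourier ?N (?G i) k = (of_real ((norm k)\<^sup>2) - of_real \<mu>) * fourier ?N (?W i) k" for k
    proof -
      have wave: "(\<lambda>x. cnj (wave k x)) \<in> cell_l2 ?N"
        by (intro l2_cnj continuous_cell_l2 continuous_intros)
      have i: "integrable (cell_measure ?N) (\<lambda>x. truncated_laplace ?N x * cnj (wave k x))"
        "integrable (cell_measure ?N) (\<lambda>x. of_real \<mu> * (truncated ?N x * cnj (wave k x)))"
        by (intro integrable_mult_right l2_mult_integrable wave cell_l2I W F)+
      have "fourier ?N (?G i) k = mean ?N (\<lambda>x. truncated_laplace ?N x * cnj (wave k x)
          - of_real \<mu> * (truncated ?N x * cnj (wave k x)))"
        unfolding fourier_def by (rule mean_cong) (simp add: algebra_simps)
      also have "\<dots> = fourier ?N (truncated_laplace ?N) k - of_real \<mu> * fourier ?N (truncated ?N) k"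
        using mean_diff_integrable[OF i] by (simp add: fourier_def mean_cmult)
      finally show ?thesis by (simp add: fourier_truncated_laplace left_diff_distrib)
    qed
    hence "msq ?N (?W i) \<le> C * (msq ?N (?G i) + mean ?N (\<lambda>x. \<psi> x * (norm (?W i x))\<^sup>2))"
      by (intro cell[OF N cell_l2I[OF W] cell_l2I[OF G]]) auto
    moreover have "msq ?N (?W i) = (LINT x|lebesgue. 1 * (norm (?W i x))\<^sup>2) / ?V"
      "msq ?N (?G i) = (LINT x|lebesgue. 1 * (norm (?G i x))\<^sup>2) / ?V"
      "mean ?N (\<lambda>x. \<psi> x * (norm (?W i x))\<^sup>2) = (LINT x|lebesgue. \<psi> x * (norm (?W i x))\<^sup>2) / ?V"
      unfolding msq_def mean_def
      by (subst cell_integral_eq; simp add: truncated_zero truncated_laplace_zero divide_inverse)+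
    ultimately have "(LINT x|lebesgue. 1 * (norm (?W i x))\<^sup>2) / ?V \<le>
       C * ((LINT x|lebesgue. 1 * (norm (?G i x))\<^sup>2) + (LINT x|lebesgue. \<psi> x * (norm (?W i x))\<^sup>2)) / ?V"
      by (simp only: add_divide_distrib[symmetric] times_divide_eq_right)
    thus ?thesis using V by (simp only: divide_le_cancel)
  qed
  have "(LINT x|lebesgue. 1 * (norm (u x))\<^sup>2) \<le>
     C * ((LINT x|lebesgue. 1 * (norm (v x - of_real \<mu> * u x))\<^sup>2)
         + (LINT x|lebesgue. \<psi> x * (norm (u x))\<^sup>2))"
  proof (rule LIMSEQ_le)
    show "(\<lambda>i. LINT x|lebesgue. 1 * (norm (?W i x))\<^sup>2) \<longlonglongrightarrow> (LINT x|lebesgue. 1 * (norm (u x))\<^sup>2)"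
        by (rule limW) auto
    show "(\<lambda>i. C * ((LINT x|lebesgue. 1 * (norm (?G i x))\<^sup>2)
        + (LINT x|lebesgue. \<psi> x * (norm (?W i x))\<^sup>2))) \<longlonglongrightarrow>
      C * ((LINT x|lebesgue. 1 * (norm (v x - of_real \<mu> * u x))\<^sup>2)
          + (LINT x|lebesgue. \<psi> x * (norm (u x))\<^sup>2))"
      by (intro tendsto_mult tendsto_const tendsto_add limG limW psi)
          (use \<psi> in \<open>auto simp: abs_le_iff intro: order_trans[of _ 0]\<close>)
  qed (use ineq in blast)
  thus ?thesis by simp
qed

end

section \<open>A continuous weight supported in a periodic set\<close>

text \<open>A continuous function on the torus that separates the image of a point of \<open>\<Omega>\<close> from the image of
  the complement of \<open>\<Omega>\<close> in a cell. The two images are disjoint because \<open>\<Omega>\<close> is invariant under the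
  periods.\<close>

lemma ex_periodic_weight:
  fixes \<Omega> :: "(real ^ 'n) set"
  assumes ne: "\<Omega> \<noteq> {}" and op: "open \<Omega>"
    and inv: "\<And>k :: int ^ 'n. (\<lambda>x. x + (\<chi> j. 2 * pi * of_int (k $ j))) ` \<Omega> = \<Omega>"
  shows "\<exists>\<psi> x0. periodic_weight \<psi> x0 \<and> (\<forall>x. x \<notin> \<Omega> \<longrightarrow> \<psi> x = 0)"
proof -
  obtain x0 where x0: "x0 \<in> \<Omega>" using ne by blast
  have shift: "x + (\<chi> j. 2 * pi * of_int (k $ j)) \<in> \<Omega>" if "x \<in> \<Omega>" for x and k :: "int ^ 'n"
    using inv[of k] that by blast
  have congruent: "y \<in> \<Omega>" if "x \<in> \<Omega>" "torus_map 1 x = torus_map 1 y" for x y :: "real ^ 'n"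
  proof -
    have "\<forall>j. \<exists>k::int. y $ j = x $ j + 2 * pi * of_int k"
    proof
      fix j
      have "cis (x $ j) = cis (y $ j)" using that(2) by (simp add: torus_map_def vec_eq_iff)
      hence "sin (y $ j) = sin (x $ j) \<and> cos (y $ j) = cos (x $ j)" by (simp add: complex_eq_iff)
      thus "\<exists>k::int. y $ j = x $ j + 2 * pi * of_int k" by (simp add: sin_cos_eq_iff)
    qed
    then obtain k :: "'n \<Rightarrow> int" where k: "\<And>j. y $ j = x $ j + 2 * pi * of_int (k j)" by metis
    have "y = x + (\<chi> j. 2 * pi * of_int ((\<chi> j. k j) $ j))" by (simp add: vec_eq_iff k)
    thus ?thesis using shift[OF that(1)] by metis
  qed
  have representative: "\<exists>y\<in>cell 1. torus_map 1 y = torus_map 1 x" for x :: "real ^ 'n"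
  proof
    define k where "k j = \<lfloor>(x $ j + pi) / (2 * pi)\<rfloor>" for j
    let ?y = "(\<chi> j. x $ j - 2 * pi * of_int (k j)) :: real ^ 'n"
    have "of_int (k j) \<le> (x $ j + pi) / (2 * pi)" "(x $ j + pi) / (2 * pi) < of_int (k j) + 1" for j
      unfolding k_def by linarith+
    hence "2 * pi * of_int (k j) \<le> x $ j + pi" "x $ j + pi < 2 * pi * of_int (k j) + 2 * pi" for j
      using pi_gt_zero by (simp_all add: field_simps)
    hence "- pi \<le> ?y $ j" "?y $ j \<le> pi" for j using less_imp_le by (fastforce simp: algebra_simps)+
    thus "?y \<in> cell 1" by (simp add: cell_def mem_box_cart)
    show "torus_map 1 ?y = torus_map 1 x"
      by (simp add: torus_map_def vec_eq_iff cis_divide[symmetric] cis_multiple_2pi)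
  qed
  let ?S = "torus_map 1 ` (cell 1 - \<Omega>)"
  have "compact (cell 1 - \<Omega>)" using compact_cell op by (rule compact_diff)
  hence S: "closed ?S" by (intro compact_imp_closed compact_continuous_image continuous_on_torus_map)
  have "torus_map 1 x0 \<notin> ?S" using congruent[OF x0] by auto
  then obtain h :: "complex ^ 'n \<Rightarrow> real" where h: "continuous_on UNIV h" "\<And>z. h z \<in> closed_segment 1 0"
     "h (torus_map 1 x0) = 1" "\<And>z. z \<in> ?S \<Longrightarrow> h z = 0"
    using Urysohn[of "{torus_map 1 x0}" ?S 1 0] S by auto
  have h01: "0 \<le> h z" "h z \<le> 1" for z using h(2)[of z] by (auto simp: closed_segment_eq_real_ivl)
  define \<psi> where "\<psi> x = h (torus_map 1 x)" for x :: "real ^ 'n"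
  have "periodic_weight \<psi> x0"
  proof
    show "continuous_on UNIV \<psi>" unfolding \<psi>_def
      by (intro continuous_on_compose2[OF h(1)] continuous_intros) auto
    show "0 \<le> \<psi> x" "\<psi> x \<le> 1" "0 < \<psi> x0" for x using h01 h(3) by (auto simp: \<psi>_def)
    show "\<exists>F c. finite F \<and> F \<subseteq> lattice 1 \<and> (\<forall>x. norm (complex_of_real (\<psi> x) - trig F c x) \<le> \<eta>)" if "\<eta> > 0"
        for \<eta>
      unfolding \<psi>_def by (rule trig_approximation[OF _ continuous_on_subset[OF h(1)] that]) auto
  qed
  moreover have "\<psi> x = 0" if x: "x \<notin> \<Omega>" for x
  proof -
    obtain y where y: "y \<in> cell 1" "torus_map 1 y = torus_map 1 x" using representative by blast
    have "y \<notin> \<Omega>" using congruent[of y x] y x by blast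
    hence "torus_map 1 x \<in> ?S" using y by (metis DiffI imageI)
    thus ?thesis by (simp add: \<psi>_def h(4))
  qed
  ultimately show ?thesis by blast
qed

section \<open>The resolvent estimate\<close>

text \<open>Here \<open>U\<close>, \<open>F\<close> and \<open>X\<close> are the integrals of \<open>|u|\<^sup>2\<close>, \<open>|f|\<^sup>2\<close> and \<open>\<gamma> * |u|\<^sup>2\<close>, and \<open>I\<close> is that of
  \<open>f * cnj u\<close>. If \<open>s\<^sup>2 \<le> m / 2\<close>, the real part of the energy identity suffices. Otherwise
  \<open>X \<le> (2 * s\<^sup>2 / m) * X\<close>, so \<open>key\<close> bounds \<open>U\<close> through \<open>s\<^sup>2 * X\<close>; by the imaginary part this is at
  most \<open>|s| * |I|\<close>, and half of \<open>U\<close> can be absorbed.\<close>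

lemma damped_resolvent_bound:
  fixes m s C X U F B \<epsilon> :: real and I :: complex
  assumes m: "m > 0" and C: "C > 0" and \<epsilon>: "\<epsilon> > 0" and B: "B \<ge> 0" and X: "X \<ge> 0"
    and I: "\<And>\<delta>. \<delta> > 0 \<Longrightarrow> norm I \<le> \<delta> / 2 * F + 1 / (2 * \<delta>) * U" and F: "F \<ge> 0"
    and im: "Im I = s * X" and re: "Re I + (s\<^sup>2 - m) * U \<ge> 0" and U: "U \<ge> 0"
    and key: "U \<le> C * (2 * F + 2 * s\<^sup>2 * B * X + X / \<epsilon>)"
  shows "U \<le> (4 * C + (C * (2 * B + 2 / (m * \<epsilon>)))\<^sup>2 + 4 / m\<^sup>2) * (1 + \<bar>s\<bar>)\<^sup>2 * F"
proof -
  define K where "K = 2 * B + 2 / (m * \<epsilon>)"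
  have K: "K > 0" using B m \<epsilon> by (simp add: K_def add_nonneg_pos)
  let ?D = "4 * C + (C * K)\<^sup>2 + 4 / m\<^sup>2"
  have one: "1 \<le> (1 + \<bar>s\<bar>)\<^sup>2" "s\<^sup>2 \<le> (1 + \<bar>s\<bar>)\<^sup>2"
    using power_mono[of 1 "1 + \<bar>s\<bar>" 2] power_mono[of "\<bar>s\<bar>" "1 + \<bar>s\<bar>" 2] by auto
  have "U \<le> ?D * (1 + \<bar>s\<bar>)\<^sup>2 * F"
  proof (cases "s\<^sup>2 \<le> m / 2")
    case True
    \<comment> \<open>With \<open>\<delta> = 2 / m\<close> the term \<open>m / 4 * U\<close> is absorbed.\<close>
    have "m / 2 * U \<le> (m - s\<^sup>2) * U" using True U by (intro mult_right_mono) auto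
    also have "\<dots> \<le> Re I" using re by (simp add: algebra_simps)
    also have "\<dots> \<le> norm I" by (rule complex_Re_le_cmod)
    also have "\<dots> \<le> 1 / m * F + m / 4 * U" using I[of "2 / m"] m by simp
    finally have "m / 4 * U \<le> 1 / m * F" by (simp add: field_simps)
    hence "U \<le> 4 / m\<^sup>2 * F" using m by (simp add: field_simps power2_eq_square)
    also have "\<dots> \<le> ?D * (1 + \<bar>s\<bar>)\<^sup>2 * F"
    proof (intro mult_right_mono F)
      have "4 / m\<^sup>2 * 1 \<le> ?D * (1 + \<bar>s\<bar>)\<^sup>2" using C one by (intro mult_mono) auto
      thus "4 / m\<^sup>2 \<le> ?D * (1 + \<bar>s\<bar>)\<^sup>2" by simp
    qed
    finally show ?thesis .
  next
    case False
    hence s: "\<bar>s\<bar> > 0" using m by auto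
    \<comment> \<open>chosen so that the coefficient of \<open>U\<close> on the right becomes \<open>1 / 2\<close>\<close>
    define \<delta> where "\<delta> = C * K * \<bar>s\<bar>"
    have \<delta>: "\<delta> > 0" using C K s by (simp add: \<delta>_def)
    have sX: "\<bar>s\<bar> * X \<le> norm I" using abs_Im_le_cmod[of I] X by (simp add: im abs_mult)
    have "1 * X \<le> (2 * s\<^sup>2 / m) * X" using False X m by (intro mult_right_mono) (auto simp: field_simps)
    hence "X / \<epsilon> \<le> 2 / (m * \<epsilon>) * (s\<^sup>2 * X)" using \<epsilon> by (simp add: field_simps)
    hence "2 * F + 2 * s\<^sup>2 * B * X + X / \<epsilon> \<le> 2 * F + K * (s\<^sup>2 * X)" by (simp add: K_def algebra_simps)
    hence "U \<le> C * (2 * F + K * (s\<^sup>2 * X))" using key C by (meson mult_left_mono less_imp_le order_trans)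
    also have "\<dots> = 2 * C * F + \<delta> * (\<bar>s\<bar> * X)"
        by (simp add: \<delta>_def algebra_simps power2_eq_square flip: abs_mult)
    also have "\<dots> \<le> 2 * C * F + \<delta> * (\<delta> / 2 * F + 1 / (2 * \<delta>) * U)"
      using order_trans[OF sX I[OF \<delta>]] \<delta> by (intro add_left_mono mult_left_mono) auto
    also have "\<dots> = 2 * C * F + \<delta>\<^sup>2 / 2 * F + U / 2" using \<delta> by (simp add: field_simps power2_eq_square)
    finally have "U \<le> (4 * C + (C * K)\<^sup>2 * s\<^sup>2) * F" by (simp add: \<delta>_def power_mult_distrib algebra_simps)
    also have "\<dots> \<le> ?D * (1 + \<bar>s\<bar>)\<^sup>2 * F"
    proof (intro mult_right_mono F)
      have "4 * C * 1 + (C * K)\<^sup>2 * s\<^sup>2 \<le> 4 * C * (1 + \<bar>s\<bar>)\<^sup>2 + (C * K)\<^sup>2 * (1 + \<bar>s\<bar>)\<^sup>2"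
        using one C by (intro add_mono mult_left_mono) auto
      also have "\<dots> \<le> ?D * (1 + \<bar>s\<bar>)\<^sup>2" by (simp add: distrib_right)
      finally show "4 * C + (C * K)\<^sup>2 * s\<^sup>2 \<le> ?D * (1 + \<bar>s\<bar>)\<^sup>2" by simp
    qed
    finally show ?thesis .
  qed
  thus ?thesis by (simp add: K_def)
qed

theorem theorem3:
  fixes m :: real and \<gamma> :: "real ^ 'n \<Rightarrow> real"
  assumes "m > 0"
    and "\<gamma> \<in> Linfty"
    and "AE x in lebesgue. \<gamma> x \<ge> 0"
    and "\<exists>\<epsilon>>0. \<exists>\<Omega>. \<Omega> \<noteq> {} \<and> open \<Omega> \<and>
           (\<forall>k :: int ^ 'n. (\<lambda>x. x + (\<chi> j. 2 * pi * of_int (k $ j))) ` \<Omega> = \<Omega>) \<and>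
           (AE x in lebesgue. x \<in> \<Omega> \<longrightarrow> \<gamma> x \<ge> \<epsilon>)"
  shows "\<exists>C>0. \<forall>s :: real. \<forall>u\<in>sobolev 2. \<forall>f\<in>L2. \<forall>v.
           is_laplacian u v \<longrightarrow>
           (AE x in lebesgue. v x + of_real m * u x + \<i> * of_real s * of_real (\<gamma> x) * u x
               - (of_real s)\<^sup>2 * u x = f x) \<longrightarrow>
           L2_norm u \<le> C * (1 + \<bar>s\<bar>) * L2_norm f"
proof -
  obtain \<epsilon> \<Omega> where \<epsilon>: "\<epsilon> > 0" and \<Omega>: "\<Omega> \<noteq> {}" "open \<Omega>"
      "\<And>k :: int ^ 'n. (\<lambda>x. x + (\<chi> j. 2 * pi * of_int (k $ j))) ` \<Omega> = \<Omega>"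
    and \<gamma>\<Omega>: "AE x in lebesgue. x \<in> \<Omega> \<longrightarrow> \<gamma> x \<ge> \<epsilon>"
    using assms(4) by blast
  obtain \<psi> x0 where "periodic_weight \<psi> x0" and \<psi>\<Omega>: "\<And>x. x \<notin> \<Omega> \<Longrightarrow> \<psi> x = 0"
    using ex_periodic_weight[OF \<Omega>] by blast
  then interpret periodic_weight \<psi> x0 by simp
  note weight_nonneg = nonneg
  obtain C where C: "C > 0" and cell: "\<And>N \<mu> w G. N > 0 \<Longrightarrow> w \<in> cell_l2 N \<Longrightarrow> G \<in> cell_l2 N \<Longrightarrow>
     (\<forall>k\<in>lattice N. fourier N G k = (of_real ((norm k)\<^sup>2) - of_real \<mu>) * fourier N w k) \<Longrightarrow>
     msq N w \<le> C * (msq N G + mean N (\<lambda>x. \<psi> x * (norm (w x))\<^sup>2))"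
    using cell_estimate by blast
  obtain b Bc where b: "cutoff b Bc" "Bc \<ge> 1" using ex_cutoff by blast
  have \<gamma>_meas: "\<gamma> \<in> borel_measurable lebesgue" using assms(2) by (simp add: Linfty_def)
  obtain B0 where B0: "AE x in lebesgue. \<bar>\<gamma> x\<bar> \<le> B0" using assms(2) by (auto simp: Linfty_def)
  define B where "B = max 0 B0"
  have B_nonneg: "B \<ge> 0" by (simp add: B_def)
  \<comment> \<open>A representative of the damping whose bounds hold everywhere, so that integrability and estimates
  need no exceptional sets.\<close>
  define d where "d x = min B (max 0 (\<gamma> x))" for x
  have d_meas [measurable]: "d \<in> borel_measurable lebesgue" unfolding d_def[abs_def] using \<gamma>_meas
      by measurable
  have d_bounds: "0 \<le> d x" "d x \<le> B" for x using B_nonneg by (auto simp: d_def)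
  have d_eq: "AE x in lebesgue. d x = \<gamma> x"
    using B0 assms(3) by eventually_elim (auto simp: d_def B_def)
  define D where "D = 4 * C + (C * (2 * B + 2 / (m * \<epsilon>)))\<^sup>2 + 4 / m\<^sup>2"
  have D: "D > 0" using C by (auto simp: D_def intro!: add_pos_nonneg)
  have "L2_norm u \<le> sqrt D * (1 + \<bar>s\<bar>) * L2_norm f"
    if u: "u \<in> sobolev 2" and f: "f \<in> L2" and lap: "is_laplacian u v'" and
     eq: "AE x in lebesgue. v' x + of_real m * u x + \<i> * of_real s * of_real (\<gamma> x) * u x
         - (of_real s)\<^sup>2 * u x = f x"
    for s u f v'
  proof -
    have u2: "u \<in> l2 lebesgue" using u by (simp add: numeral_2_eq_2 L2_eq_l2)
    have f2: "f \<in> l2 lebesgue" using f by (simp add: L2_eq_l2)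
    have du: "(\<lambda>x. of_real (d x) * u x) \<in> l2 lebesgue"
      by (rule l2_mult_bounded[OF u2, where B=B]) (use d_bounds in auto)
    \<comment> \<open>The equation exhibits the Laplacian as a square-integrable function.\<close>
    define v where "v x = f x + of_real (s\<^sup>2 - m) * u x - \<i> * of_real s * (of_real (d x) * u x)" for x
    have v2: "v \<in> l2 lebesgue" unfolding v_def[abs_def] by (intro l2_diff l2_add l2_cmult f2 u2 du)
    have "AE x in lebesgue. v' x = v x"
      using eq d_eq by eventually_elim (simp add: v_def algebra_simps)
    then obtain g where "weak_laplacian u v g"
      using weak_laplacian_sobolev[OF u lap] v2 by (auto simp: L2_eq_l2)
    then interpret truncated_laplacian u v g b Bc
      by (intro truncated_laplacian.intro truncated_laplacian_axioms.intro b)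
    define U where "U = (LINT x|lebesgue. (norm (u x))\<^sup>2)"
    define F where "F = (LINT x|lebesgue. (norm (f x))\<^sup>2)"
    define X where "X = (LINT x|lebesgue. d x * (norm (u x))\<^sup>2)"
    define I where "I = (LINT x|lebesgue. f x * cnj (u x))"
    have Uint: "integrable lebesgue (\<lambda>x. (norm (u x))\<^sup>2)" by (rule l2D(2)[OF u2])
    have Fint: "integrable lebesgue (\<lambda>x. (norm (f x))\<^sup>2)" by (rule l2D(2)[OF f2])
    have Xint: "integrable lebesgue (\<lambda>x. d x * (norm (u x))\<^sup>2)"
    proof (rule Bochner_Integration.integrable_bound[where f="\<lambda>x. B * (norm (u x))\<^sup>2"])
      show "(\<lambda>x. d x * (norm (u x))\<^sup>2) \<in> borel_measurable lebesgue" using l2D(1)[OF u2] by measurable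
      show "AE x in lebesgue. norm (d x * (norm (u x))\<^sup>2) \<le> norm (B * (norm (u x))\<^sup>2)"
        using d_bounds B_nonneg by (auto simp: abs_mult intro!: AE_I2 mult_right_mono)
    qed (use Uint in auto)
    have Iint: "integrable lebesgue (\<lambda>x. f x * cnj (u x))" by (intro l2_mult_integrable f2 l2_cnj u2)
    have nonneg: "U \<ge> 0" "F \<ge> 0" "X \<ge> 0"
      using d_bounds by (auto simp: U_def F_def X_def intro!: Bochner_Integration.integral_nonneg)
    have energy: "(LINT x|lebesgue. v x * cnj (u x)) = I + of_real (s\<^sup>2 - m) * of_real U
        - \<i> * of_real s * of_real X"
    proof -
      have "v x * cnj (u x) = f x * cnj (u x) + of_real (s\<^sup>2 - m) * complex_of_real ((norm (u x))\<^sup>2)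
          - \<i> * of_real s * complex_of_real (d x * (norm (u x))\<^sup>2)" for x
        unfolding v_def of_real_mult complex_norm_square by (simp add: algebra_simps)
      hence "(LINT x|lebesgue. v x * cnj (u x)) = (LINT x|lebesgue. f x * cnj (u x) + of_real (s\<^sup>2 - m) *
          complex_of_real ((norm (u x))\<^sup>2) - \<i> * of_real s * complex_of_real (d x * (norm (u x))\<^sup>2))"
        by (simp only:)
      also have "\<dots> = I + of_real (s\<^sup>2 - m) * (LINT x|lebesgue. complex_of_real ((norm (u x))\<^sup>2))
          - \<i> * of_real s * (LINT x|lebesgue. complex_of_real (d x * (norm (u x))\<^sup>2))"
        unfolding I_def using Iint integrable_of_real[OF Uint, where 'a=complex]
            integrable_of_real[OF Xint, where 'a=complex]
        by (simp only: Bochner_Integration.integral_diff Bochner_Integration.integral_add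
            Bochner_Integration.integrable_add
            integrable_mult_right integral_mult_right_zero)
      also have "(LINT x|lebesgue. complex_of_real ((norm (u x))\<^sup>2)) = complex_of_real U"
        unfolding U_def by (rule integral_complex_of_real)
      also have "(LINT x|lebesgue. complex_of_real (d x * (norm (u x))\<^sup>2)) = complex_of_real X"
        unfolding X_def by (rule integral_complex_of_real)
      finally show ?thesis .
    qed
    have im: "Im I = s * X" using integral_mult_cnj_laplacian(1) by (simp add: energy)
    have re: "Re I + (s\<^sup>2 - m) * U \<ge> 0" using integral_mult_cnj_laplacian(2) by (simp add: energy)
    have norm_I: "norm I \<le> \<delta> / 2 * F + 1 / (2 * \<delta>) * U" if "\<delta> > 0" for \<delta>
      using norm_integral_mult_le[OF f2 l2_cnj[OF u2] that] by (simp add: I_def F_def U_def)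
    have "U \<le> C * ((LINT x|lebesgue. (norm (v x - of_real (s\<^sup>2 - m) * u x))\<^sup>2)
        + (LINT x|lebesgue. \<psi> x * (norm (u x))\<^sup>2))"
      unfolding U_def by (rule whole_space_estimate[OF cell continuous weight_nonneg le_one])
    also have "\<dots> \<le> C * ((2 * F + 2 * s\<^sup>2 * B * X) + X / \<epsilon>)"
    proof (intro mult_left_mono add_mono)
      have "(LINT x|lebesgue. (norm (v x - of_real (s\<^sup>2 - m) * u x))\<^sup>2)
          \<le> (LINT x|lebesgue. 2 * (norm (f x))\<^sup>2 + 2 * s\<^sup>2 * B * (d x * (norm (u x))\<^sup>2))"
      proof (rule integral_mono)
        show "integrable lebesgue (\<lambda>x. (norm (v x - of_real (s\<^sup>2 - m) * u x))\<^sup>2)"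
          by (intro l2D(2) l2_diff v2 l2_cmult u2)
        show "integrable lebesgue (\<lambda>x. 2 * (norm (f x))\<^sup>2 + 2 * s\<^sup>2 * B * (d x * (norm (u x))\<^sup>2))"
          by (intro Bochner_Integration.integrable_add integrable_mult_right Fint Xint)
        fix x
        have "v x - of_real (s\<^sup>2 - m) * u x = f x + (- \<i> * of_real (s * d x) * u x)" by (simp add: v_def)
        hence "(norm (v x - of_real (s\<^sup>2 - m) * u x))\<^sup>2 \<le> 2 * (norm (f x))\<^sup>2
            + 2 * (norm (- \<i> * of_real (s * d x) * u x))\<^sup>2"
          using norm_add_squared_le[of "f x" "- \<i> * of_real (s * d x) * u x"] by (simp only:)
        also have "(norm (- \<i> * of_real (s * d x) * u x))\<^sup>2 = s\<^sup>2 * (d x * (d x * (norm (u x))\<^sup>2))"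
          by (simp add: norm_mult power_mult_distrib power2_eq_square mult_ac)
        also have "\<dots> \<le> s\<^sup>2 * (B * (d x * (norm (u x))\<^sup>2))"
          using d_bounds by (intro mult_left_mono mult_right_mono) auto
        finally show "(norm (v x - of_real (s\<^sup>2 - m) * u x))\<^sup>2 \<le> 2 * (norm (f x))\<^sup>2
            + 2 * s\<^sup>2 * B * (d x * (norm (u x))\<^sup>2)"
          by (simp add: mult_ac)
      qed
      also have "\<dots> = 2 * F + 2 * s\<^sup>2 * B * X"
        unfolding F_def X_def using Fint Xint
        by (simp only: Bochner_Integration.integral_add integrable_mult_right integral_mult_right_zero)
      finally show "(LINT x|lebesgue. (norm (v x - of_real (s\<^sup>2 - m) * u x))\<^sup>2) \<le> 2 * F + 2 * s\<^sup>2 * B * X"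
          .
      have "(LINT x|lebesgue. \<psi> x * (norm (u x))\<^sup>2) \<le> (LINT x|lebesgue. 1 / \<epsilon> * (d x * (norm (u x))\<^sup>2))"
      proof (rule integral_mono_AE)
        have [measurable]: "\<psi> \<in> borel_measurable lebesgue"
          using borel_measurable_continuous_onI[OF continuous] by (simp add: measurable_completion)
        show "integrable lebesgue (\<lambda>x. \<psi> x * (norm (u x))\<^sup>2)"
        proof (rule Bochner_Integration.integrable_bound[OF Uint])
          show "(\<lambda>x. \<psi> x * (norm (u x))\<^sup>2) \<in> borel_measurable lebesgue" using l2D(1)[OF u2] by measurable
          show "AE x in lebesgue. norm (\<psi> x * (norm (u x))\<^sup>2) \<le> norm ((norm (u x))\<^sup>2)"
            using weight_nonneg le_one by (auto simp: abs_mult intro!: AE_I2 mult_left_le_one_le)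
        qed
        show "integrable lebesgue (\<lambda>x. 1 / \<epsilon> * (d x * (norm (u x))\<^sup>2))"
            by (intro integrable_mult_right Xint)
        show "AE x in lebesgue. \<psi> x * (norm (u x))\<^sup>2 \<le> 1 / \<epsilon> * (d x * (norm (u x))\<^sup>2)"
          using \<gamma>\<Omega> d_eq
        proof eventually_elim
          case (elim x)
          have "\<psi> x \<le> 1 / \<epsilon> * d x"
          proof (cases "x \<in> \<Omega>")
            case True
            hence "1 \<le> 1 / \<epsilon> * d x" using elim \<epsilon> by (simp add: field_simps)
            thus ?thesis using le_one order_trans by blast
          qed (use \<psi>\<Omega> d_bounds \<epsilon> in auto)
          hence "\<psi> x * (norm (u x))\<^sup>2 \<le> (1 / \<epsilon> * d x) * (norm (u x))\<^sup>2" by (rule mult_right_mono) simp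
          thus ?case by (simp only: mult.assoc)
        qed
      qed
      thus "(LINT x|lebesgue. \<psi> x * (norm (u x))\<^sup>2) \<le> X / \<epsilon>" by (simp add: X_def)
    qed (use C in simp)
    finally have "U \<le> C * (2 * F + 2 * s\<^sup>2 * B * X + X / \<epsilon>)" .
    from damped_resolvent_bound[OF assms(1) C \<epsilon> B_nonneg nonneg(3) norm_I nonneg(2) im re nonneg(1) this]
    have "U \<le> D * (1 + \<bar>s\<bar>)\<^sup>2 * F" by (simp add: D_def)
    hence "sqrt U \<le> sqrt (D * (1 + \<bar>s\<bar>)\<^sup>2 * F)" by simp
    also have "\<dots> = sqrt D * (1 + \<bar>s\<bar>) * sqrt F" by (simp add: real_sqrt_mult)
    finally show ?thesis by (simp add: L2_norm_def U_def F_def)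
  qed
  moreover have "sqrt D > 0" using D by simp
  ultimately show ?thesis by blast
qed

end
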